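(* Let $m\ge 0$ and let $a_0,\dots,a_m\in\mathcal{C}^\infty_b(\mathbb{T}^2)$, where $\mathbb{T}^2=\mathbb{R}^2/\mathbb{Z}^2$ (each $a_k$ viewed as a $\mathbb{Z}^2$-periodic smooth function on $\mathbb{R}^2$). For $\vartheta\in\mathbb{R}$ and $y=(y_1,y_2)\in\mathbb{T}^2$ define $$A_{\vartheta,y}=\sum_{k=0}^m a_k(x+y_1,\vartheta x+y_2)\frac{d^k}{dx^k},\qquad A_\vartheta=A_{\vartheta,0},$$ and assume these are self-adjoint elliptic operators on $L^2(\mathbb{R})$. Set $$\Sigma(A_\vartheta):=\bigcup_{y\in\mathbb{T}^2}\sigma(A_{\vartheta,y}).$$ Let $\theta\in\mathbb{R}$. There exists $C>0$ such that for every $\theta'\in\mathbb{R}$ with $|\theta-\theta'|$ sufficiently small and every $\lambda\in\Sigma(A_\theta)$, $$d\big(\lambda,\Sigma(A_{\theta'})\big)\le C(1+|\lambda|)\,|\theta-\theta'|^{1/2}.$$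
   Context: $\sigma(\cdot)$ denotes the spectrum on $L^2(\mathbb{R})$ and $d(\lambda,S)=\inf_{s\in S}|\lambda-s|$. *)

theory Defs
  imports "HOL-Analysis.Analysis"
begin

definition vderiv :: "(real \<Rightarrow> complex) \<Rightarrow> real \<Rightarrow> complex" where
  "vderiv f = (\<lambda>x. vector_derivative f (at x))"

definition test_fun :: "(real \<Rightarrow> complex) \<Rightarrow> bool" where
  "test_fun \<phi> \<longleftrightarrow> (\<forall>k x. ((vderiv ^^ k) \<phi>) differentiable (at x)) \<and> bounded {x. \<phi> x \<noteq> 0}"

fun Ck2 :: "nat \<Rightarrow> (real \<times> real \<Rightarrow> complex) \<Rightarrow> bool" where
  "Ck2 0 f = continuous_on UNIV f"
| "Ck2 (Suc k) f = ((\<forall>p. f differentiable (at p)) \<and>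
      Ck2 k (\<lambda>p. frechet_derivative f (at p) (1, 0)) \<and>
      Ck2 k (\<lambda>p. frechet_derivative f (at p) (0, 1)))"

definition smooth2 :: "(real \<times> real \<Rightarrow> complex) \<Rightarrow> bool" where
  "smooth2 f \<longleftrightarrow> (\<forall>k. Ck2 k f)"

definition periodic2 :: "(real \<times> real \<Rightarrow> complex) \<Rightarrow> bool" where
  "periodic2 f \<longleftrightarrow> (\<forall>x y. f (x + 1, y) = f (x, y) \<and> f (x, y + 1) = f (x, y))"

definition L2 :: "(real \<Rightarrow> complex) \<Rightarrow> bool" where
  "L2 f \<longleftrightarrow> f \<in> borel_measurable lborel \<and> integrable lborel (\<lambda>x. (cmod (f x))\<^sup>2)"

definition l2inner :: "(real \<Rightarrow> complex) \<Rightarrow> (real \<Rightarrow> complex) \<Rightarrow> complex" where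
  "l2inner f g = (LINT x|lborel. f x * cnj (g x))"

definition weak_derivs :: "nat \<Rightarrow> (real \<Rightarrow> complex) \<Rightarrow> (nat \<Rightarrow> real \<Rightarrow> complex) \<Rightarrow> bool" where
  "weak_derivs m u v \<longleftrightarrow> v 0 = u \<and> (\<forall>j\<le>m. L2 (v j)) \<and>
     (\<forall>j. 1 \<le> j \<and> j \<le> m \<longrightarrow> (\<forall>\<phi>. test_fun \<phi> \<longrightarrow>
        (LINT x|lborel. u x * (vderiv ^^ j) \<phi> x) = (-1) ^ j * (LINT x|lborel. v j x * \<phi> x)))"

(* graph of the operator A_{t,y} = \<Sum>_{k\<le>m} a_k(x+y1, t x + y2) d^k/dx^k on L^2(R),
   domain H^m(R); pairs (u, A u), with A u given up to a.e. equality *)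
definition op_graph :: "(nat \<Rightarrow> real \<times> real \<Rightarrow> complex) \<Rightarrow> nat \<Rightarrow> real \<Rightarrow> real \<times> real
    \<Rightarrow> ((real \<Rightarrow> complex) \<times> (real \<Rightarrow> complex)) set" where
  "op_graph a m t y = {(u, f). L2 f \<and> (\<exists>v. weak_derivs m u v \<and>
      (AE x in lborel. f x = (\<Sum>k\<le>m. a k (x + fst y, t * x + snd y) * v k x)))}"

definition self_adjoint_graph :: "((real \<Rightarrow> complex) \<times> (real \<Rightarrow> complex)) set \<Rightarrow> bool" where
  "self_adjoint_graph G \<longleftrightarrow>
     (\<forall>(u, f)\<in>G. \<forall>(w, g)\<in>G. l2inner f w = l2inner u g) \<and>
     (\<forall>w g. L2 w \<and> L2 g \<and> (\<forall>(u, f)\<in>G. l2inner f w = l2inner u g) \<longrightarrow> (w, g) \<in> G)"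

definition spec_graph :: "((real \<Rightarrow> complex) \<times> (real \<Rightarrow> complex)) set \<Rightarrow> complex set" where
  "spec_graph G = {z. \<not> ((\<forall>(u, f)\<in>G. (AE x in lborel. f x = z * u x) \<longrightarrow> (AE x in lborel. u x = 0)) \<and>
                         (\<forall>g. L2 g \<longrightarrow> (\<exists>(u, f)\<in>G. AE x in lborel. f x - z * u x = g x)))}"

(* \<Sigma>(A_t) = union over y of \<sigma>(A_{t,y}); y ranges over R^2, which by periodicity
   gives the same union as y over T^2 *)
definition Sigma_spec :: "(nat \<Rightarrow> real \<times> real \<Rightarrow> complex) \<Rightarrow> nat \<Rightarrow> real \<Rightarrow> complex set" where
  "Sigma_spec a m t = (\<Union>y. spec_graph (op_graph a m t y))"

end

theory Submission
  imports Defs "HOL-Computational_Algebra.Polynomial"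
begin

text \<open>
  Let \<open>z\<close> be in the spectrum of \<open>A = A\<^bsub>\<theta>,y\<^esub>\<close> and let \<open>u\<close> be an approximate eigenfunction. Put
  \<open>L = \<bar>\<theta> - \<theta>'\<bar> powr (- 1/2)\<close> and multiply \<open>u\<close> by a Gaussian \<open>\<chi>\<^sub>s\<close> of width \<open>L\<close> centred at \<open>s\<close>. With
  \<open>y\<^sub>s = (y\<^sub>1, y\<^sub>2 + (\<theta> - \<theta>') s)\<close> the coefficients of \<open>A\<close> and of \<open>A' = A\<^bsub>\<theta>',y\<^sub>s\<^esub>\<close> agree at \<open>s\<close>, so on the
  essential support of \<open>\<chi>\<^sub>s\<close> they differ by \<open>O(\<bar>\<theta> - \<theta>'\<bar> L) = O(1/L)\<close>; the commutator of \<open>A'\<close> with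
  \<open>\<chi>\<^sub>s\<close> is \<open>O(1/L)\<close> as well. If \<open>z\<close> has distance \<open>d\<close> from all the spectra of the \<open>A'\<close>, then \<open>d\<close> times the
  norm of \<open>\<chi>\<^sub>s u\<close> is at most the norm of \<open>(A' - z) (\<chi>\<^sub>s u)\<close>. Squaring and integrating over \<open>s\<close> removes the
  cutoff and leaves \<open>d = O((1 + \<bar>z\<bar>) / L)\<close>, by the elliptic estimate
  \<open>\<parallel>u\<^sup>(\<^sup>k\<^sup>)\<parallel> \<le> K (\<parallel>u\<parallel> + \<parallel>A u\<parallel>)\<close>.

  That estimate is the open mapping theorem for the map from tuples of weak derivatives onto the
  graph of \<open>A\<close>, which is closed since \<open>A\<close> is self-adjoint; compactness of the torus makes it uniform in \<open>y\<close>.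
\<close>

section \<open>Linear relations on a Hilbert space\<close>

text \<open>An approximate eigenfunction may spread its mass anywhere, and near a fixed centre its
  derivatives may dwarf its values; averaging over all centres replaces the choice of a good one.
  Every centre \<open>s\<close> calls for its own base point, so the gap is needed for all the
  \<open>A'\<close> at once: this is why the spectra are united over \<open>y\<close>. The
  coefficient mismatch grows with \<open>L\<close> while the commutator decays; balancing them fixes
  \<open>L\<close> and produces the exponent 1/2. A Gaussian has explicit derivatives, and its decay
  absorbs the mismatch, which is linear in the distance from \<open>s\<close>.

  The lower bound by \<open>d\<close> is obtained without the spectral theorem: were it violated,
  the reciprocal of the norm of the inverse, with one of its two signs, would be a singular point
  inside the gap. The elliptic estimate is obtained without solving for the top derivative, which
  would leave the intermediate derivatives to be interpolated; the open mapping argument bounds all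
  of them together.\<close>

lemma summable_geometric_half:
  fixes K :: real
  shows "summable (\<lambda>n. K * (1/2)^n)" "(\<Sum>n. K * (1/2)^n) = 2 * K"
proof -
  show "summable (\<lambda>n. K * (1/2::real)^n)"
    by (intro summable_mult summable_geometric) simp
  show "(\<Sum>n. K * (1/2::real)^n) = 2 * K"
    using suminf_mult[of "\<lambda>n. (1/2::real)^n" K] suminf_geometric[of "1/2::real"]
    by simp
qed

text \<open>A form of Zabreiko's lemma: \<open>P y r\<close> says that \<open>y\<close> has a lift of cost at most \<open>r\<close>.\<close>

lemma lift_bound:
  fixes S :: "'b::banach set" and P :: "'b \<Rightarrow> real \<Rightarrow> bool"
  assumes S: "subspace S" "closed S"
    and mono: "\<And>y r r'. P y r \<Longrightarrow> r \<le> r' \<Longrightarrow> P y r'"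
    and scale: "\<And>y r c. P y r \<Longrightarrow> P (c *\<^sub>R y) (\<bar>c\<bar> * r)"
    and sums: "\<And>y r x. (\<And>n. P (y n) (r n)) \<Longrightarrow> (\<And>n. 0 \<le> r n) \<Longrightarrow> y sums x \<Longrightarrow> summable r \<Longrightarrow> P x (suminf r)"
    and surj: "\<And>y. y \<in> S \<Longrightarrow> \<exists>r. P y r"
  obtains C where "C > 0" "\<And>y. y \<in> S \<Longrightarrow> P y (C * norm y)"
proof -
  \<comment> \<open>The sets of points liftable at cost \<open>n\<close> need not be closed, so the
    Baire category theorem is applied to their closures.\<close>
  define F where "F n = closure {y \<in> S. P y (real n)}" for n
  have S0: "0 \<in> S" using S(1) by (rule subspace_0)
  obtain r0 where "P 0 r0" using surj S0 by blast
  then have P0: "P 0 0" using scale[of 0 r0 0] by simp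
  \<comment> \<open>Finite additivity is countable additivity padded with the free lift
    \<open>P0\<close> of zero.\<close>
  have P_add: "P (y + w) (r + q)" if "P y r" "P w q" "0 \<le> r" "0 \<le> q" for y w r q
  proof -
    let ?y = "\<lambda>n::nat. if n = 0 then y else if n = 1 then w else 0"
    let ?r = "\<lambda>n::nat. if n = 0 then r else if n = 1 then q else 0"
    have y: "?y sums (y + w)" and r: "?r sums (r + q)"
      using sums_finite[of "{0,1}" ?y] sums_finite[of "{0,1}" ?r] by simp_all
    have "P (y + w) (suminf ?r)"
      using that P0 by (intro sums[OF _ _ y sums_summable[OF r]]) auto
    with r show ?thesis by (simp add: sums_iff)
  qed
  have FS: "F n \<subseteq> S" for n
    unfolding F_def using S(2) by (intro closure_minimal) auto
  have cover: "S \<subseteq> (\<Union>n. F n)"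
  proof
    fix y assume y: "y \<in> S"
    then obtain r where "P y r" using surj by blast
    then have "P y (real (nat \<lceil>r\<rceil>))" by (rule mono) linarith
    then have "y \<in> F (nat \<lceil>r\<rceil>)" unfolding F_def using y by (intro subsetD[OF closure_subset]) simp
    then show "y \<in> (\<Union>n. F n)" by blast
  qed
  have "\<exists>n. (top_of_set S) interior_of (F n) \<noteq> {}"
  proof (rule ccontr)
    assume "\<not> ?thesis"
    then have e: "\<And>n. (top_of_set S) interior_of (F n) = {}" by blast
    have "completely_metrizable_space (top_of_set S)"
      using S(2) by (intro completely_metrizable_space_closedin completely_metrizable_space_euclidean) auto
    then have "(top_of_set S) interior_of \<Union>(range F) = {}"
      using e FS by (intro Baire_category_alt) (auto simp: F_def closedin_closed_eq S(2))
    moreover have "\<Union>(range F) = S" using cover FS by blast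
    ultimately show False using S0 by (metis interior_of_topspace topspace_euclidean_subtopology empty_iff)
  qed
  then obtain n y0 where "y0 \<in> (top_of_set S) interior_of (F n)" by blast
  then obtain U where U: "openin (top_of_set S) U" "y0 \<in> U" "U \<subseteq> F n"
    unfolding interior_of_def by blast
  then obtain e where e: "e > 0" "\<And>y. y \<in> S \<Longrightarrow> dist y y0 < e \<Longrightarrow> y \<in> F n"
    by (meson openin_euclidean_subtopology_iff subsetD)
  have y0: "y0 \<in> S" "y0 \<in> F n" using U FS by blast+
  \<comment> \<open>Subtracting approximations of \<open>y0 + y\<close> and of \<open>y0\<close>
    moves the ball from \<open>y0\<close> to the origin and doubles the cost.\<close>
  have near: "\<exists>w \<in> S. P w (2 * real n) \<and> dist w y < d" if y: "y \<in> S" "norm y < e" and d: "d > 0" for y d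
  proof -
    have "y0 + y \<in> F n"
      using y y0 S(1) by (intro e) (auto simp: subspace_add dist_norm)
    then obtain p where p: "p \<in> S" "P p (real n)" "dist p (y0 + y) < d/2"
      unfolding F_def using d by (metis (no_types, lifting) closure_approachable half_gt_zero mem_Collect_eq)
    obtain q where q: "q \<in> S" "P q (real n)" "dist q y0 < d/2"
      using y0(2) unfolding F_def using d by (metis (no_types, lifting) closure_approachable half_gt_zero mem_Collect_eq)
    have "P (p + (-1) *\<^sub>R q) (real n + \<bar>-1\<bar> * real n)"
      using p q by (intro P_add scale) auto
    then have "P (p - q) (2 * real n)" by simp
    moreover have "dist (p - q) y < d"
    proof -
      have "norm ((p - (y0 + y)) - (q - y0)) \<le> norm (p - (y0 + y)) + norm (q - y0)"
        by (rule norm_triangle_ineq4)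
      then show ?thesis using p(3) q(3) by (simp add: dist_norm algebra_simps)
    qed
    ultimately show ?thesis using p(1) q(1) S(1) subspace_diff by blast
  qed
  \<comment> \<open>Shrinking or stretching \<open>y\<close> to norm \<open>e / 2\<close>
    contributes the factor \<open>2 * norm y / e\<close>, on top of the cost
    \<open>2 * real n\<close> inside the ball.\<close>
  define K where "K = 2 * (2 * real n) / e"
  have K0: "K \<ge> 0" using e(1) by (simp add: K_def)
  have halve: "\<exists>w \<in> S. P w (K * norm y) \<and> norm (y - w) \<le> norm y / 2" if y: "y \<in> S" for y
  proof (cases "y = 0")
    case True
    then show ?thesis using P0 S0 by (intro bexI[of _ 0]) auto
  next
    case False
    define c where "c = e / (2 * norm y)"
    have c: "c > 0" using False e(1) by (simp add: c_def)
    have "norm (c *\<^sub>R y) < e" using False e(1) by (simp add: c_def)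
    moreover have "c *\<^sub>R y \<in> S" using y S(1) by (simp add: subspace_scale)
    ultimately obtain w where w: "w \<in> S" "P w (2 * real n)" "dist w (c *\<^sub>R y) < c * norm y / 2"
      using near[of "c *\<^sub>R y" "c * norm y / 2"] c False by auto
    have "P ((1/c) *\<^sub>R w) (\<bar>1/c\<bar> * (2 * real n))" using w(2) by (rule scale)
    moreover have "\<bar>1/c\<bar> * (2 * real n) = K * norm y" using c e(1) by (simp add: c_def K_def)
    moreover have "norm (y - (1/c) *\<^sub>R w) \<le> norm y / 2"
    proof -
      have "y - (1/c) *\<^sub>R w = (1/c) *\<^sub>R (c *\<^sub>R y - w)" using c by (simp add: scaleR_diff_right)
      then have "norm (y - (1/c) *\<^sub>R w) = (1/c) * dist w (c *\<^sub>R y)"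
        using c by (simp add: dist_norm norm_minus_commute)
      also have "\<dots> \<le> (1/c) * (c * norm y / 2)" using w(3) c by (intro mult_left_mono) auto
      finally show ?thesis using c by simp
    qed
    ultimately show ?thesis using w(1) S(1) subspace_scale by metis
  qed
  then obtain w where w: "\<And>y. y \<in> S \<Longrightarrow> w y \<in> S \<and> P (w y) (K * norm y) \<and> norm (y - w y) \<le> norm y / 2"
    by metis
  \<comment> \<open>Iterated halving leaves residues dominated by a geometric series, so the exact
    lift costs \<open>2 * K * norm y\<close>. The added 1 keeps the final constant positive even
    when \<open>n = 0\<close>.\<close>
  have main: "P y ((2 * K + 1) * norm y)" if y: "y \<in> S" for y
  proof -
    define z where "z = rec_nat y (\<lambda>_ x. x - w x)"
    have z0: "z 0 = y" and zS: "\<And>k. z (Suc k) = z k - w (z k)" by (simp_all add: z_def)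
    have zin: "z k \<in> S" for k
      by (induction k) (use y w S(1) in \<open>auto simp: z0 zS subspace_diff\<close>)
    have zn: "norm (z k) \<le> norm y * (1/2)^k" for k
    proof (induction k)
      case (Suc k)
      then show ?case using w[OF zin[of k]] by (simp add: zS)
    qed (simp add: z0)
    have zlim: "z \<longlonglongrightarrow> 0"
      by (rule Lim_null_comparison[where g = "\<lambda>k. norm y * (1/2)^k"])
        (use zn in \<open>auto intro!: tendsto_mult_right_zero LIMSEQ_power_zero\<close>)
    have "(\<lambda>k. z k - z (Suc k)) sums (z 0 - 0)" using zlim by (rule telescope_sums')
    then have s: "(\<lambda>k. w (z k)) sums y" by (simp add: zS z0)
    have "P y (\<Sum>k. (K * norm y) * (1/2)^k)"
    proof (rule sums[OF _ _ s summable_geometric_half(1)])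
      fix k
      have "K * norm (z k) \<le> (K * norm y) * (1/2)^k"
        using mult_left_mono[OF zn[of k] K0] by simp
      with w[OF zin[of k]] show "P (w (z k)) ((K * norm y) * (1/2)^k)" using mono by blast
      show "0 \<le> (K * norm y) * (1/2)^k" using K0 by simp
    qed
    then show ?thesis unfolding summable_geometric_half(2)
      by (rule mono) (auto simp: algebra_simps)
  qed
  show ?thesis by (rule that[of "2 * K + 1"]) (use K0 main in auto)
qed

text \<open>The projection theorem, carried out on the range. A minimizing sequence for the distance
  to \<open>g\<close> is Cauchy by the parallelogram law; the lower bound \<open>c\<close> makes the
  preimages Cauchy too, and closedness of \<open>H\<close> puts the limit in the range. The residue
  is orthogonal to the range, hence zero.\<close>

lemma closed_range_surj:
  fixes H :: "('a::{real_inner,banach} \<times> 'a) set"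
  assumes H: "subspace H" "closed H"
    and c: "c > 0" "\<And>u h. (u, h) \<in> H \<Longrightarrow> c * norm u \<le> norm h"
    and orth: "\<And>g. (\<And>u h. (u, h) \<in> H \<Longrightarrow> inner h g = 0) \<Longrightarrow> g = 0"
  shows "\<exists>u. (u, g) \<in> H"
proof -
  define R where "R = snd ` H"
  have R: "subspace R" unfolding R_def
    using H(1) by (intro linear_subspace_image linear_snd)
  have R0: "0 \<in> R" using R by (rule subspace_0)
  define I where "I = (INF h\<in>R. (norm (g - h))\<^sup>2)"
  have bdd: "bdd_below ((\<lambda>h. (norm (g - h))\<^sup>2) ` R)" by (rule bdd_belowI[of _ 0]) auto
  have Ile: "I \<le> (norm (g - h))\<^sup>2" if "h \<in> R" for h
    unfolding I_def using bdd that by (rule cINF_lower)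
  have "\<exists>h\<in>R. (norm (g - h))\<^sup>2 < I + 1 / real (Suc n)" for n
  proof -
    have "I < I + 1 / real (Suc n)" by simp
    then show ?thesis unfolding I_def using bdd R0 by (subst (asm) cINF_less_iff) auto
  qed
  then obtain h where h: "\<And>n. h n \<in> R" "\<And>n. (norm (g - h n))\<^sup>2 < I + 1 / real (Suc n)"
    by metis
  then have "\<forall>n. \<exists>u. (u, h n) \<in> H" unfolding R_def by force
  then obtain u where u: "\<And>n. (u n, h n) \<in> H" by metis
  have par: "(norm (h i - h j))\<^sup>2 \<le> 2 * (1 / real (Suc i) + 1 / real (Suc j))" for i j
  proof -
    \<comment> \<open>The midpoint lies in the range, so its distance to \<open>g\<close> cannot
      undercut \<open>I\<close>.\<close>
    have mid: "(1/2) *\<^sub>R (h i + h j) \<in> R" using h(1) R by (simp add: subspace_scale subspace_add)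
    have "(norm (h i - h j))\<^sup>2 = 2 * (norm (g - h i))\<^sup>2 + 2 * (norm (g - h j))\<^sup>2 - 4 * (norm (g - (1/2) *\<^sub>R (h i + h j)))\<^sup>2"
      unfolding power2_norm_eq_inner by (simp add: inner_simps inner_commute algebra_simps)
    then show ?thesis using Ile[OF mid] h(2)[of i] h(2)[of j] by simp
  qed
  have Cauchy_h: "Cauchy h"
  proof (rule metric_CauchyI)
    fix e :: real assume e: "e > 0"
    obtain N where N: "1 / real (Suc N) < e\<^sup>2 / 4" using e nat_approx_posE[of "e\<^sup>2/4"] by auto
    have "dist (h i) (h j) < e" if "i \<ge> N" "j \<ge> N" for i j
    proof -
      have "1 / real (Suc i) \<le> 1 / real (Suc N)" "1 / real (Suc j) \<le> 1 / real (Suc N)"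
        using that by (auto simp: field_simps)
      then have "(norm (h i - h j))\<^sup>2 < e\<^sup>2" using par[of i j] N by argo
      then show ?thesis using e by (simp add: dist_norm power_less_imp_less_base)
    qed
    then show "\<exists>M. \<forall>i\<ge>M. \<forall>j\<ge>M. dist (h i) (h j) < e" by blast
  qed
  have Cauchy_u: "Cauchy u"
  proof (rule metric_CauchyI)
    fix e :: real assume e: "e > 0"
    obtain N where N: "\<And>i j. i \<ge> N \<Longrightarrow> j \<ge> N \<Longrightarrow> dist (h i) (h j) < c * e"
      using metric_CauchyD[OF Cauchy_h, of "c * e"] c(1) e by auto
    have "dist (u i) (u j) < e" if "i \<ge> N" "j \<ge> N" for i j
    proof -
      have "(u i - u j, h i - h j) \<in> H" using subspace_diff[OF H(1) u[of i] u[of j]] by simp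
      then have "c * norm (u i - u j) < c * e" using c(2) N[OF that] by (fastforce simp: dist_norm)
      then show ?thesis using c(1) by (simp add: dist_norm)
    qed
    then show "\<exists>M. \<forall>i\<ge>M. \<forall>j\<ge>M. dist (u i) (u j) < e" by blast
  qed
  obtain ul hl where ul: "u \<longlonglongrightarrow> ul" and hl: "h \<longlonglongrightarrow> hl"
    using Cauchy_h Cauchy_u by (meson Cauchy_convergent convergent_def)
  have uhl: "(ul, hl) \<in> H"
    using closed_sequentially[OF H(2), of "\<lambda>n. (u n, h n)" "(ul, hl)"] u tendsto_Pair[OF ul hl] by blast
  then have hlR: "hl \<in> R" unfolding R_def by force
  have "(norm (g - hl))\<^sup>2 \<le> I"
  proof (rule LIMSEQ_le)
    show "(\<lambda>n. (norm (g - h n))\<^sup>2) \<longlonglongrightarrow> (norm (g - hl))\<^sup>2" by (intro tendsto_intros hl)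
    show "(\<lambda>n. I + 1 / real (Suc n)) \<longlonglongrightarrow> I"
      using tendsto_add[OF tendsto_const LIMSEQ_Suc[OF lim_1_over_n]] by fastforce
    show "\<exists>N. \<forall>n\<ge>N. (norm (g - h n))\<^sup>2 \<le> I + 1 / real (Suc n)" using h(2) less_imp_le by blast
  qed
  then have min: "(norm (g - hl))\<^sup>2 \<le> (norm (g - k))\<^sup>2" if "k \<in> R" for k using Ile[OF that] by linarith
  have "g - hl = 0"
  proof (rule orth)
    fix w k assume "(w, k) \<in> H"
    then have k: "k \<in> R" unfolding R_def by force
    \<comment> \<open>The minimizer of the quadratic in \<open>t\<close> below; for
      \<open>k = 0\<close> the quotient is 0 and the claim is trivial.\<close>
    define t where "t = inner k (g - hl) / (norm k)\<^sup>2"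
    have "hl + t *\<^sub>R k \<in> R" using hlR k R by (simp add: subspace_scale subspace_add)
    from min[OF this] have "0 \<le> t\<^sup>2 * (norm k)\<^sup>2 - 2 * t * inner k (g - hl)"
      unfolding power2_norm_eq_inner by (simp add: inner_simps inner_commute algebra_simps power2_eq_square)
    also have "\<dots> = - (inner k (g - hl))\<^sup>2 / (norm k)\<^sup>2"
      by (cases "k = 0") (simp_all add: t_def power2_eq_square field_simps)
    finally have "(inner k (g - hl))\<^sup>2 / (norm k)\<^sup>2 \<le> 0" by simp
    then show "inner k (g - hl) = 0"
      by (cases "k = 0") (auto simp: divide_le_0_iff)
  qed
  then show ?thesis using uhl by auto
qed

text \<open>Algebraic bijectivity only; for closed \<open>G\<close> the bound on the inverse comes
  from \<open>regular_bound\<close>.\<close>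

definition regular_at :: "('a::real_vector \<times> 'a) set \<Rightarrow> real \<Rightarrow> bool" where
  "regular_at G t \<longleftrightarrow> (\<forall>u. (u, t *\<^sub>R u) \<in> G \<longrightarrow> u = 0) \<and> (\<forall>g. \<exists>u f. (u, f) \<in> G \<and> f - t *\<^sub>R u = g)"

text \<open>The bounded inverse theorem: a lift of \<open>g\<close> is a solution of the shifted
  equation, its cost the norm of that solution. Injectivity identifies the cheap solution with the
  given one.\<close>

lemma regular_bound:
  fixes G :: "('a::{real_inner,banach} \<times> 'a) set"
  assumes G: "subspace G" "closed G" and reg: "regular_at G t"
  obtains K where "K > 0" "\<And>u f. (u, f) \<in> G \<Longrightarrow> norm u \<le> K * norm (f - t *\<^sub>R u)"
proof -
  define P where "P g r \<longleftrightarrow> (\<exists>u f. (u, f) \<in> G \<and> f - t *\<^sub>R u = g \<and> norm u \<le> r)" for g r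
  obtain K where K: "K > 0" "\<And>g. P g (K * norm g)"
  proof (rule lift_bound[of UNIV P])
    show "P y r'" if "P y r" "r \<le> r'" for y r r' using that unfolding P_def by (blast intro: order_trans)
    show "P (c *\<^sub>R y) (\<bar>c\<bar> * r)" if Py: "P y r" for y r c
    proof -
      obtain u f where u: "(u, f) \<in> G" "f - t *\<^sub>R u = y" "norm u \<le> r" using Py unfolding P_def by blast
      have "(c *\<^sub>R u, c *\<^sub>R f) \<in> G" using subspace_scale[OF G(1) u(1), of c] by simp
      moreover have "c *\<^sub>R f - t *\<^sub>R (c *\<^sub>R u) = c *\<^sub>R y"
        unfolding u(2)[symmetric] by (simp add: scaleR_diff_right)
      moreover have "norm (c *\<^sub>R u) \<le> \<bar>c\<bar> * r" using u(3) by (simp add: mult_left_mono)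
      ultimately show ?thesis unfolding P_def by blast
    qed
    show "P x (suminf r)" if y: "\<And>n. P (y n) (r n)" and r: "\<And>n. 0 \<le> r n" and s: "y sums x" "summable r" for y r x
    proof -
      have "\<forall>n. \<exists>p. p \<in> G \<and> snd p - t *\<^sub>R fst p = y n \<and> norm (fst p) \<le> r n"
        using y unfolding P_def by auto
      from choice[OF this] obtain p
        where p: "\<And>n. p n \<in> G \<and> snd (p n) - t *\<^sub>R fst (p n) = y n \<and> norm (fst (p n)) \<le> r n" by blast
      define u f where "u n = fst (p n)" and "f n = snd (p n)" for n
      have u: "(u n, f n) \<in> G" "f n - t *\<^sub>R u n = y n" "norm (u n) \<le> r n" for n
        using p[of n] by (auto simp: u_def f_def)
      have sn: "summable (\<lambda>n. norm (u n))"
        by (rule summable_comparison_test'[OF s(2)]) (simp add: u(3))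
      then have su: "u sums suminf u" by (rule summable_sums[OF summable_norm_cancel])
      \<comment> \<open>The cost controls only \<open>u\<close>; convergence of the second
        components follows from the equation.\<close>
      have "f n = y n + t *\<^sub>R u n" for n using u(2)[of n] by (simp add: algebra_simps)
      then have sf: "f sums (x + t *\<^sub>R suminf u)"
        using sums_add[OF s(1) sums_scaleR_right[OF su, of t]] by presburger
      have "(suminf u, x + t *\<^sub>R suminf u) \<in> G"
      proof (rule closed_sequentially[OF G(2)])
        show "(\<Sum>i<n. u i, \<Sum>i<n. f i) \<in> G" for n
          using subspace_sum[OF G(1), of "{..<n}" "\<lambda>i. (u i, f i)"] u(1) by (simp add: sum_prod)
        show "(\<lambda>n. (\<Sum>i<n. u i, \<Sum>i<n. f i)) \<longlonglongrightarrow> (suminf u, x + t *\<^sub>R suminf u)"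
          using su sf unfolding sums_def by (rule tendsto_Pair)
      qed
      moreover have "norm (suminf u) \<le> suminf r"
        using summable_norm[OF sn] suminf_le[OF u(3) sn s(2)] by linarith
      ultimately show ?thesis unfolding P_def by force
    qed
    show "\<exists>r. P y r" for y using reg unfolding regular_at_def P_def by blast
  qed (auto simp: that)
  show ?thesis
  proof (rule that[OF K(1)])
    fix u f assume uf: "(u, f) \<in> G"
    obtain w k where w: "(w, k) \<in> G" "k - t *\<^sub>R w = f - t *\<^sub>R u" "norm w \<le> K * norm (f - t *\<^sub>R u)"
      using K(2)[of "f - t *\<^sub>R u"] unfolding P_def by blast
    have "(u - w, f - k) \<in> G" using subspace_diff[OF G(1) uf w(1)] by simp
    moreover have "f - k = t *\<^sub>R (u - w)" using w(2) by (simp add: algebra_simps)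
    ultimately have "u - w = 0" using reg unfolding regular_at_def by metis
    then show "norm u \<le> K * norm (f - t *\<^sub>R u)" using w(3) by simp
  qed
qed


section \<open>Self-adjoint relations and gaps in their real spectrum\<close>

definition self_adjoint :: "('a::real_inner \<times> 'a) set \<Rightarrow> bool" where
  "self_adjoint G \<longleftrightarrow>
     (\<forall>(u, f)\<in>G. \<forall>(w, g)\<in>G. inner f w = inner u g) \<and>
     (\<forall>w g. (\<forall>(u, f)\<in>G. inner f w = inner u g) \<longrightarrow> (w, g) \<in> G)"

lemma self_adjoint_symmetric:
  "self_adjoint G \<Longrightarrow> (u, f) \<in> G \<Longrightarrow> (w, g) \<in> G \<Longrightarrow> inner f w = inner u g"
  unfolding self_adjoint_def by blast

lemma self_adjoint_maximal:
  "self_adjoint G \<Longrightarrow> (\<And>u f. (u, f) \<in> G \<Longrightarrow> inner f w = inner u g) \<Longrightarrow> (w, g) \<in> G"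
  unfolding self_adjoint_def by blast

text \<open>Symmetry and maximality together make \<open>G\<close> the solution set of the
  conditions \<open>inner f w = inner u g\<close>. These are linear in the pair of \<open>w\<close>
  and \<open>g\<close>, which gives the subspace property, and continuous, which gives
  \<open>self_adjoint_closed\<close>.\<close>

lemma self_adjoint_subspace:
  assumes "self_adjoint G" shows "subspace G"
proof (rule subspaceI)
  show "0 \<in> G" unfolding zero_prod_def
    by (rule self_adjoint_maximal[OF assms]) simp
  show "x + y \<in> G" if "x \<in> G" "y \<in> G" for x y
  proof (cases x; cases y)
    fix a b c d assume x: "x = (a, b)" "y = (c, d)"
    show ?thesis unfolding x add_Pair
      using that x
      by (intro self_adjoint_maximal[OF assms])
        (simp add: inner_add_right self_adjoint_symmetric[OF assms])
  qed
  show "r *\<^sub>R x \<in> G" if "x \<in> G" for r x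
  proof (cases x)
    fix a b assume x: "x = (a, b)"
    show ?thesis unfolding x scaleR_Pair
      using that x
      by (intro self_adjoint_maximal[OF assms])
        (simp add: self_adjoint_symmetric[OF assms])
  qed
qed

lemma self_adjoint_closed:
  assumes "self_adjoint G" shows "closed G"
proof -
  have "G = (\<Inter>(u, f)\<in>G. {p. inner f (fst p) = inner u (snd p)})"
  proof (intro equalityI subsetI)
    fix p assume "p \<in> G"
    then show "p \<in> (\<Inter>(u, f)\<in>G. {p. inner f (fst p) = inner u (snd p)})"
      using self_adjoint_symmetric[OF assms, of _ _ "fst p" "snd p"] by auto
  next
    fix p assume p: "p \<in> (\<Inter>(u, f)\<in>G. {p. inner f (fst p) = inner u (snd p)})"
    have "(fst p, snd p) \<in> G"
    proof (rule self_adjoint_maximal[OF assms])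
      fix u f assume "(u, f) \<in> G"
      then show "inner f (fst p) = inner u (snd p)" using p by blast
    qed
    then show "p \<in> G" by simp
  qed
  moreover have "closed (\<Inter>(u, f)\<in>G. {p. inner f (fst p) = inner u (snd p)})"
    by (auto intro!: closed_INT closed_Collect_eq continuous_intros)
  ultimately show ?thesis by simp
qed

text \<open>A bounded symmetric operator of norm \<open>M\<close> has \<open>M\<close> or
  \<open>- M\<close> in its spectrum. Apply this to the inverse of \<open>G\<close>: if the bound
  failed, \<open>M\<close> would exceed \<open>1 / d\<close>, and both \<open>1 / M\<close> and
  \<open>- (1 / M)\<close> would lie in the gap, where \<open>G\<close> is regular.\<close>

lemma spectral_gap_bound_zero:
  fixes G :: "('a::{real_inner,banach} \<times> 'a) set"
  assumes sa: "self_adjoint G" and d: "d > 0"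
    and reg: "\<And>t. \<bar>t\<bar> < d \<Longrightarrow> regular_at G t" and uf: "(u0, f0) \<in> G"
  shows "d * norm u0 \<le> norm f0"
proof (rule ccontr)
  note G = self_adjoint_subspace[OF sa] self_adjoint_closed[OF sa]
  assume "\<not> ?thesis"
  then have viol: "d * norm u0 > norm f0" by simp
  have reg0: "regular_at G 0" using reg d by simp
  obtain K0 where K0: "K0 > 0" "\<And>u f. (u, f) \<in> G \<Longrightarrow> norm u \<le> K0 * norm (f - 0 *\<^sub>R u)"
    using regular_bound[OF G reg0] by metis
  have f0: "f0 \<noteq> 0" using K0(2)[OF uf] viol d by auto
  \<comment> \<open>The supremum \<open>M\<close> of these numbers is the operator norm of the
    inverse of \<open>G\<close>.\<close>
  define Ns where "Ns = {norm u |u f. (u, f) \<in> G \<and> norm f \<le> 1}"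
  define M where "M = Sup Ns"
  have bdd: "bdd_above Ns"
  proof (rule bdd_aboveI)
    fix x assume "x \<in> Ns"
    then obtain u f where "x = norm u" "(u, f) \<in> G" "norm f \<le> 1" unfolding Ns_def by blast
    moreover from this have "K0 * norm f \<le> K0 * 1" using K0(1) by (intro mult_left_mono) auto
    ultimately show "x \<le> K0" using K0(2)[of u f] by simp
  qed
  have Mup: "norm u \<le> M" if "(u, f) \<in> G" "norm f \<le> 1" for u f
    unfolding M_def using bdd that by (intro cSup_upper) (auto simp: Ns_def)
  have Mbound: "norm u \<le> M * norm f" if "(u, f) \<in> G" for u f
  proof (cases "f = 0")
    case True
    then show ?thesis using K0(2)[OF that] by simp
  next
    case False
    have "((1 / norm f) *\<^sub>R u, (1 / norm f) *\<^sub>R f) \<in> G"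
      using subspace_scale[OF G(1) that, of "1 / norm f"] by simp
    from Mup[OF this] show ?thesis using False by (simp add: field_simps)
  qed
  have "norm f0 < d * (M * norm f0)" using viol Mbound[OF uf] d by (smt (verit) mult_left_mono)
  then have dM: "1 < d * M" using f0 by (simp add: mult.assoc[symmetric])
  then have M0: "M > 0" using d by (smt (verit) mult_nonneg_nonpos)
  \<comment> \<open>Regularity of \<open>G\<close> at \<mu> and - \<mu> is invertibility of the
    inverse minus \<open>M\<close> and plus \<open>M\<close>.\<close>
  define \<mu> where "\<mu> = 1 / M"
  have \<mu>: "\<mu> > 0" "\<mu> < d" "\<mu> * M = 1" using M0 dM by (auto simp: \<mu>_def field_simps)
  obtain K1 where K1: "K1 > 0" "\<And>u f. (u, f) \<in> G \<Longrightarrow> norm u \<le> K1 * norm (f - \<mu> *\<^sub>R u)"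
    using regular_bound[OF G reg, of \<mu>] \<mu> by auto
  obtain K2 where K2: "K2 > 0" "\<And>u f. (u, f) \<in> G \<Longrightarrow> norm u \<le> K2 * norm (f - (-\<mu>) *\<^sub>R u)"
    using regular_bound[OF G reg, of "-\<mu>"] \<mu> by auto
  \<comment> \<open>Collects the constants from undoing the two factors in turn: \<open>K1\<close>
    recovers \<open>q\<close> from \<open>h\<close>, then \<open>K2\<close> recovers
    \<open>u\<close> from \<open>q\<close>.\<close>
  define B where "B = K2 * \<mu> * (\<mu> + \<mu> * (K1 * \<mu>))"
  have B: "B > 0" unfolding B_def using K1(1) K2(1) \<mu>(1) by (simp add: add_pos_pos)
  text \<open>Writing \<open>R\<close> for the inverse relation, \<open>(R - M) (R + M) g\<close> is small for almost maximizing \<open>g\<close>.\<close>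
  have key: "(norm u)\<^sup>2 \<le> B\<^sup>2 * (M\<^sup>2 * (M\<^sup>2 - (norm u)\<^sup>2))" if ug: "(u, g) \<in> G" "norm g \<le> 1" for u g
  proof -
    obtain w where w: "(w, u) \<in> G" using reg0 unfolding regular_at_def by fastforce
    have wg: "inner w g = (norm u)\<^sup>2"
      using self_adjoint_symmetric[OF sa w ug(1)] by (simp add: power2_norm_eq_inner)
    define h where "h = w - M\<^sup>2 *\<^sub>R g"
    have "(norm w)\<^sup>2 \<le> M\<^sup>2 * (norm u)\<^sup>2"
      using power_mono[OF Mbound[OF w], of 2] by (simp add: power_mult_distrib)
    moreover have "M\<^sup>2 * (M\<^sup>2 * (norm g)\<^sup>2) \<le> M\<^sup>2 * (M\<^sup>2 * 1)"
      using ug(2) by (intro mult_left_mono) (auto simp: power_le_one)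
    moreover have "(norm h)\<^sup>2 = (norm w)\<^sup>2 - 2 * M\<^sup>2 * (norm u)\<^sup>2 + M\<^sup>2 * (M\<^sup>2 * (norm g)\<^sup>2)"
      unfolding h_def using wg unfolding power2_norm_eq_inner
      by (simp add: inner_simps inner_commute[of g w] algebra_simps power2_eq_square)
    ultimately have h: "(norm h)\<^sup>2 \<le> M\<^sup>2 * (M\<^sup>2 - (norm u)\<^sup>2)" by (simp add: algebra_simps)
    define q where "q = u + M *\<^sub>R g"
    define r where "r = w + M *\<^sub>R u"
    have "(r, q) \<in> G" unfolding r_def q_def
      using subspace_add[OF G(1) w subspace_scale[OF G(1) ug(1), of M]] by simp
    moreover have "q - \<mu> *\<^sub>R r = - \<mu> *\<^sub>R h"
      using \<mu>(3) by (simp add: q_def r_def h_def algebra_simps power2_eq_square)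
    ultimately have r: "norm r \<le> K1 * (\<mu> * norm h)" using K1(2) \<mu>(1) by fastforce
    have "q = - \<mu> *\<^sub>R h + \<mu> *\<^sub>R r" using \<open>q - \<mu> *\<^sub>R r = - \<mu> *\<^sub>R h\<close> by (simp add: algebra_simps)
    then have "norm q \<le> \<mu> * norm h + \<mu> * norm r"
      using norm_triangle_ineq[of "- \<mu> *\<^sub>R h" "\<mu> *\<^sub>R r"] \<mu>(1) by simp
    also have "\<dots> \<le> \<mu> * norm h + \<mu> * (K1 * (\<mu> * norm h))" using r \<mu>(1) by (simp add: mult_left_mono)
    finally have q: "norm q \<le> (\<mu> + \<mu> * (K1 * \<mu>)) * norm h" by (simp add: algebra_simps)
    have "g - (-\<mu>) *\<^sub>R u = \<mu> *\<^sub>R q" using \<mu>(3) by (simp add: q_def algebra_simps)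
    then have "norm u \<le> K2 * (\<mu> * norm q)" using K2(2)[OF ug(1)] \<mu>(1) by simp
    also have "\<dots> \<le> K2 * (\<mu> * ((\<mu> + \<mu> * (K1 * \<mu>)) * norm h))"
      using q K2(1) \<mu>(1) by (intro mult_left_mono) auto
    finally have "norm u \<le> B * norm h" by (simp add: B_def algebra_simps)
    then have "(norm u)\<^sup>2 \<le> B\<^sup>2 * (norm h)\<^sup>2"
      using power_mono[of "norm u" "B * norm h" 2] by (simp add: power_mult_distrib)
    also have "\<dots> \<le> B\<^sup>2 * (M\<^sup>2 * (M\<^sup>2 - (norm u)\<^sup>2))" using h by (intro mult_left_mono) auto
    finally show ?thesis .
  qed
  \<comment> \<open>Solving \<open>key\<close> for the square of \<open>norm u\<close> gives the
    factor \<open>1 - 1/E\<close>, uniformly over the unit ball; this keeps the supremum strictly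
    below \<open>M\<close>, a contradiction.\<close>
  define E where "E = 1 + B\<^sup>2 * M\<^sup>2"
  have E: "E > 1" using B M0 by (simp add: E_def)
  have bound: "(norm u)\<^sup>2 \<le> (1 - 1/E) * M\<^sup>2" if "(u, g) \<in> G" "norm g \<le> 1" for u g
  proof -
    have "E * (norm u)\<^sup>2 \<le> (E - 1) * M\<^sup>2" using key[OF that] by (simp add: E_def algebra_simps)
    then show ?thesis using E by (simp add: field_simps)
  qed
  have "M \<le> sqrt (1 - 1/E) * M"
    unfolding M_def
  proof (rule cSup_least)
    show "Ns \<noteq> {}" using subspace_0[OF G(1)] unfolding Ns_def zero_prod_def by force
    fix x assume "x \<in> Ns"
    then obtain u g where x: "x = norm u" "(u, g) \<in> G" "norm g \<le> 1" unfolding Ns_def by blast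
    have "norm u \<le> sqrt ((1 - 1/E) * M\<^sup>2)" using bound[OF x(2,3)] by (rule real_le_rsqrt)
    then show "x \<le> sqrt (1 - 1/E) * Sup Ns"
      using x(1) M0 by (simp add: real_sqrt_mult M_def)
  qed
  moreover have "sqrt (1 - 1/E) < 1" using E by simp
  ultimately show False using M0 by simp
qed

lemma self_adjoint_shift:
  assumes "self_adjoint G"
  shows "self_adjoint ((\<lambda>(u, f). (u, f - t *\<^sub>R u)) ` G)"
  unfolding self_adjoint_def
proof (intro conjI allI impI)
  let ?H = "(\<lambda>(u, f). (u, f - t *\<^sub>R u)) ` G"
  show "\<forall>(u, f)\<in>?H. \<forall>(w, g)\<in>?H. inner f w = inner u g"
    using self_adjoint_symmetric[OF assms] by (auto simp: inner_diff_left inner_diff_right)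
  fix w g assume a: "\<forall>(u, f)\<in>?H. inner f w = inner u g"
  have "(w, g + t *\<^sub>R w) \<in> G"
  proof (rule self_adjoint_maximal[OF assms])
    fix u f assume "(u, f) \<in> G"
    then have "inner (f - t *\<^sub>R u) w = inner u g" using a by force
    then show "inner f w = inner u (g + t *\<^sub>R w)" by (simp add: inner_diff_left inner_add_right)
  qed
  then show "(w, g) \<in> ?H" by force
qed

lemma spectral_gap_bound:
  fixes G :: "('a::{real_inner,banach} \<times> 'a) set"
  assumes sa: "self_adjoint G" and d: "d > 0"
    and reg: "\<And>t. \<bar>t - z\<bar> < d \<Longrightarrow> regular_at G t" and uf: "(u, f) \<in> G"
  shows "d * norm u \<le> norm (f - z *\<^sub>R u)"
proof (rule spectral_gap_bound_zero[OF self_adjoint_shift[OF sa, of z] d])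
  let ?H = "(\<lambda>(u, f). (u, f - z *\<^sub>R u)) ` G"
  show "(u, f - z *\<^sub>R u) \<in> ?H" using uf by force
  fix t :: real assume "\<bar>t\<bar> < d"
  then have r: "regular_at G (z + t)" using reg by simp
  show "regular_at ?H t" unfolding regular_at_def
  proof (intro conjI allI impI)
    fix u assume "(u, t *\<^sub>R u) \<in> ?H"
    then obtain f where f: "(u, f) \<in> G" "f - z *\<^sub>R u = t *\<^sub>R u" by auto
    then have "f = (z + t) *\<^sub>R u" by (simp add: algebra_simps)
    then show "u = 0" using f r unfolding regular_at_def by blast
  next
    fix g
    obtain u f where f: "(u, f) \<in> G" "f - (z + t) *\<^sub>R u = g" using r unfolding regular_at_def by blast
    have "(u, f - z *\<^sub>R u) \<in> ?H" using f(1) by force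
    moreover have "f - z *\<^sub>R u - t *\<^sub>R u = g" using f(2) by (simp add: algebra_simps)
    ultimately show "\<exists>u f. (u, f) \<in> ?H \<and> f - t *\<^sub>R u = g" by blast
  qed
qed

section \<open>The Hilbert space of square-integrable functions\<close>

lemma L2_borel [measurable_dest]: "L2 f \<Longrightarrow> f \<in> borel_measurable borel"
  by (simp add: L2_def)

lemma L2_integrable: "L2 f \<Longrightarrow> integrable lborel (\<lambda>x. (cmod (f x))\<^sup>2)"
  by (simp add: L2_def)

lemma L2_zero: "L2 (\<lambda>x. 0)"
  by (simp add: L2_def)

lemma L2_bound:
  assumes g: "L2 g" and [measurable]: "f \<in> borel_measurable borel"
    and le: "AE x in lborel. cmod (f x) \<le> C * cmod (g x)"
  shows "L2 f"
  unfolding L2_def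
proof
  show "integrable lborel (\<lambda>x. (cmod (f x))\<^sup>2)"
  proof (rule Bochner_Integration.integrable_bound)
    show "integrable lborel (\<lambda>x. C\<^sup>2 * (cmod (g x))\<^sup>2)" using L2_integrable[OF g] by simp
    show "AE x in lborel. norm ((cmod (f x))\<^sup>2) \<le> norm (C\<^sup>2 * (cmod (g x))\<^sup>2)"
      using le
    proof eventually_elim
      case (elim x)
      then show ?case using power_mono[OF elim, of 2] by (simp add: power_mult_distrib)
    qed
  qed simp
qed simp

lemma L2_add:
  assumes [measurable_dest]: "L2 f" "L2 g" shows "L2 (\<lambda>x. f x + g x)"
  unfolding L2_def
proof
  note [measurable] = assms[THEN L2_borel]
  show "(\<lambda>x. f x + g x) \<in> borel_measurable lborel" by simp
  show "integrable lborel (\<lambda>x. (cmod (f x + g x))\<^sup>2)"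
  proof (rule Bochner_Integration.integrable_bound)
    show "integrable lborel (\<lambda>x. 2 * (cmod (f x))\<^sup>2 + 2 * (cmod (g x))\<^sup>2)"
      using assms by (intro Bochner_Integration.integrable_add integrable_mult_right L2_integrable)
    show "AE x in lborel. norm ((cmod (f x + g x))\<^sup>2) \<le> norm (2 * (cmod (f x))\<^sup>2 + 2 * (cmod (g x))\<^sup>2)"
    proof (rule AE_I2)
      fix x
      have "(cmod (f x + g x))\<^sup>2 \<le> (cmod (f x) + cmod (g x))\<^sup>2"
        by (intro power_mono norm_triangle_ineq) auto
      also have "\<dots> \<le> 2 * (cmod (f x))\<^sup>2 + 2 * (cmod (g x))\<^sup>2"
        using sum_squares_bound[of "cmod (f x)" "cmod (g x)"] by (simp add: power2_sum)
      finally show "norm ((cmod (f x + g x))\<^sup>2) \<le> norm (2 * (cmod (f x))\<^sup>2 + 2 * (cmod (g x))\<^sup>2)" by simp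
    qed
  qed simp
qed

lemma L2_cmult: "L2 f \<Longrightarrow> L2 (\<lambda>x. c * f x)"
  by (rule L2_bound[of f _ "cmod c"]) (auto simp: norm_mult dest: L2_borel)

lemma L2_uminus: "L2 f \<Longrightarrow> L2 (\<lambda>x. - f x)"
  using L2_cmult[of f "-1"] by simp

lemma L2_diff: "L2 f \<Longrightarrow> L2 g \<Longrightarrow> L2 (\<lambda>x. f x - g x)"
  using L2_add[OF _ L2_uminus, of f g] by simp

lemma L2_sum: "(\<And>i. i \<in> I \<Longrightarrow> L2 (f i)) \<Longrightarrow> L2 (\<lambda>x. \<Sum>i\<in>I. f i x)"
  by (induction I rule: infinite_finite_induct) (auto simp: L2_zero intro: L2_add)

lemma L2_mult_bounded:
  assumes "L2 f" "h \<in> borel_measurable borel" "\<And>x. cmod (h x) \<le> C"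
  shows "L2 (\<lambda>x. h x * f x)"
proof (rule L2_bound[OF assms(1)])
  show "(\<lambda>x. h x * f x) \<in> borel_measurable borel" using assms L2_borel by simp
  show "AE x in lborel. cmod (h x * f x) \<le> C * cmod (f x)"
    using assms(3) by (auto simp: norm_mult intro!: mult_right_mono)
qed

lemma L2_integrable_mult:
  assumes "L2 f" "L2 g" shows "integrable lborel (\<lambda>x. f x * g x)"
proof (rule Bochner_Integration.integrable_bound)
  note [measurable] = assms[THEN L2_borel]
  show "(\<lambda>x. f x * g x) \<in> borel_measurable lborel" by simp
  show "integrable lborel (\<lambda>x. (cmod (f x))\<^sup>2 + (cmod (g x))\<^sup>2)"
    using assms by (auto intro: L2_integrable)
  show "AE x in lborel. cmod (f x * g x) \<le> norm ((cmod (f x))\<^sup>2 + (cmod (g x))\<^sup>2)"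
  proof (rule AE_I2)
    fix x
    have "2 * (cmod (f x) * cmod (g x)) \<le> (cmod (f x))\<^sup>2 + (cmod (g x))\<^sup>2"
      using sum_squares_bound[of "cmod (f x)" "cmod (g x)"] by simp
    moreover have "0 \<le> cmod (f x) * cmod (g x)" by simp
    ultimately have "cmod (f x) * cmod (g x) \<le> (cmod (f x))\<^sup>2 + (cmod (g x))\<^sup>2" by linarith
    then show "cmod (f x * g x) \<le> norm ((cmod (f x))\<^sup>2 + (cmod (g x))\<^sup>2)"
      unfolding norm_mult by simp
  qed
qed

lemma cnj_measurable [measurable]: "cnj \<in> borel_measurable borel"
  by (intro borel_measurable_continuous_onI continuous_intros)

lemma L2_cnj: "L2 f \<Longrightarrow> L2 (\<lambda>x. cnj (f x))"
  by (rule L2_bound[of f _ 1]) (auto intro: measurable_compose[OF L2_borel cnj_measurable])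

lemma L2_integrable_inner: "L2 f \<Longrightarrow> L2 g \<Longrightarrow> integrable lborel (\<lambda>x. f x * cnj (g x))"
  by (intro L2_integrable_mult L2_cnj)

text \<open>
  As a real Hilbert space; the complex structure is recovered through \<open>cscale\<close> below.
\<close>

quotient_type l2 = "real \<Rightarrow> complex" / partial: "\<lambda>f g. L2 f \<and> L2 g \<and> (AE x in lborel. f x = g x)"
proof (rule part_equivpI)
  show "\<exists>f. L2 f \<and> L2 f \<and> (AE x in lborel. f x = f x)" using L2_zero by auto
  show "symp (\<lambda>f g. L2 f \<and> L2 g \<and> (AE x in lborel. f x = g x))"
    by (intro sympI) (auto elim: eventually_mono)
  show "transp (\<lambda>f g. L2 f \<and> L2 g \<and> (AE x in lborel. f x = g x))"
    by (intro transpI) (auto elim: eventually_elim2)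
qed

definition fn :: "l2 \<Rightarrow> real \<Rightarrow> complex" where "fn = rep_l2"
definition mk :: "(real \<Rightarrow> complex) \<Rightarrow> l2" where "mk = abs_l2"

lemma fn_L2 [simp]: "L2 (fn u)"
  unfolding fn_def using Quotient3_rep_reflp[OF Quotient3_l2] by blast

lemma fn_measurable [measurable]: "fn u \<in> borel_measurable borel"
  using L2_borel fn_L2 by blast

lemma mk_fn [simp]: "mk (fn u) = u"
  unfolding fn_def mk_def by (rule Quotient3_abs_rep[OF Quotient3_l2])

lemma mk_eq_iff: "L2 f \<Longrightarrow> L2 g \<Longrightarrow> mk f = mk g \<longleftrightarrow> (AE x in lborel. f x = g x)"
  unfolding mk_def using Quotient3_rel[OF Quotient3_l2, of f g] by auto

lemma fn_mk: "L2 f \<Longrightarrow> AE x in lborel. fn (mk f) x = f x"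
  using mk_eq_iff[of "fn (mk f)" f] by simp

lemma l2_eq_iff: "u = v \<longleftrightarrow> (AE x in lborel. fn u x = fn v x)"
  using mk_eq_iff[of "fn u" "fn v"] by simp

instantiation l2 :: real_vector
begin
definition "0 = mk (\<lambda>x. 0)"
definition "u + v = mk (\<lambda>x. fn u x + fn v x)"
definition "- u = mk (\<lambda>x. - fn u x)"
definition "(u::l2) - v = mk (\<lambda>x. fn u x - fn v x)"
definition "r *\<^sub>R u = mk (\<lambda>x. of_real r * fn u x)"

lemma fn_zero: "AE x in lborel. fn 0 x = 0"
  unfolding zero_l2_def by (rule fn_mk) (rule L2_zero)
lemma fn_plus: "AE x in lborel. fn (u + v) x = fn u x + fn v x"
  unfolding plus_l2_def by (rule fn_mk) (simp add: L2_add)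
lemma fn_uminus: "AE x in lborel. fn (- u) x = - fn u x"
  unfolding uminus_l2_def by (rule fn_mk) (simp add: L2_uminus)
lemma fn_minus: "AE x in lborel. fn (u - v) x = fn u x - fn v x"
  unfolding minus_l2_def by (rule fn_mk) (simp add: L2_diff)
lemma fn_scaleR: "AE x in lborel. fn (r *\<^sub>R u) x = of_real r * fn u x"
  unfolding scaleR_l2_def by (rule fn_mk) (simp add: L2_cmult)

instance
proof
  fix u v w :: l2 and a b :: real
  show "u + v + w = u + (v + w)" unfolding l2_eq_iff
    using fn_plus[of "u + v" w] fn_plus[of u v] fn_plus[of u "v + w"] fn_plus[of v w]
    by eventually_elim simp
  show "u + v = v + u" unfolding l2_eq_iff
    using fn_plus[of u v] fn_plus[of v u] by eventually_elim simp
  show "0 + u = u" unfolding l2_eq_iff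
    using fn_plus[of 0 u] fn_zero by eventually_elim simp
  show "- u + u = 0" unfolding l2_eq_iff
    using fn_plus[of "- u" u] fn_uminus[of u] fn_zero by eventually_elim simp
  show "u - v = u + - v" unfolding l2_eq_iff
    using fn_plus[of u "- v"] fn_uminus[of v] fn_minus[of u v] by eventually_elim simp
  show "a *\<^sub>R (u + v) = a *\<^sub>R u + a *\<^sub>R v" unfolding l2_eq_iff
    using fn_scaleR[of a "u + v"] fn_plus[of u v] fn_plus[of "a *\<^sub>R u" "a *\<^sub>R v"] fn_scaleR[of a u] fn_scaleR[of a v]
    by eventually_elim (simp add: algebra_simps)
  show "(a + b) *\<^sub>R u = a *\<^sub>R u + b *\<^sub>R u" unfolding l2_eq_iff
    using fn_scaleR[of "a + b" u] fn_plus[of "a *\<^sub>R u" "b *\<^sub>R u"] fn_scaleR[of a u] fn_scaleR[of b u]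
    by eventually_elim (simp add: algebra_simps)
  show "a *\<^sub>R b *\<^sub>R u = (a * b) *\<^sub>R u" unfolding l2_eq_iff
    using fn_scaleR[of a "b *\<^sub>R u"] fn_scaleR[of b u] fn_scaleR[of "a * b" u]
    by eventually_elim simp
  show "1 *\<^sub>R u = u" unfolding l2_eq_iff
    using fn_scaleR[of 1 u] by eventually_elim simp
qed
end

lemma l2inner_AE_cong:
  assumes "L2 f" "L2 f'" "L2 g" "L2 g'" "AE x in lborel. f x = f' x" "AE x in lborel. g x = g' x"
  shows "l2inner f g = l2inner f' g'"
proof -
  note [measurable] = assms(1-4)[THEN L2_borel]
  show ?thesis unfolding l2inner_def
  proof (rule integral_cong_AE)
    show "AE x in lborel. f x * cnj (g x) = f' x * cnj (g' x)"
      using assms(5,6) by eventually_elim simp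
  qed simp_all
qed

lemma l2inner_commute: "l2inner g f = cnj (l2inner f g)"
  unfolding l2inner_def Bochner_Integration.integral_cnj[symmetric] by (simp add: mult.commute)

lemma l2inner_self: "l2inner f f = of_real (LINT x|lborel. (cmod (f x))\<^sup>2)"
  unfolding l2inner_def integral_complex_of_real[symmetric] by (simp only: complex_norm_square)

lemma l2inner_add_left: "L2 f \<Longrightarrow> L2 g \<Longrightarrow> L2 h \<Longrightarrow> l2inner (\<lambda>x. f x + g x) h = l2inner f h + l2inner g h"
  unfolding l2inner_def by (simp add: distrib_right L2_integrable_inner)

lemma l2inner_cmult_left: "l2inner (\<lambda>x. c * f x) h = c * l2inner f h"
  unfolding l2inner_def by (simp add: mult.assoc)

lemma l2inner_cmult_right: "l2inner f (\<lambda>x. c * h x) = cnj c * l2inner f h"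
  unfolding l2inner_def by (simp add: mult.left_commute)

instantiation l2 :: real_inner
begin
definition "inner u v = Re (l2inner (fn u) (fn v))"
definition "norm (u::l2) = sqrt (inner u u)"
definition "sgn (u::l2) = u /\<^sub>R norm u"
definition "dist (u::l2) v = norm (u - v)"
definition "uniformity = (INF e\<in>{0<..}. principal {(x, y::l2). dist x y < e})"
definition "open (U::l2 set) = (\<forall>x\<in>U. eventually (\<lambda>(x', y). x' = x \<longrightarrow> y \<in> U) uniformity)"

instance
proof
  fix u v w :: l2 and a b :: real and U :: "l2 set"
  show "inner u v = inner v u" unfolding inner_l2_def by (subst l2inner_commute) simp
  have "l2inner (fn (u + v)) (fn w) = l2inner (\<lambda>x. fn u x + fn v x) (fn w)"
    by (rule l2inner_AE_cong) (auto simp: L2_add fn_plus)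
  then show "inner (u + v) w = inner u w + inner v w"
    unfolding inner_l2_def by (simp add: l2inner_add_left)
  have "l2inner (fn (a *\<^sub>R u)) (fn v) = l2inner (\<lambda>x. of_real a * fn u x) (fn v)"
    by (rule l2inner_AE_cong) (auto simp: L2_cmult fn_scaleR)
  then show "inner (a *\<^sub>R u) v = a * inner u v"
    unfolding inner_l2_def by (simp add: l2inner_cmult_left)
  have s: "inner u u = (LINT x|lborel. (cmod (fn u x))\<^sup>2)"
    unfolding inner_l2_def l2inner_self by simp
  show "0 \<le> inner u u" unfolding s by simp
  have "(inner u u = 0) = (AE x in lborel. (cmod (fn u x))\<^sup>2 = 0)"
    unfolding s by (rule integral_nonneg_eq_0_iff_AE) (auto intro: L2_integrable)
  also have "\<dots> \<longleftrightarrow> u = 0" unfolding l2_eq_iff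
  proof
    assume "AE x in lborel. (cmod (fn u x))\<^sup>2 = 0"
    then show "AE x in lborel. fn u x = fn 0 x" using fn_zero by eventually_elim simp
  next
    assume "AE x in lborel. fn u x = fn 0 x"
    then show "AE x in lborel. (cmod (fn u x))\<^sup>2 = 0" using fn_zero by eventually_elim simp
  qed
  finally show "(inner u u = 0) = (u = 0)" .
qed (simp_all add: norm_l2_def sgn_l2_def dist_l2_def uniformity_l2_def open_l2_def)
end

lemma norm_l2: "(norm u)\<^sup>2 = (LINT x|lborel. (cmod (fn u x))\<^sup>2)"
  unfolding power2_norm_eq_inner inner_l2_def l2inner_self by simp

lemma norm_l2_nn: "ennreal ((norm u)\<^sup>2) = (\<integral>\<^sup>+x. ennreal ((cmod (fn u x))\<^sup>2) \<partial>lborel)"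
  unfolding norm_l2 by (rule nn_integral_eq_integral[symmetric]) (auto intro: L2_integrable)

lemma norm_mk: "L2 f \<Longrightarrow> ennreal ((norm (mk f))\<^sup>2) = (\<integral>\<^sup>+x. ennreal ((cmod (f x))\<^sup>2) \<partial>lborel)"
  unfolding norm_l2_nn by (intro nn_integral_cong_AE eventually_mono[OF fn_mk]) auto

lemma mk_add: assumes "L2 f" "L2 g" shows "mk (\<lambda>x. f x + g x) = mk f + mk g"
  unfolding l2_eq_iff
  using fn_mk[OF L2_add[OF assms]] fn_mk[OF assms(1)] fn_mk[OF assms(2)] fn_plus[of "mk f" "mk g"]
  by eventually_elim simp

lemma mk_diff: assumes "L2 f" "L2 g" shows "mk (\<lambda>x. f x - g x) = mk f - mk g"
  unfolding l2_eq_iff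
  using fn_mk[OF L2_diff[OF assms]] fn_mk[OF assms(1)] fn_mk[OF assms(2)] fn_minus[of "mk f" "mk g"]
  by eventually_elim simp

lemma mk_zero: "mk (\<lambda>x. 0) = 0"
  by (simp add: zero_l2_def)

definition cscale :: "complex \<Rightarrow> l2 \<Rightarrow> l2" where
  "cscale c u = mk (\<lambda>x. c * fn u x)"

lemma fn_cscale: "AE x in lborel. fn (cscale c u) x = c * fn u x"
  unfolding cscale_def by (rule fn_mk) (simp add: L2_cmult)

lemma cscale_of_real: "cscale (of_real r) u = r *\<^sub>R u"
  by (simp add: cscale_def scaleR_l2_def)

lemma cscale_mk: assumes "L2 f" shows "cscale c (mk f) = mk (\<lambda>x. c * f x)"
  unfolding l2_eq_iff using fn_cscale[of c "mk f"] fn_mk[OF assms] fn_mk[OF L2_cmult[OF assms, of c]]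
  by eventually_elim simp

lemma inner_mk: "L2 f \<Longrightarrow> L2 g \<Longrightarrow> inner (mk f) (mk g) = Re (l2inner f g)"
  unfolding inner_l2_def by (subst l2inner_AE_cong[of _ f _ g]) (auto simp: fn_mk)

text \<open>Since \<open>cnj \<i>\<close> times a number has the imaginary part of that number as
  its real part, two real inner products determine the complex one.\<close>

lemma l2inner_eq:
  assumes "L2 f" "L2 g"
  shows "l2inner f g = Complex (inner (mk f) (mk g)) (inner (mk f) (cscale \<i> (mk g)))"
  using assms by (simp add: cscale_mk inner_mk L2_cmult l2inner_cmult_right complex_eq_iff)

lemma norm_cscale: "norm (cscale c u) = cmod c * norm u"
proof -
  have "(norm (cscale c u))\<^sup>2 = (cmod c * norm u)\<^sup>2"
    unfolding power_mult_distrib norm_l2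
    apply (subst integral_cong_AE[where g = "\<lambda>x. (cmod c)\<^sup>2 * (cmod (fn u x))\<^sup>2"])
    using fn_cscale[of c u] by (auto elim!: eventually_mono simp: norm_mult power_mult_distrib)
  then show ?thesis by (simp add: power2_eq_iff_nonneg)
qed

lemma cscale_diff: "cscale c (u - v) = cscale c u - cscale c v"
  unfolding l2_eq_iff using fn_cscale[of c "u - v"] fn_minus[of u v] fn_cscale[of c u] fn_cscale[of c v] fn_minus[of "cscale c u" "cscale c v"]
  by eventually_elim (simp add: right_diff_distrib)

lemma cscale_diff_left: "cscale (c - d) u = cscale c u - cscale d u"
  unfolding l2_eq_iff using fn_cscale[of "c - d" u] fn_cscale[of c u] fn_cscale[of d u] fn_minus[of "cscale c u" "cscale d u"]
  by eventually_elim (simp add: left_diff_distrib)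

lemma cscale_scaleR: "cscale c (r *\<^sub>R u) = r *\<^sub>R cscale c u"
  unfolding l2_eq_iff using fn_cscale[of c "r *\<^sub>R u"] fn_scaleR[of r u] fn_cscale[of c u] fn_scaleR[of r "cscale c u"]
  by eventually_elim (simp add: algebra_simps)

lemma cscale_cscale: "cscale c (cscale d u) = cscale (c * d) u"
  unfolding l2_eq_iff using fn_cscale[of c "cscale d u"] fn_cscale[of d u] fn_cscale[of "c * d" u]
  by eventually_elim simp

lemma inner_cscale_right: "inner u (cscale c v) = inner (cscale (cnj c) u) v"
proof -
  have "inner (mk (fn u)) (cscale c (mk (fn v))) = inner (cscale (cnj c) (mk (fn u))) (mk (fn v))"
    unfolding cscale_mk[OF fn_L2]
    by (simp only: inner_mk[OF fn_L2 L2_cmult[OF fn_L2]] inner_mk[OF L2_cmult[OF fn_L2] fn_L2] l2inner_cmult_left l2inner_cmult_right)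
  then show ?thesis by simp
qed

lemma bounded_linear_cscale: "bounded_linear (cscale c)"
proof (rule bounded_linear_intro[where K = "cmod c"])
  show "cscale c (u + v) = cscale c u + cscale c v" for u v
    using cscale_diff[of c "u + v" v] by (simp add: algebra_simps)
qed (auto simp: cscale_scaleR norm_cscale mult.commute)

section \<open>Completeness of \<open>l2\<close> (Riesz-Fischer)\<close>

lemma norm_diff_nn:
  "(\<integral>\<^sup>+x. ennreal ((cmod (fn u x - fn v x))\<^sup>2) \<partial>lborel) = ennreal ((norm (u - v))\<^sup>2)"
  unfolding norm_l2_nn by (intro nn_integral_cong_AE eventually_mono[OF fn_minus[of u v]]) simp

text \<open>The weights force the terms below a geometric sequence of ratio
  \<open>sqrt (1/2)\<close>. This turns square-integral control of increments into pointwise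
  convergence.\<close>

lemma summable_of_weighted_squares:
  fixes b :: "nat \<Rightarrow> complex"
  assumes "(\<Sum>n. ennreal (2 ^ n * (cmod (b n))\<^sup>2)) < \<infinity>"
  shows "summable b"
proof -
  have "summable (\<lambda>n. 2 ^ n * (cmod (b n))\<^sup>2)"
    using assms by (intro summable_suminf_not_top) auto
  then have "Bseq (\<lambda>n. 2 ^ n * (cmod (b n))\<^sup>2)"
    by (intro convergent_imp_Bseq convergentI[OF summable_LIMSEQ_zero])
  then obtain K where K: "K > 0" "\<And>n. 2 ^ n * (cmod (b n))\<^sup>2 \<le> K"
    unfolding Bseq_def by auto
  have bound: "cmod (b n) \<le> sqrt K * sqrt (1/2) ^ n" for n
  proof -
    have "(cmod (b n))\<^sup>2 \<le> K * (1/2) ^ n" using K(2)[of n] by (simp add: field_simps)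
    then have "cmod (b n) \<le> sqrt (K * (1/2) ^ n)" by (rule real_le_rsqrt)
    then show ?thesis by (simp add: real_sqrt_mult real_sqrt_power)
  qed
  have "sqrt (1/2) < (1::real)" by simp
  then have "summable (\<lambda>n. sqrt K * sqrt (1/2) ^ n)"
    by (intro summable_mult summable_geometric) simp
  then show ?thesis by (rule summable_comparison_test') (rule bound)
qed

instance l2 :: banach
proof
  fix X :: "nat \<Rightarrow> l2" assume X: "Cauchy X"
  have "\<forall>n. \<exists>N. \<forall>i\<ge>N. \<forall>j\<ge>N. dist (X i) (X j) < (1/2) ^ n"
    using metric_CauchyD[OF X] by simp
  then obtain N where N: "\<And>n i j. i \<ge> N n \<Longrightarrow> j \<ge> N n \<Longrightarrow> dist (X i) (X j) < (1/2) ^ n" by metis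
  \<comment> \<open>Summing the thresholds puts \<open>r m\<close> above every \<open>N n\<close>
    with \<open>n \<le> m\<close>; adding \<open>n\<close> makes the sequence strictly
    increasing.\<close>
  define r where "r n = (\<Sum>k\<le>n. N k) + n" for n
  have r: "strict_mono r" unfolding strict_mono_Suc_iff r_def by simp
  have rN: "N n \<le> r m" if "n \<le> m" for n m
  proof -
    have "N n \<le> (\<Sum>k\<le>m. N k)" by (rule member_le_sum) (use that in auto)
    then show ?thesis by (simp add: r_def)
  qed
  have close: "dist (X (r i)) (X (r j)) < (1/2) ^ n" if "n \<le> i" "n \<le> j" for i j n
    using N[OF rN rN] that by simp
  define F where "F n = fn (X (r n))" for n
  have [measurable]: "F n \<in> borel_measurable borel" for n by (simp add: F_def)
  have int: "(\<integral>\<^sup>+x. ennreal ((cmod (F i x - F j x))\<^sup>2) \<partial>lborel) \<le> ennreal (((1/2) ^ n)\<^sup>2)"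
    if "n \<le> i" "n \<le> j" for i j n
    unfolding F_def norm_diff_nn
    using close[OF that] by (intro ennreal_leI power_mono) (auto simp: dist_norm)
  have "(\<integral>\<^sup>+x. (\<Sum>n. ennreal (2 ^ n * (cmod (F (Suc n) x - F n x))\<^sup>2)) \<partial>lborel)
      = (\<Sum>n. ennreal (2 ^ n) * (\<integral>\<^sup>+x. ennreal ((cmod (F (Suc n) x - F n x))\<^sup>2) \<partial>lborel))"
    by (subst nn_integral_suminf) (auto simp: ennreal_mult nn_integral_cmult)
  \<comment> \<open>The squared increments decay like the powers of 1/4, which leaves room for the
    weights \<open>2 ^ n\<close>.\<close>
  also have "\<dots> \<le> (\<Sum>n. ennreal ((1/2) ^ n))"
  proof (intro suminf_le summableI)
    fix n
    have "ennreal (2 ^ n) * (\<integral>\<^sup>+x. ennreal ((cmod (F (Suc n) x - F n x))\<^sup>2) \<partial>lborel)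
        \<le> ennreal (2 ^ n) * ennreal (((1/2) ^ n)\<^sup>2)"
      by (intro mult_left_mono int) auto
    also have "\<dots> = ennreal ((1/2) ^ n)"
      by (simp add: ennreal_mult[symmetric] power2_eq_square power_one_over field_simps)
    finally show "ennreal (2 ^ n) * (\<integral>\<^sup>+x. ennreal ((cmod (F (Suc n) x - F n x))\<^sup>2) \<partial>lborel) \<le> ennreal ((1/2) ^ n)" .
  qed
  also have "\<dots> = ennreal 2"
    using summable_geometric_half[of 1] by (subst suminf_ennreal2) auto
  finally have "AE x in lborel. (\<Sum>n. ennreal (2 ^ n * (cmod (F (Suc n) x - F n x))\<^sup>2)) \<noteq> \<infinity>"
    by (intro nn_integral_PInf_AE) (auto simp: top_unique)
  then have conv: "AE x in lborel. convergent (\<lambda>n. F n x)"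
  proof eventually_elim
    case (elim x)
    then have "summable (\<lambda>n. F (Suc n) x - F n x)"
      by (intro summable_of_weighted_squares) (simp add: less_top)
    then have "convergent (\<lambda>n. F n x - F 0 x)"
      unfolding summable_iff_convergent sum_lessThan_telescope[of "\<lambda>n. F n x"] .
    then show "convergent (\<lambda>n. F n x)" by (simp add: convergent_diff_const_right_iff)
  qed
  define f where "f x = lim (\<lambda>n. F n x)" for x
  have [measurable]: "f \<in> borel_measurable borel"
    unfolding f_def by (rule borel_measurable_lim_metric) simp
  \<comment> \<open>Fatou's lemma carries the Cauchy bound over to the almost everywhere limit; this
    gives both membership in \<open>l2\<close> and the rate of convergence.\<close>
  have fatou: "(\<integral>\<^sup>+x. ennreal ((cmod (f x - F n x))\<^sup>2) \<partial>lborel) \<le> ennreal (((1/2) ^ n)\<^sup>2)" for n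
  proof -
    have "(\<integral>\<^sup>+x. ennreal ((cmod (f x - F n x))\<^sup>2) \<partial>lborel)
        = (\<integral>\<^sup>+x. liminf (\<lambda>k. ennreal ((cmod (F k x - F n x))\<^sup>2)) \<partial>lborel)"
    proof (intro nn_integral_cong_AE eventually_mono[OF conv])
      fix x assume "convergent (\<lambda>n. F n x)"
      then have "(\<lambda>k. F k x) \<longlonglongrightarrow> f x" by (simp add: f_def convergent_LIMSEQ_iff)
      then have "(\<lambda>k. ennreal ((cmod (F k x - F n x))\<^sup>2)) \<longlonglongrightarrow> ennreal ((cmod (f x - F n x))\<^sup>2)"
        by (intro tendsto_intros)
      then show "ennreal ((cmod (f x - F n x))\<^sup>2) = liminf (\<lambda>k. ennreal ((cmod (F k x - F n x))\<^sup>2))"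
        by (intro lim_imp_Liminf[symmetric]) auto
    qed
    also have "\<dots> \<le> liminf (\<lambda>k. \<integral>\<^sup>+x. ennreal ((cmod (F k x - F n x))\<^sup>2) \<partial>lborel)"
      by (rule nn_integral_liminf) simp
    also have "\<dots> \<le> ennreal (((1/2) ^ n)\<^sup>2)"
    proof (rule Liminf_le)
      show "\<forall>\<^sub>F k in sequentially. (\<integral>\<^sup>+x. ennreal ((cmod (F k x - F n x))\<^sup>2) \<partial>lborel) \<le> ennreal (((1/2) ^ n)\<^sup>2)"
        using eventually_ge_at_top[of n] by eventually_elim (use int in auto)
    qed simp
    finally show ?thesis .
  qed
  have "L2 (\<lambda>x. f x - F 0 x)" unfolding L2_def
  proof
    show "integrable lborel (\<lambda>x. (cmod (f x - F 0 x))\<^sup>2)"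
      using fatou[of 0] by (intro integrableI_bounded) (auto simp: le_less_trans)
  qed simp
  then have "L2 (\<lambda>x. (f x - F 0 x) + F 0 x)" by (rule L2_add) (simp add: F_def)
  then have f: "L2 f" by simp
  have "dist (X (r n)) (mk f) \<le> (1/2) ^ n" for n
  proof -
    have "ennreal ((norm (mk f - X (r n)))\<^sup>2) = (\<integral>\<^sup>+x. ennreal ((cmod (f x - F n x))\<^sup>2) \<partial>lborel)"
      unfolding norm_diff_nn[symmetric] F_def
      by (intro nn_integral_cong_AE eventually_mono[OF fn_mk[OF f]]) simp
    also have "\<dots> \<le> ennreal (((1/2) ^ n)\<^sup>2)" by (rule fatou)
    finally have "(norm (mk f - X (r n)))\<^sup>2 \<le> ((1/2) ^ n)\<^sup>2" by simp
    then have "norm (mk f - X (r n)) \<le> (1/2) ^ n" by (rule power2_le_imp_le) simp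
    then show ?thesis by (simp add: dist_norm norm_minus_commute)
  qed
  then have le: "\<forall>n. norm (dist ((X \<circ> r) n) (mk f)) \<le> (1/2) ^ n" by simp
  have "(\<lambda>n. dist ((X \<circ> r) n) (mk f)) \<longlonglongrightarrow> 0"
    by (rule Lim_null_comparison[OF always_eventually[OF le]]) (simp add: LIMSEQ_power_zero)
  then have "(X \<circ> r) \<longlonglongrightarrow> mk f" unfolding tendsto_dist_iff[symmetric] .
  then have "X \<longlonglongrightarrow> mk f" by (rule Cauchy_converges_subseq[OF X r])
  then show "convergent X" by (rule convergentI)
qed

section \<open>Graphs of functions as relations on \<open>l2\<close>, and Weyl's criterion\<close>

definition qgraph :: "((real \<Rightarrow> complex) \<times> (real \<Rightarrow> complex)) set \<Rightarrow> (l2 \<times> l2) set" where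
  "qgraph G = {p. (fn (fst p), fn (snd p)) \<in> G}"

lemma mem_qgraph: "(u, f) \<in> qgraph G \<longleftrightarrow> (fn u, fn f) \<in> G"
  by (simp add: qgraph_def)

locale sa_graph =
  fixes G :: "((real \<Rightarrow> complex) \<times> (real \<Rightarrow> complex)) set"
  assumes sa: "self_adjoint_graph G"
    and L2G: "\<And>u f. (u, f) \<in> G \<Longrightarrow> L2 u \<and> L2 f"
begin

lemma symm: "(u, f) \<in> G \<Longrightarrow> (w, g) \<in> G \<Longrightarrow> l2inner f w = l2inner u g"
  using sa unfolding self_adjoint_graph_def by blast

lemma maximal:
  "L2 w \<Longrightarrow> L2 g \<Longrightarrow> (\<And>u f. (u, f) \<in> G \<Longrightarrow> l2inner f w = l2inner u g) \<Longrightarrow> (w, g) \<in> G"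
  using sa unfolding self_adjoint_graph_def by blast

text \<open>Inner products ignore null sets, so a modified pair still satisfies the symmetry
  conditions and maximality admits it. Hence membership in \<open>qgraph G\<close> does not depend
  on the chosen representatives.\<close>

lemma saturated:
  assumes "(u, f) \<in> G" "L2 u'" "L2 f'" "AE x in lborel. u x = u' x" "AE x in lborel. f x = f' x"
  shows "(u', f') \<in> G"
proof (rule maximal)
  fix w g assume w: "(w, g) \<in> G"
  have "l2inner g u' = l2inner g u" "l2inner w f = l2inner w f'"
    using assms L2G[OF w] L2G[OF assms(1)] by (auto intro!: l2inner_AE_cong elim: eventually_mono)
  then show "l2inner g u' = l2inner w f'" using symm[OF w assms(1)] by simp
qed fact+

lemma mk_mem_qgraph: "(u, f) \<in> G \<Longrightarrow> (mk u, mk f) \<in> qgraph G"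
  unfolding mem_qgraph using L2G[of u f] fn_mk[of u] fn_mk[of f]
  by (intro saturated[of u f "fn (mk u)" "fn (mk f)"]) (auto elim: eventually_mono)

lemma cmult_mem: "(u, f) \<in> G \<Longrightarrow> ((\<lambda>x. c * u x), (\<lambda>x. c * f x)) \<in> G"
  using L2G[of u f] by (intro maximal) (auto simp: L2_cmult l2inner_cmult_right symm)

lemma cscale_mem: "(u, f) \<in> qgraph G \<Longrightarrow> (cscale c u, cscale c f) \<in> qgraph G"
  using mk_mem_qgraph[OF cmult_mem[of "fn u" "fn f" c]] by (simp add: mem_qgraph cscale_def)

lemma self_adjoint_qgraph: "self_adjoint (qgraph G)"
  unfolding self_adjoint_def
proof (intro conjI allI impI)
  show "\<forall>(u, f)\<in>qgraph G. \<forall>(w, g)\<in>qgraph G. inner f w = inner u g"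
    by (auto simp: mem_qgraph inner_l2_def intro!: arg_cong[where f = Re] symm)
  fix w g assume a: "\<forall>(u, f)\<in>qgraph G. inner f w = inner u g"
  show "(w, g) \<in> qgraph G" unfolding mem_qgraph
  proof (rule maximal)
    fix u f assume uf: "(u, f) \<in> G"
    have "inner (mk f) w = inner (mk u) g" using a mk_mem_qgraph[OF uf] by blast
    \<comment> \<open>The real hypothesis, used on the pair rotated by \<open>cnj \<i>\<close>,
      supplies the imaginary part of the complex identity.\<close>
    moreover have "inner (cscale (cnj \<i>) (mk f)) w = inner (cscale (cnj \<i>) (mk u)) g"
      using a cscale_mem[OF mk_mem_qgraph[OF uf]] by blast
    ultimately show "l2inner f (fn w) = l2inner u (fn g)"
      using L2G[OF uf] by (simp add: l2inner_eq inner_cscale_right)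
  qed simp_all
qed

lemmas q_subspace = self_adjoint_subspace[OF self_adjoint_qgraph]
lemmas q_closed = self_adjoint_closed[OF self_adjoint_qgraph]

lemma not_spec_iff:
  "z \<notin> spec_graph G \<longleftrightarrow> (\<forall>u. (u, cscale z u) \<in> qgraph G \<longrightarrow> u = 0) \<and>
     (\<forall>g. \<exists>u f. (u, f) \<in> qgraph G \<and> f - cscale z u = g)"
proof -
  have "(\<forall>(u, f)\<in>G. (AE x in lborel. f x = z * u x) \<longrightarrow> (AE x in lborel. u x = 0))
      \<longleftrightarrow> (\<forall>u. (u, cscale z u) \<in> qgraph G \<longrightarrow> u = 0)" (is "?A = ?B")
  proof
    assume A: ?A
    show ?B
    proof (intro allI impI)
      fix u assume "(u, cscale z u) \<in> qgraph G"
      then have "AE x in lborel. fn u x = 0" using A fn_cscale[of z u] unfolding mem_qgraph by blast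
      then show "u = 0" unfolding l2_eq_iff using fn_zero by eventually_elim simp
    qed
  next
    assume B: ?B
    show ?A
    proof -
      have "AE x in lborel. u x = 0" if uf: "(u, f) \<in> G" and ae: "AE x in lborel. f x = z * u x" for u f
      proof -
      have L: "L2 u" "L2 f" using L2G[OF uf] by auto
      have "mk f = cscale z (mk u)" using L ae by (simp add: cscale_mk mk_eq_iff L2_cmult)
      then have "mk u = 0" using B mk_mem_qgraph[OF uf] by metis
      then show "AE x in lborel. u x = 0" using L mk_eq_iff[of u "\<lambda>x. 0"] by (simp add: mk_zero L2_zero)
      qed
      then show ?thesis by blast
    qed
  qed
  moreover have "(\<forall>g. L2 g \<longrightarrow> (\<exists>(u, f)\<in>G. AE x in lborel. f x - z * u x = g x))
      \<longleftrightarrow> (\<forall>g. \<exists>u f. (u, f) \<in> qgraph G \<and> f - cscale z u = g)" (is "?A = ?B")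
  proof
    assume A: ?A
    show ?B
    proof
      fix g
      obtain u f where uf: "(u, f) \<in> G" "AE x in lborel. f x - z * u x = fn g x" using A fn_L2[of g] by blast
      have L: "L2 u" "L2 f" using L2G[OF uf(1)] by auto
      have "mk f - cscale z (mk u) = mk (fn g)"
        unfolding cscale_mk[OF L(1)] mk_diff[OF L(2) L2_cmult[OF L(1)], symmetric]
        using uf(2) L by (subst mk_eq_iff) (auto intro: L2_diff L2_cmult)
      then show "\<exists>u f. (u, f) \<in> qgraph G \<and> f - cscale z u = g" using mk_mem_qgraph[OF uf(1)] by auto
    qed
  next
    assume B: ?B
    show ?A
    proof (intro allI impI)
      fix g assume g: "L2 g"
      obtain u f where uf: "(u, f) \<in> qgraph G" "f - cscale z u = mk g" using B by blast
      have "AE x in lborel. fn f x - z * fn u x = g x"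
        using fn_minus[of f "cscale z u"] fn_cscale[of z u] fn_mk[OF g] unfolding uf(2)
        by eventually_elim simp
      then show "\<exists>(u, f)\<in>G. AE x in lborel. f x - z * u x = g x" using uf(1) unfolding mem_qgraph by blast
    qed
  qed
  ultimately show ?thesis unfolding spec_graph_def by simp
qed

lemma not_spec_real: "of_real t \<notin> spec_graph G \<Longrightarrow> regular_at (qgraph G) t"
  unfolding not_spec_iff regular_at_def cscale_of_real .

lemma inner_cscale_i_self: "inner u (cscale \<i> u) = 0"
proof -
  have "inner u (cscale \<i> u) = - inner u (cscale \<i> u)"
    by (subst inner_cscale_right) (simp add: inner_commute[of _ u] cscale_diff_left[of 0 \<i>, simplified] cscale_of_real[of 0, simplified])
  then show ?thesis by simp
qed

lemma cscale_complex: "cscale z u = Re z *\<^sub>R u + Im z *\<^sub>R cscale \<i> u"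
proof -
  have "cscale z u = cscale (of_real (Re z)) u - cscale (- (of_real (Im z) * \<i>)) u"
    unfolding cscale_diff_left[symmetric] by (rule arg_cong[where f = "\<lambda>z. cscale z u"]) (simp add: complex_eq_iff)
  also have "cscale (- (of_real (Im z) * \<i>)) u = - (Im z *\<^sub>R cscale \<i> u)"
    using cscale_cscale[of "of_real (- Im z)" \<i> u] cscale_of_real[of "- Im z" "cscale \<i> u"] by simp
  finally show ?thesis by (simp add: cscale_of_real)
qed

text \<open>The quadratic form of a symmetric relation is real, so pairing
  \<open>f - cscale z u\<close> with \<open>cscale \<i> u\<close> leaves only the contribution of
  \<open>Im z\<close>; Cauchy-Schwarz does the rest.\<close>

lemma imag_bound:
  assumes uf: "(u, f) \<in> qgraph G"
  shows "\<bar>Im z\<bar> * norm u \<le> norm (f - cscale z u)"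
proof -
  have "inner f (cscale \<i> u) = inner u (cscale \<i> f)"
    using self_adjoint_symmetric[OF self_adjoint_qgraph uf cscale_mem[OF uf]] .
  also have "\<dots> = - inner f (cscale \<i> u)"
    by (subst inner_cscale_right) (simp add: inner_commute[of _ f] cscale_diff_left[of 0 \<i>, simplified] cscale_of_real[of 0, simplified])
  finally have "inner f (cscale \<i> u) = 0" by simp
  then have "inner (f - cscale z u) (cscale \<i> u) = - Im z * (norm u)\<^sup>2"
    unfolding cscale_complex[of z u]
    by (simp add: inner_diff_left inner_add_left inner_cscale_i_self power2_norm_eq_inner[symmetric] norm_cscale)
  then have "\<bar>Im z\<bar> * norm u * norm u \<le> norm (f - cscale z u) * norm u"
    using Cauchy_Schwarz_ineq2[of "f - cscale z u" "cscale \<i> u"]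
    by (simp add: norm_cscale abs_mult power2_eq_square mult.assoc)
  then show ?thesis by (cases "u = 0") auto
qed

text \<open>Without such a pair the shifted relation \<open>H\<close> is bounded below by
  \<open>c\<close>, so it is injective with closed range. What is orthogonal to the range is an
  eigenvector for \<open>cnj z\<close>, excluded by \<open>imag_bound\<close> if \<open>z\<close> is
  not real and by the same lower bound if it is. Then \<open>z\<close> would not be
  spectral.\<close>

lemma approx_eigenvector:
  assumes z: "z \<in> spec_graph G" and c: "c > 0"
  shows "\<exists>u f. (u, f) \<in> qgraph G \<and> norm (f - cscale z u) < c * norm u"
proof (rule ccontr)
  assume "\<not> ?thesis"
  then have below: "\<And>u f. (u, f) \<in> qgraph G \<Longrightarrow> c * norm u \<le> norm (f - cscale z u)" by (meson not_le)
  define H where "H = (\<lambda>p. (fst p, snd p - cscale z (fst p))) ` qgraph G"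
  have memH: "(u, h) \<in> H \<longleftrightarrow> (u, h + cscale z u) \<in> qgraph G" for u h
    unfolding H_def by force
  interpret cmz: bounded_linear "cscale z" by (rule bounded_linear_cscale)
  have "linear (\<lambda>p. (fst p, snd p - cscale z (fst p)))"
    by (rule linearI) (auto simp: cmz.add cmz.scaleR scaleR_diff_right)
  then have H1: "subspace H" unfolding H_def using q_subspace by (rule linear_subspace_image)
  have "H = (\<lambda>p. (fst p, snd p + cscale z (fst p))) -` qgraph G" using memH by auto
  moreover have "closed ((\<lambda>p. (fst p, snd p + cscale z (fst p))) -` qgraph G)"
    by (intro closed_vimage q_closed continuous_intros cmz.continuous_on)
  ultimately have H2: "closed H" by simp
  have "\<exists>u. (u, g) \<in> H" for g
  proof (rule closed_range_surj[OF H1 H2 c])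
    show "c * norm u \<le> norm h" if "(u, h) \<in> H" for u h
      using below[of u "h + cscale z u"] that by (simp add: memH)
    fix g assume a: "\<And>u h. (u, h) \<in> H \<Longrightarrow> inner h g = 0"
    have g: "(g, cscale (cnj z) g) \<in> qgraph G"
    proof (rule self_adjoint_maximal[OF self_adjoint_qgraph])
      fix u f assume "(u, f) \<in> qgraph G"
      then have "inner (f - cscale z u) g = 0" by (intro a[of u]) (simp add: memH)
      then show "inner f g = inner u (cscale (cnj z) g)" by (simp add: inner_diff_left inner_cscale_right)
    qed
    have "\<bar>Im z\<bar> * norm g \<le> norm (cscale (cnj z) g - cscale (cnj z) g)"
      using imag_bound[OF g, of "cnj z"] by simp
    then have "Im z = 0 \<or> g = 0" by (auto simp: mult_le_0_iff)
    moreover have "g = 0" if "Im z = 0"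
    proof -
      have "cnj z = z" using that by (simp add: complex_eq_iff)
      then show ?thesis using below[OF g] c by (simp add: mult_le_0_iff)
    qed
    ultimately show "g = 0" by blast
  qed
  then have "\<exists>u f. (u, f) \<in> qgraph G \<and> f - cscale z u = g" for g
    by (metis memH add_diff_cancel)
  moreover have "u = 0" if "(u, cscale z u) \<in> qgraph G" for u
    using below[OF that] c by (simp add: mult_le_0_iff)
  ultimately have "z \<notin> spec_graph G" unfolding not_spec_iff by blast
  with z show False by simp
qed

lemma spec_real: "z \<in> spec_graph G \<Longrightarrow> z = of_real (Re z)"
proof (rule ccontr)
  assume z: "z \<in> spec_graph G" "z \<noteq> of_real (Re z)"
  then have "\<bar>Im z\<bar> > 0" by (simp add: complex_eq_iff)
  from approx_eigenvector[OF z(1) this] imag_bound[of _ _ z] show False by (meson not_le)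
qed

lemma gap_bound:
  assumes d: "d > 0" and far: "\<And>w. w \<in> spec_graph G \<Longrightarrow> d \<le> dist (of_real t) w"
    and uf: "(u, f) \<in> qgraph G"
  shows "d * norm u \<le> norm (f - cscale (of_real t) u)"
  unfolding cscale_of_real
proof (rule spectral_gap_bound[OF self_adjoint_qgraph d _ uf])
  fix s :: real assume "\<bar>s - t\<bar> < d"
  then have "dist (complex_of_real t) (of_real s) < d"
    by (simp add: dist_norm norm_of_real abs_minus_commute flip: of_real_diff)
  then show "regular_at (qgraph G) s" using far by (intro not_spec_real) fastforce
qed

end

section \<open>Test functions and weak derivatives\<close>

definition smooth1 :: "(real \<Rightarrow> complex) \<Rightarrow> bool" where
  "smooth1 h \<longleftrightarrow> (\<forall>k x. ((vderiv ^^ k) h) differentiable (at x))"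

lemma smooth1_has_vderiv: "smooth1 h \<Longrightarrow> (h has_vector_derivative vderiv h x) (at x)"
  unfolding smooth1_def vderiv_def
  using vector_derivative_works[of h "at x"] by (metis funpow_0)

lemma smooth1_vderiv: "smooth1 h \<Longrightarrow> smooth1 (vderiv h)"
  unfolding smooth1_def by (metis funpow_Suc_right o_apply)

lemma vderiv_eqI: "(\<And>x. (h has_vector_derivative h' x) (at x)) \<Longrightarrow> vderiv h = h'"
  unfolding vderiv_def by (auto intro: vector_derivative_at)

lemma smooth1_continuous: "smooth1 h \<Longrightarrow> continuous_on UNIV h"
  by (metis smooth1_has_vderiv has_vector_derivative_continuous continuous_at_imp_continuous_on)

lemma smooth1_measurable: "smooth1 h \<Longrightarrow> h \<in> borel_measurable borel"
  by (intro borel_measurable_continuous_onI smooth1_continuous)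

text \<open>All iterated derivatives stay in a class that is closed under differentiation.
  Exhibiting such a class replaces formulas for derivatives of arbitrary order.\<close>

lemma smooth1_coinduct:
  assumes "P h" and step: "\<And>f. P f \<Longrightarrow> \<exists>f'. P f' \<and> (\<forall>x. (f has_vector_derivative f' x) (at x))"
  shows "smooth1 h"
proof -
  have "P ((vderiv ^^ k) h)" for k
  proof (induction k)
    case (Suc k)
    then show ?case using step[OF Suc] vderiv_eqI by fastforce
  qed (simp add: assms(1))
  then show ?thesis unfolding smooth1_def using step
    by (meson differentiableI_vector)
qed

text \<open>The class used for products: the derivative of one product is a sum of two, hence the
  closure under addition.\<close>

inductive prod_span :: "(real \<Rightarrow> complex) \<Rightarrow> bool" where
  prod: "smooth1 f \<Longrightarrow> smooth1 g \<Longrightarrow> prod_span (\<lambda>x. f x * g x)"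
| add: "prod_span f \<Longrightarrow> prod_span g \<Longrightarrow> prod_span (\<lambda>x. f x + g x)"

lemma vderiv_mult_has:
  assumes "smooth1 f" "smooth1 g"
  shows "((\<lambda>x. f x * g x) has_vector_derivative vderiv f x * g x + f x * vderiv g x) (at x)"
  using has_vector_derivative_mult[OF smooth1_has_vderiv[OF assms(1)] smooth1_has_vderiv[OF assms(2)], of x]
  by (simp add: add.commute)

lemma smooth1_mult:
  assumes "smooth1 f" "smooth1 g" shows "smooth1 (\<lambda>x. f x * g x)"
proof (rule smooth1_coinduct[of prod_span])
  show "prod_span (\<lambda>x. f x * g x)" using assms by (rule prod_span.prod)
  show "\<exists>f'. prod_span f' \<and> (\<forall>x. (f has_vector_derivative f' x) (at x))" if "prod_span f" for f
    using that
  proof induction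
    case (prod f g)
    show ?case
      using prod_span.add[OF prod_span.prod[OF smooth1_vderiv[OF prod(1)] prod(2)] prod_span.prod[OF prod(1) smooth1_vderiv[OF prod(2)]]]
        vderiv_mult_has[OF prod] by blast
  next
    case (add f g)
    then obtain f' g' where "prod_span f'" "prod_span g'"
      "\<forall>x. (f has_vector_derivative f' x) (at x)" "\<forall>x. (g has_vector_derivative g' x) (at x)" by blast
    then show ?case by (intro exI[of _ "\<lambda>x. f' x + g' x"]) (auto intro: prod_span.add has_vector_derivative_add)
  qed
qed

lemma test_fun_smooth: "test_fun \<phi> \<Longrightarrow> smooth1 \<phi>"
  by (simp add: test_fun_def smooth1_def)

lemma test_fun_mult:
  assumes "smooth1 h" "test_fun \<phi>" shows "test_fun (\<lambda>x. h x * \<phi> x)"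
proof -
  have "{x. h x * \<phi> x \<noteq> 0} \<subseteq> {x. \<phi> x \<noteq> 0}" by auto
  moreover have "bounded {x. \<phi> x \<noteq> 0}" using assms(2) by (simp add: test_fun_def)
  ultimately have "bounded {x. h x * \<phi> x \<noteq> 0}" using bounded_subset by blast
  then show ?thesis
    using smooth1_mult[OF assms(1) test_fun_smooth[OF assms(2)]] by (simp add: test_fun_def smooth1_def)
qed

lemma test_fun_vderiv:
  assumes "test_fun \<phi>" shows "test_fun (vderiv \<phi>)"
proof -
  \<comment> \<open>Off the closed support the function vanishes on a neighbourhood, so its
    derivative vanishes as well.\<close>
  have "x \<in> closure {x. \<phi> x \<noteq> 0}" if "vderiv \<phi> x \<noteq> 0" for x
  proof (rule ccontr)
    assume x: "x \<notin> closure {x. \<phi> x \<noteq> 0}"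
    have "((\<lambda>x. 0) has_vector_derivative vderiv \<phi> x) (at x)"
    proof (rule has_vector_derivative_transform_within_open[OF smooth1_has_vderiv[OF test_fun_smooth[OF assms]]])
      show "open (- closure {x. \<phi> x \<noteq> 0})" by auto
      show "x \<in> - closure {x. \<phi> x \<noteq> 0}" using x by simp
      show "\<phi> y = 0" if "y \<in> - closure {x. \<phi> x \<noteq> 0}" for y
        using that closure_subset[of "{x. \<phi> x \<noteq> 0}"] by auto
    qed
    then have "vderiv \<phi> x = 0" using vector_derivative_unique_at has_vector_derivative_const by blast
    with that show False by simp
  qed
  then have "{x. vderiv \<phi> x \<noteq> 0} \<subseteq> closure {x. \<phi> x \<noteq> 0}" by blast
  moreover have "bounded (closure {x. \<phi> x \<noteq> 0})" using assms by (simp add: test_fun_def bounded_closure)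
  ultimately have "bounded {x. vderiv \<phi> x \<noteq> 0}" using bounded_subset by blast
  then show ?thesis
    using smooth1_vderiv[OF test_fun_smooth[OF assms]] by (simp add: test_fun_def smooth1_def)
qed

lemma test_fun_L2:
  assumes "test_fun \<phi>" shows "L2 \<phi>"
  unfolding L2_def
proof
  note c = smooth1_continuous[OF test_fun_smooth[OF assms]]
  show "\<phi> \<in> borel_measurable lborel" using smooth1_measurable[OF test_fun_smooth[OF assms]] by simp
  let ?K = "closure {x. \<phi> x \<noteq> 0}"
  have "compact ?K" using assms by (simp add: test_fun_def compact_closure)
  then have "integrable lborel (\<lambda>x. indicator ?K x *\<^sub>R (cmod (\<phi> x))\<^sup>2)"
    by (intro borel_integrable_compact continuous_intros continuous_on_subset[OF c]) auto
  moreover have "(\<lambda>x. indicator ?K x *\<^sub>R (cmod (\<phi> x))\<^sup>2) = (\<lambda>x. (cmod (\<phi> x))\<^sup>2)"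
  proof
    fix x
    show "indicator ?K x *\<^sub>R (cmod (\<phi> x))\<^sup>2 = (cmod (\<phi> x))\<^sup>2"
    proof (cases "\<phi> x = 0")
      case False
      then have "x \<in> ?K" using closure_subset[of "{x. \<phi> x \<noteq> 0}"] by auto
      then show ?thesis by simp
    qed simp
  qed
  ultimately show "integrable lborel (\<lambda>x. (cmod (\<phi> x))\<^sup>2)" by simp
qed

section \<open>First-order weak derivatives and the Leibniz rule\<close>

definition weak_deriv :: "(real \<Rightarrow> complex) \<Rightarrow> (real \<Rightarrow> complex) \<Rightarrow> bool" where
  "weak_deriv p q \<longleftrightarrow> (\<forall>\<phi>. test_fun \<phi> \<longrightarrow> (LINT x|lborel. p x * vderiv \<phi> x) = - (LINT x|lborel. q x * \<phi> x))"

lemma weak_derivD: "weak_deriv p q \<Longrightarrow> test_fun \<phi> \<Longrightarrow> (LINT x|lborel. p x * vderiv \<phi> x) = - (LINT x|lborel. q x * \<phi> x)"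
  by (simp add: weak_deriv_def)

text \<open>The derivative of a test function is a test function, so the identity of order
  \<open>j\<close> tested on \<open>vderiv \<phi>\<close> links consecutive entries. In this form
  product rules and closedness need only one derivative at a time.\<close>

lemma weak_derivs_iff_chain:
  "weak_derivs m u v \<longleftrightarrow> v 0 = u \<and> (\<forall>j\<le>m. L2 (v j)) \<and> (\<forall>j<m. weak_deriv (v j) (v (Suc j)))"
proof
  assume w: "weak_derivs m u v"
  then have u: "v 0 = u" and w': "\<And>j \<phi>. 1 \<le> j \<Longrightarrow> j \<le> m \<Longrightarrow> test_fun \<phi> \<Longrightarrow>
     (LINT x|lborel. u x * (vderiv ^^ j) \<phi> x) = (-1) ^ j * (LINT x|lborel. v j x * \<phi> x)"
    by (auto simp: weak_derivs_def)
  have all: "(LINT x|lborel. u x * (vderiv ^^ j) \<phi> x) = (-1) ^ j * (LINT x|lborel. v j x * \<phi> x)"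
    if "j \<le> m" "test_fun \<phi>" for j \<phi>
    using w'[of j \<phi>] that u by (cases "j = 0") auto
  have "weak_deriv (v j) (v (Suc j))" if "j < m" for j
    unfolding weak_deriv_def
  proof (intro allI impI)
    fix \<phi> assume t: "test_fun \<phi>"
    have "(-1) ^ j * (LINT x|lborel. v j x * vderiv \<phi> x) = (LINT x|lborel. u x * (vderiv ^^ j) (vderiv \<phi>) x)"
      using all[of j "vderiv \<phi>"] that test_fun_vderiv[OF t] by simp
    also have "\<dots> = (-1) ^ Suc j * (LINT x|lborel. v (Suc j) x * \<phi> x)"
      using all[of "Suc j" \<phi>] that t by (simp add: funpow_swap1)
    finally have "(-1) ^ j * (LINT x|lborel. v j x * vderiv \<phi> x) = (-1) ^ j * - (LINT x|lborel. v (Suc j) x * \<phi> x)" by simp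
    then show "(LINT x|lborel. v j x * vderiv \<phi> x) = - (LINT x|lborel. v (Suc j) x * \<phi> x)"
      unfolding mult_cancel_left by simp
  qed
  with w u show "v 0 = u \<and> (\<forall>j\<le>m. L2 (v j)) \<and> (\<forall>j<m. weak_deriv (v j) (v (Suc j)))"
    by (auto simp: weak_derivs_def)
next
  assume c: "v 0 = u \<and> (\<forall>j\<le>m. L2 (v j)) \<and> (\<forall>j<m. weak_deriv (v j) (v (Suc j)))"
  have "(LINT x|lborel. u x * (vderiv ^^ j) \<phi> x) = (-1) ^ j * (LINT x|lborel. v j x * \<phi> x)"
    if "j \<le> m" "test_fun \<phi>" for j \<phi>
    using that
  proof (induction j arbitrary: \<phi>)
    case (Suc j)
    have "(LINT x|lborel. u x * (vderiv ^^ Suc j) \<phi> x) = (-1) ^ j * (LINT x|lborel. v j x * vderiv \<phi> x)"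
      using Suc.IH[of "vderiv \<phi>"] Suc.prems test_fun_vderiv by (simp add: funpow_swap1)
    also have "\<dots> = (-1) ^ Suc j * (LINT x|lborel. v (Suc j) x * \<phi> x)"
      using weak_derivD[of "v j" "v (Suc j)" \<phi>] c Suc.prems by simp
    finally show ?case .
  qed (use c in simp)
  with c show "weak_derivs m u v" by (simp add: weak_derivs_def)
qed

lemma weak_deriv_add:
  assumes "weak_deriv p q" "weak_deriv p' q'" and L: "L2 p" "L2 q" "L2 p'" "L2 q'"
  shows "weak_deriv (\<lambda>x. p x + p' x) (\<lambda>x. q x + q' x)"
  unfolding weak_deriv_def
proof (intro allI impI)
  fix \<phi> assume t: "test_fun \<phi>"
  note i = L2_integrable_mult[OF _ test_fun_L2[OF t]] L2_integrable_mult[OF _ test_fun_L2[OF test_fun_vderiv[OF t]]]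
  show "(LINT x|lborel. (p x + p' x) * vderiv \<phi> x) = - (LINT x|lborel. (q x + q' x) * \<phi> x)"
    using weak_derivD[OF assms(1) t] weak_derivD[OF assms(2) t] L by (simp add: distrib_right i)
qed

text \<open>The factor \<open>h\<close> is moved onto the test function: the identity for
  \<open>p\<close> is tested on the product of \<open>h\<close> and \<phi>, and the extra term is
  the one with \<open>vderiv h\<close>.\<close>

lemma weak_deriv_mult:
  assumes w: "weak_deriv p q" and L: "L2 p" "L2 q" and h: "smooth1 h"
  shows "weak_deriv (\<lambda>x. h x * p x) (\<lambda>x. vderiv h x * p x + h x * q x)"
  unfolding weak_deriv_def
proof (intro allI impI)
  fix \<phi> assume t: "test_fun \<phi>"
  note t1 = test_fun_mult[OF h t] and t2 = test_fun_mult[OF smooth1_vderiv[OF h] t]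
  have d: "vderiv (\<lambda>x. h x * \<phi> x) = (\<lambda>x. vderiv h x * \<phi> x + h x * vderiv \<phi> x)"
    by (rule vderiv_eqI) (rule vderiv_mult_has[OF h test_fun_smooth[OF t]])
  have i: "integrable lborel (\<lambda>x. p x * vderiv (\<lambda>x. h x * \<phi> x) x)"
    "integrable lborel (\<lambda>x. p x * (vderiv h x * \<phi> x))" "integrable lborel (\<lambda>x. q x * (h x * \<phi> x))"
    by (intro L2_integrable_mult L test_fun_L2 test_fun_vderiv t1 t2)+
  have "(LINT x|lborel. h x * p x * vderiv \<phi> x)
      = (LINT x|lborel. p x * vderiv (\<lambda>x. h x * \<phi> x) x - p x * (vderiv h x * \<phi> x))"
    unfolding d by (simp add: algebra_simps)
  also have "\<dots> = - (LINT x|lborel. q x * (h x * \<phi> x)) - (LINT x|lborel. p x * (vderiv h x * \<phi> x))"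
    by (subst Bochner_Integration.integral_diff[OF i(1,2)]) (simp add: weak_derivD[OF w t1])
  also have "\<dots> = - (LINT x|lborel. p x * (vderiv h x * \<phi> x) + q x * (h x * \<phi> x))"
    by (subst Bochner_Integration.integral_add[OF i(2,3)]) simp
  also have "(\<lambda>x. p x * (vderiv h x * \<phi> x) + q x * (h x * \<phi> x)) = (\<lambda>x. (vderiv h x * p x + h x * q x) * \<phi> x)"
    by (simp add: algebra_simps)
  finally show "(LINT x|lborel. h x * p x * vderiv \<phi> x) = - (LINT x|lborel. (vderiv h x * p x + h x * q x) * \<phi> x)" .
qed

text \<open>\<open>leibniz k D v\<close> is the \<open>k\<close>-th derivative of the product of \<open>D 0\<close> and \<open>v 0\<close>, the Leibniz formula
  unfolded recursively so that no binomial coefficients occur.\<close>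

fun leibniz :: "nat \<Rightarrow> (nat \<Rightarrow> real \<Rightarrow> complex) \<Rightarrow> (nat \<Rightarrow> real \<Rightarrow> complex) \<Rightarrow> real \<Rightarrow> complex" where
  "leibniz 0 D v = (\<lambda>x. D 0 x * v 0 x)"
| "leibniz (Suc k) D v = (\<lambda>x. leibniz k (\<lambda>i. D (Suc i)) v x + leibniz k D (\<lambda>i. v (Suc i)) x)"

text \<open>Lists a smooth function together with all its derivatives; the bounds, which may depend
  on the order, keep products square-integrable.\<close>

definition multiplier :: "(nat \<Rightarrow> real \<Rightarrow> complex) \<Rightarrow> bool" where
  "multiplier D \<longleftrightarrow> (\<forall>i. smooth1 (D i) \<and> vderiv (D i) = D (Suc i) \<and> (\<exists>C. \<forall>x. cmod (D i x) \<le> C))"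

lemma multiplier_Suc: "multiplier D \<Longrightarrow> multiplier (\<lambda>i. D (Suc i))"
  by (simp add: multiplier_def)

lemma multiplier_L2: "multiplier D \<Longrightarrow> L2 p \<Longrightarrow> L2 (\<lambda>x. D i x * p x)"
  unfolding multiplier_def by (metis L2_mult_bounded smooth1_measurable)

lemma leibniz_L2: "multiplier D \<Longrightarrow> (\<And>j. j \<le> k \<Longrightarrow> L2 (v j)) \<Longrightarrow> L2 (leibniz k D v)"
proof (induction k arbitrary: D v)
  case (Suc k)
  show ?case unfolding leibniz.simps
    using Suc.prems by (intro L2_add Suc.IH multiplier_Suc) auto
qed (simp add: multiplier_L2)

lemma leibniz_weak_deriv:
  "multiplier D \<Longrightarrow> (\<And>j. j \<le> Suc k \<Longrightarrow> L2 (v j)) \<Longrightarrow> (\<And>j. j \<le> k \<Longrightarrow> weak_deriv (v j) (v (Suc j)))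
    \<Longrightarrow> weak_deriv (leibniz k D v) (leibniz (Suc k) D v)"
proof (induction k arbitrary: D v)
  case 0
  have D0: "smooth1 (D 0)" "vderiv (D 0) = D (Suc 0)" using 0(1) by (auto simp: multiplier_def)
  show ?case using weak_deriv_mult[OF 0(3)[of 0] 0(2)[of 0] 0(2)[of "Suc 0"] D0(1)] by (simp add: D0(2))
next
  case (Suc k)
  show ?case
    unfolding leibniz.simps(2)[of k D v] leibniz.simps(2)[of "Suc k" D v]
    using Suc.prems by (intro weak_deriv_add Suc.IH leibniz_L2 multiplier_Suc) auto
qed

text \<open>Fully unfolded there are \<open>2 ^ k\<close> products, and exactly one contains
  \<open>D 0\<close>. With it removed, each remaining term carries a derivative of \<open>D\<close>,
  so the bound \<open>E\<close> is asked only from index 1 on. For a wide cutoff these are the small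
  terms.\<close>

lemma leibniz_bound:
  assumes "\<And>i. 1 \<le> i \<Longrightarrow> i \<le> k \<Longrightarrow> cmod (D i x) \<le> E" "\<And>j. j \<le> k \<Longrightarrow> cmod (v j x) \<le> V"
    and E: "0 \<le> E"
  shows "cmod (leibniz k D v x - D 0 x * v k x) \<le> 2 ^ k * E * V"
proof -
  have V: "0 \<le> V" using assms(2)[of 0] by (meson le0 norm_ge_zero order_trans)
  have all: "cmod (leibniz k D v x) \<le> 2 ^ k * E * V"
    if "\<And>i. i \<le> k \<Longrightarrow> cmod (D i x) \<le> E" "\<And>j. j \<le> k \<Longrightarrow> cmod (v j x) \<le> V" for k D v
    using that
  proof (induction k arbitrary: D v)
    case 0
    then show ?case using E V by (simp add: norm_mult mult_mono)
  next
    case (Suc k)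
    have "cmod (leibniz (Suc k) D v x) \<le> 2 ^ k * E * V + 2 ^ k * E * V"
      unfolding leibniz.simps
      using Suc.prems by (intro norm_triangle_mono Suc.IH) auto
    also have "\<dots> = 2 ^ Suc k * E * V" by simp
    finally show ?case .
  qed
  show "cmod (leibniz k D v x - D 0 x * v k x) \<le> 2 ^ k * E * V"
    using assms(1,2)
  proof (induction k arbitrary: v)
    case 0
    then show ?case using E V by simp
  next
    case (Suc k)
    have "cmod (leibniz (Suc k) D v x - D 0 x * v (Suc k) x)
        \<le> cmod (leibniz k (\<lambda>i. D (Suc i)) v x) + cmod (leibniz k D (\<lambda>i. v (Suc i)) x - D 0 x * v (Suc k) x)"
      unfolding leibniz.simps by (metis add_diff_eq norm_triangle_ineq)
    also have "\<dots> \<le> 2 ^ k * E * V + 2 ^ k * E * V"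
      using Suc.prems by (intro add_mono all Suc.IH) auto
    also have "\<dots> = 2 ^ Suc k * E * V" by simp
    finally show ?case .
  qed
qed

lemma weak_derivs_leibniz:
  assumes "weak_derivs m u v" "multiplier D"
  shows "weak_derivs m (\<lambda>x. D 0 x * u x) (\<lambda>k. leibniz k D v)"
  using assms unfolding weak_derivs_iff_chain by (auto simp del: leibniz.simps(2) intro: leibniz_L2 leibniz_weak_deriv)

section \<open>Smooth periodic coefficients and their restrictions to lines\<close>

lemma Ck2_lincomb: "Ck2 k f \<Longrightarrow> Ck2 k g \<Longrightarrow> Ck2 k (\<lambda>p. f p + c * g p)"
proof (induction k arbitrary: f g)
  case 0
  then show ?case by (auto intro!: continuous_intros)
next
  case (Suc k)
  have diff: "f differentiable (at p)" "g differentiable (at p)" for p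
    using Suc.prems unfolding Ck2.simps by blast+
  have "((\<lambda>p. f p + c * g p) has_derivative
      (\<lambda>h. frechet_derivative f (at p) h + c * frechet_derivative g (at p) h)) (at p)" for p
    using diff[of p] unfolding frechet_derivative_works
    by (auto intro!: derivative_intros)
  moreover from this have "frechet_derivative (\<lambda>p. f p + c * g p) (at p)
      = (\<lambda>h. frechet_derivative f (at p) h + c * frechet_derivative g (at p) h)" for p
    by (metis frechet_derivative_at)
  ultimately show ?case using Suc by (auto simp: differentiable_def)
qed

lemma smooth2_partial:
  assumes "smooth2 f"
  shows "smooth2 (\<lambda>p. frechet_derivative f (at p) (1, 0))" "smooth2 (\<lambda>p. frechet_derivative f (at p) (0, 1))"
  using assms unfolding smooth2_def by (metis Ck2.simps(2))+

lemma smooth2_has_derivative: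
  assumes "smooth2 f"
  shows "(f has_derivative (\<lambda>h. of_real (fst h) * frechet_derivative f (at p) (1, 0)
     + of_real (snd h) * frechet_derivative f (at p) (0, 1))) (at p)"
proof -
  have "f differentiable (at p)" using assms unfolding smooth2_def by (metis Ck2.simps(2))
  then have d: "(f has_derivative frechet_derivative f (at p)) (at p)" by (simp add: frechet_derivative_works)
  interpret bounded_linear "frechet_derivative f (at p)" using d by (rule has_derivative_bounded_linear)
  have "frechet_derivative f (at p) h = of_real (fst h) * frechet_derivative f (at p) (1, 0)
     + of_real (snd h) * frechet_derivative f (at p) (0, 1)" for h
  proof -
    have "h = fst h *\<^sub>R (1, 0) + snd h *\<^sub>R (0, 1)" by (cases h) simp
    then show ?thesis by (metis add scaleR scaleR_conv_of_real)
  qed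
  with d show ?thesis by (metis (no_types, lifting) ext)
qed

lemma smooth2_continuous: "smooth2 f \<Longrightarrow> continuous_on UNIV f"
  unfolding smooth2_def by (metis Ck2.simps(1))

text \<open>Differentiating along the line applies the first partial derivative plus
  \<open>t\<close> times the second, which keeps the function on the plane smooth; coinduction then
  covers all orders.\<close>

lemma smooth1_line:
  assumes "smooth2 f" shows "smooth1 (\<lambda>x. f (x + y, t * x + s))"
proof (rule smooth1_coinduct[of "\<lambda>h. \<exists>b. smooth2 b \<and> h = (\<lambda>x. b (x + y, t * x + s))"])
  show "\<exists>b. smooth2 b \<and> (\<lambda>x. f (x + y, t * x + s)) = (\<lambda>x. b (x + y, t * x + s))" using assms by blast
  fix h assume "\<exists>b. smooth2 b \<and> h = (\<lambda>x. b (x + y, t * x + s))"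
  then obtain b where b: "smooth2 b" "h = (\<lambda>x. b (x + y, t * x + s))" by blast
  let ?b = "\<lambda>p. frechet_derivative b (at p) (1, 0) + of_real t * frechet_derivative b (at p) (0, 1)"
  have "smooth2 ?b" using smooth2_partial[OF b(1)] Ck2_lincomb unfolding smooth2_def by blast
  moreover have "(h has_vector_derivative ?b (x + y, t * x + s)) (at x)" for x
  proof -
    have l: "((\<lambda>x. (x + y, t * x + s)) has_derivative (\<lambda>h. (h, t * h))) (at x)"
      by (auto intro!: derivative_eq_intros)
    show ?thesis
      unfolding b(2) has_vector_derivative_def
      using has_derivative_compose[OF l smooth2_has_derivative[OF b(1)]]
      by (simp add: scaleR_conv_of_real algebra_simps)
  qed
  ultimately show "\<exists>f'. (\<exists>b. smooth2 b \<and> f' = (\<lambda>x. b (x + y, t * x + s))) \<and> (\<forall>x. (h has_vector_derivative f' x) (at x))"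
    by blast
qed

lemma periodic2_int:
  assumes "periodic2 f" shows "f (x + of_int i, y + of_int j) = f (x, y)"
proof -
  have 1: "f (x + of_int i, y) = f (x, y)" for x y
  proof (induction i rule: int_induct[of _ 0])
    case (step1 i)
    then show ?case using assms unfolding periodic2_def by (metis add.assoc of_int_1 of_int_add)
  next
    case (step2 i)
    have "f (x + of_int (i - 1) + 1, y) = f (x + of_int (i - 1), y)" using assms unfolding periodic2_def by blast
    then show ?case using step2 by simp
  qed simp
  have 2: "f (x, y + of_int j) = f (x, y)" for x y
  proof (induction j rule: int_induct[of _ 0])
    case (step1 i)
    then show ?case using assms unfolding periodic2_def by (metis add.assoc of_int_1 of_int_add)
  next
    case (step2 i)
    have "f (x, y + of_int (i - 1) + 1) = f (x, y + of_int (i - 1))" using assms unfolding periodic2_def by blast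
    then show ?case using step2 by simp
  qed simp
  show ?thesis using 1 2 by simp
qed

lemma periodic2_bounded:
  assumes "periodic2 f" "continuous_on UNIV f"
  obtains B where "B > 0" "\<And>p. cmod (f p) \<le> B"
proof -
  have "compact (f ` ({0..1} \<times> {0..1}))"
    by (intro compact_continuous_image continuous_on_subset[OF assms(2)] compact_Times) auto
  then obtain B where B: "B > 0" "\<And>q. q \<in> {0..1} \<times> {0..1} \<Longrightarrow> cmod (f q) \<le> B"
    using compact_imp_bounded bounded_pos by (metis image_eqI)
  have "cmod (f p) \<le> B" for p
  proof (cases p)
    case (Pair x y)
    have "f p = f (frac x, frac y)"
      using periodic2_int[OF assms(1), of "frac x" "\<lfloor>x\<rfloor>" "frac y" "\<lfloor>y\<rfloor>"] Pair by (simp add: frac_def)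
    then show ?thesis using B(2)[of "(frac x, frac y)"] by (simp add: frac_ge_0 frac_lt_1 less_imp_le)
  qed
  with B(1) that show ?thesis by blast
qed

lemma periodic2_frechet_derivative:
  assumes "periodic2 f" "smooth2 f"
  shows "periodic2 (\<lambda>p. frechet_derivative f (at p) h)"
proof -
  have d: "(f has_derivative frechet_derivative f (at p)) (at p)" for p
    using assms(2) unfolding smooth2_def by (metis Ck2.simps(2) frechet_derivative_works)
  have "frechet_derivative f (at (p + e)) = frechet_derivative f (at p)" if e: "\<And>p. f (p + e) = f p" for p e
  proof -
    have "((\<lambda>p. p + e) has_derivative (\<lambda>h. h)) (at p)" by (auto intro!: derivative_eq_intros)
    from has_derivative_compose[OF this d] have "(f has_derivative frechet_derivative f (at (p + e))) (at p)"
      by (simp add: e)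
    then show ?thesis by (rule frechet_derivative_at)
  qed
  from this[of "(1, 0)"] this[of "(0, 1)"] assms(1) show ?thesis
    unfolding periodic2_def by (force simp: split_paired_all)
qed

text \<open>The partial derivatives inherit periodicity, so they are bounded on the plane because
  they are continuous on the unit square; the mean value inequality gives a global constant.\<close>

lemma periodic2_lipschitz:
  assumes "periodic2 f" "smooth2 f"
  obtains B where "B > 0" "\<And>p q. cmod (f p - f q) \<le> B * dist p q"
proof -
  obtain B1 where B1: "B1 > 0" "\<And>p. cmod (frechet_derivative f (at p) (1, 0)) \<le> B1"
    using periodic2_bounded[OF periodic2_frechet_derivative[OF assms] smooth2_continuous[OF smooth2_partial(1)[OF assms(2)]]] by blast
  obtain B2 where B2: "B2 > 0" "\<And>p. cmod (frechet_derivative f (at p) (0, 1)) \<le> B2"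
    using periodic2_bounded[OF periodic2_frechet_derivative[OF assms] smooth2_continuous[OF smooth2_partial(2)[OF assms(2)]]] by blast
  show ?thesis
  proof (rule that[of "B1 + B2"])
    fix p q :: "real \<times> real"
    show "cmod (f p - f q) \<le> (B1 + B2) * dist p q"
      unfolding dist_norm
    proof (rule differentiable_bound[of UNIV f])
      fix x
      show "(f has_derivative (\<lambda>h. of_real (fst h) * frechet_derivative f (at x) (1, 0)
        + of_real (snd h) * frechet_derivative f (at x) (0, 1))) (at x within UNIV)"
        using smooth2_has_derivative[OF assms(2)] by simp
      show "onorm (\<lambda>h. of_real (fst h) * frechet_derivative f (at x) (1, 0)
        + of_real (snd h) * frechet_derivative f (at x) (0, 1)) \<le> B1 + B2"
      proof (rule onorm_le)
        fix h :: "real \<times> real"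
        have "cmod (of_real (fst h) * frechet_derivative f (at x) (1, 0) + of_real (snd h) * frechet_derivative f (at x) (0, 1))
          \<le> norm h * B1 + norm h * B2"
          using norm_fst_le[of "fst h" "snd h"] norm_snd_le[of "snd h" "fst h"]
          by (intro norm_triangle_mono) (auto simp: norm_mult intro!: mult_mono B1(2) B2(2))
        then show "cmod (of_real (fst h) * frechet_derivative f (at x) (1, 0) + of_real (snd h) * frechet_derivative f (at x) (0, 1))
          \<le> (B1 + B2) * norm h" by (simp add: algebra_simps)
      qed
    qed auto
  qed (use B1 B2 in auto)
qed

section \<open>The elliptic estimate\<close>

definition bounded_measurable :: "real \<Rightarrow> (real \<Rightarrow> complex) \<Rightarrow> bool" where
  "bounded_measurable B h \<longleftrightarrow> h \<in> borel_measurable borel \<and> (\<forall>x. cmod (h x) \<le> B)"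

definition mult_op :: "(real \<Rightarrow> complex) \<Rightarrow> l2 \<Rightarrow> l2" where
  "mult_op h u = mk (\<lambda>x. h x * fn u x)"

lemma bounded_measurable_L2: "bounded_measurable B h \<Longrightarrow> L2 f \<Longrightarrow> L2 (\<lambda>x. h x * f x)"
  unfolding bounded_measurable_def by (auto intro: L2_mult_bounded)

lemma fn_mult: "bounded_measurable B h \<Longrightarrow> AE x in lborel. fn (mult_op h u) x = h x * fn u x"
  unfolding mult_op_def by (rule fn_mk) (simp add: bounded_measurable_L2)

lemma norm_mk_le:
  assumes "L2 f" "L2 g" "AE x in lborel. cmod (f x) \<le> C * cmod (g x)" "0 \<le> C"
  shows "norm (mk f) \<le> C * norm (mk g)"
proof -
  have [measurable]: "g \<in> borel_measurable borel" using assms(2) by (rule L2_borel)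
  have "ennreal ((norm (mk f))\<^sup>2) \<le> (\<integral>\<^sup>+x. ennreal (C\<^sup>2) * ennreal ((cmod (g x))\<^sup>2) \<partial>lborel)"
    unfolding norm_mk[OF assms(1)]
  proof (rule nn_integral_mono_AE, use assms(3) in eventually_elim)
    fix x assume "cmod (f x) \<le> C * cmod (g x)"
    from power_mono[OF this, of 2]
    show "ennreal ((cmod (f x))\<^sup>2) \<le> ennreal (C\<^sup>2) * ennreal ((cmod (g x))\<^sup>2)"
      by (simp add: power_mult_distrib flip: ennreal_mult)
  qed
  also have "\<dots> = ennreal (C\<^sup>2) * ennreal ((norm (mk g))\<^sup>2)"
    unfolding norm_mk[OF assms(2)] by (rule nn_integral_cmult) simp
  finally have "(norm (mk f))\<^sup>2 \<le> (C * norm (mk g))\<^sup>2"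
    by (simp add: power_mult_distrib flip: ennreal_mult)
  then show ?thesis by (rule power2_le_imp_le) (use assms(4) in simp)
qed

lemma bounded_measurable_nonneg: "bounded_measurable B h \<Longrightarrow> 0 \<le> B"
  unfolding bounded_measurable_def by (meson norm_ge_zero order_trans)

lemma norm_mult_le: "bounded_measurable B h \<Longrightarrow> norm (mult_op h u) \<le> B * norm u"
  using norm_mk_le[of "\<lambda>x. h x * fn u x" "fn u" B] bounded_measurable_L2[of B h "fn u"] bounded_measurable_nonneg[of B h]
  by (auto simp: mult_op_def bounded_measurable_def norm_mult mult_right_mono)

lemma bounded_linear_mult:
  assumes h: "bounded_measurable B h" shows "bounded_linear (mult_op h)"
proof (rule bounded_linear_intro[where K = B])
  fix u v
  show "mult_op h (u + v) = mult_op h u + mult_op h v" unfolding l2_eq_iff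
    using fn_mult[OF h, of "u + v"] fn_plus[of u v] fn_plus[of "mult_op h u" "mult_op h v"] fn_mult[OF h, of u] fn_mult[OF h, of v]
    by eventually_elim (simp add: distrib_left)
  show "mult_op h (r *\<^sub>R u) = r *\<^sub>R mult_op h u" for r unfolding l2_eq_iff
    using fn_mult[OF h, of "r *\<^sub>R u"] fn_scaleR[of r u] fn_scaleR[of r "mult_op h u"] fn_mult[OF h, of u]
    by eventually_elim simp
  show "norm (mult_op h u) \<le> norm u * B" using norm_mult_le[OF h, of u] by (simp add: mult.commute)
qed

lemma mult_diff_left:
  assumes h: "bounded_measurable B h" and g: "bounded_measurable B' g" and hg: "bounded_measurable B'' (\<lambda>x. h x - g x)"
  shows "mult_op h u - mult_op g u = mult_op (\<lambda>x. h x - g x) u"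
  unfolding l2_eq_iff
  using fn_mult[OF h, of u] fn_mult[OF g, of u] fn_mult[OF hg, of u] fn_minus[of "mult_op h u" "mult_op g u"]
  by eventually_elim (simp add: left_diff_distrib)

lemma mk_sum: "(\<And>k. k \<in> I \<Longrightarrow> L2 (f k)) \<Longrightarrow> mk (\<lambda>x. \<Sum>k\<in>I. f k x) = (\<Sum>k\<in>I. mk (f k))"
proof (induction I rule: infinite_finite_induct)
  case (insert k I)
  then show ?case by (simp add: mk_add L2_sum)
qed (auto simp: mk_zero)

lemma lint_mult_inner:
  assumes "L2 p" "L2 \<phi>"
  shows "(LINT x|lborel. p x * \<phi> x)
    = Complex (inner (mk p) (mk (\<lambda>x. cnj (\<phi> x)))) (inner (mk p) (cscale \<i> (mk (\<lambda>x. cnj (\<phi> x)))))"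
  using l2inner_eq[OF assms(1) L2_cnj[OF assms(2)]] by (simp add: l2inner_def)

lemma weak_deriv_iff_inner:
  assumes "L2 p" "L2 q"
  shows "weak_deriv p q \<longleftrightarrow> (\<forall>\<phi>. test_fun \<phi> \<longrightarrow>
     inner (mk p) (mk (\<lambda>x. cnj (vderiv \<phi> x))) = - inner (mk q) (mk (\<lambda>x. cnj (\<phi> x))) \<and>
     inner (mk p) (cscale \<i> (mk (\<lambda>x. cnj (vderiv \<phi> x)))) = - inner (mk q) (cscale \<i> (mk (\<lambda>x. cnj (\<phi> x)))))"
proof -
  have "(LINT x|lborel. p x * vderiv \<phi> x) = - (LINT x|lborel. q x * \<phi> x) \<longleftrightarrow>
     inner (mk p) (mk (\<lambda>x. cnj (vderiv \<phi> x))) = - inner (mk q) (mk (\<lambda>x. cnj (\<phi> x))) \<and>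
     inner (mk p) (cscale \<i> (mk (\<lambda>x. cnj (vderiv \<phi> x)))) = - inner (mk q) (cscale \<i> (mk (\<lambda>x. cnj (\<phi> x))))"
    if "test_fun \<phi>" for \<phi>
    unfolding lint_mult_inner[OF assms(1) test_fun_L2[OF test_fun_vderiv[OF that]]]
      lint_mult_inner[OF assms(2) test_fun_L2[OF that]]
    by (simp add: complex_eq_iff)
  then show ?thesis unfolding weak_deriv_def by blast
qed

definition weak_deriv_rel :: "(l2 \<times> l2) set" where
  "weak_deriv_rel = {p. weak_deriv (fn (fst p)) (fn (snd p))}"

lemma mem_weak_deriv_rel: "(p, q) \<in> weak_deriv_rel \<longleftrightarrow> weak_deriv (fn p) (fn q)"
  by (simp add: weak_deriv_rel_def)

lemma mk_mem_weak_deriv_rel: "L2 p \<Longrightarrow> L2 q \<Longrightarrow> (mk p, mk q) \<in> weak_deriv_rel \<longleftrightarrow> weak_deriv p q"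
  by (simp add: mem_weak_deriv_rel weak_deriv_iff_inner)

text \<open>Each test function imposes two real conditions, continuous and linear in the pair, one
  for each part of the complex integral. Closedness and the subspace property can be read
  off.\<close>

lemma weak_deriv_rel_alt: "weak_deriv_rel = (\<Inter>\<phi>\<in>Collect test_fun.
     {p. inner (fst p) (mk (\<lambda>x. cnj (vderiv \<phi> x))) = - inner (snd p) (mk (\<lambda>x. cnj (\<phi> x)))} \<inter>
     {p. inner (fst p) (cscale \<i> (mk (\<lambda>x. cnj (vderiv \<phi> x)))) = - inner (snd p) (cscale \<i> (mk (\<lambda>x. cnj (\<phi> x))))})"
  unfolding weak_deriv_rel_def by (auto simp: weak_deriv_iff_inner)

lemma weak_deriv_rel_closed: "closed weak_deriv_rel"
  unfolding weak_deriv_rel_alt by (intro closed_INT ballI closed_Int closed_Collect_eq continuous_intros)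

lemma weak_deriv_rel_subspace: "subspace weak_deriv_rel"
  unfolding weak_deriv_rel_alt by (rule subspaceI) (auto simp: inner_add_left)

text \<open>\<open>V 0, \<dots>, V m\<close> are the weak derivatives of \<open>V 0\<close>; the values \<open>V k\<close> with \<open>k > m\<close> are irrelevant.\<close>

definition weak_chain :: "nat \<Rightarrow> (nat \<Rightarrow> l2) \<Rightarrow> bool" where
  "weak_chain m V \<longleftrightarrow> (\<forall>j<m. (V j, V (Suc j)) \<in> weak_deriv_rel)"

lemma weak_chain_weak_derivs: "weak_chain m V \<longleftrightarrow> weak_derivs m (fn (V 0)) (\<lambda>k. fn (V k))"
  by (auto simp: weak_chain_def weak_derivs_iff_chain mem_weak_deriv_rel)

lemma weak_chain_diff: "weak_chain m V \<Longrightarrow> weak_chain m V' \<Longrightarrow> weak_chain m (\<lambda>k. V k - V' k)"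
  unfolding weak_chain_def using subspace_diff[OF weak_deriv_rel_subspace] by fastforce

lemma weak_chain_scaleR: "weak_chain m V \<Longrightarrow> weak_chain m (\<lambda>k. c *\<^sub>R V k)"
  unfolding weak_chain_def using subspace_scale[OF weak_deriv_rel_subspace] by fastforce

lemma weak_chain_sums:
  assumes "\<And>n. weak_chain m (V n)" "\<And>k. k \<le> m \<Longrightarrow> (\<lambda>n. V n k) sums S k"
  shows "weak_chain m S"
  unfolding weak_chain_def
proof (intro allI impI)
  fix j assume j: "j < m"
  show "(S j, S (Suc j)) \<in> weak_deriv_rel"
  proof (rule closed_sequentially[OF weak_deriv_rel_closed])
    show "(\<Sum>i<n. V i j, \<Sum>i<n. V i (Suc j)) \<in> weak_deriv_rel" for n
      using subspace_sum[OF weak_deriv_rel_subspace, of "{..<n}" "\<lambda>i. (V i j, V i (Suc j))"] assms(1) j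
      by (simp add: sum_prod weak_chain_def)
    show "(\<lambda>n. (\<Sum>i<n. V i j, \<Sum>i<n. V i (Suc j))) \<longlonglongrightarrow> (S j, S (Suc j))"
      using assms(2)[of j] assms(2)[of "Suc j"] j unfolding sums_def by (intro tendsto_Pair) auto
  qed
qed

definition perp_test :: "(real \<Rightarrow> complex) \<Rightarrow> bool" where
  "perp_test w \<longleftrightarrow> (\<forall>\<phi>. test_fun \<phi> \<longrightarrow> (LINT x|lborel. w x * \<phi> x) = 0)"

section \<open>The operators of the family acting on chains of weak derivatives\<close>

locale elliptic_family =
  fixes a :: "nat \<Rightarrow> real \<times> real \<Rightarrow> complex" and m :: nat
  assumes smooth: "\<And>k. k \<le> m \<Longrightarrow> smooth2 (a k)"
    and periodic: "\<And>k. k \<le> m \<Longrightarrow> periodic2 (a k)"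
    and elliptic: "\<And>p. a m p \<noteq> 0"
    and selfadj: "\<And>t y. self_adjoint_graph (op_graph a m t y)"
begin

definition coef :: "real \<Rightarrow> real \<times> real \<Rightarrow> nat \<Rightarrow> real \<Rightarrow> complex" where
  "coef t y k x = a k (x + fst y, t * x + snd y)"

lemma smooth1_coef: "k \<le> m \<Longrightarrow> smooth1 (coef t y k)"
  using smooth1_line[OF smooth, of k "fst y" t "snd y"] by (simp add: coef_def[abs_def])

lemma uniform_bounds:
  obtains B where "B > 0" "\<And>k p. k \<le> m \<Longrightarrow> cmod (a k p) \<le> B"
    "\<And>k p q. k \<le> m \<Longrightarrow> cmod (a k p - a k q) \<le> B * dist p q"
proof -
  have "\<exists>B>0. (\<forall>p. cmod (a k p) \<le> B) \<and> (\<forall>p q. cmod (a k p - a k q) \<le> B * dist p q)" if k: "k \<le> m" for k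
  proof -
    obtain B1 where B1: "B1 > 0" "\<And>p. cmod (a k p) \<le> B1"
      using periodic2_bounded[OF periodic[OF k] smooth2_continuous[OF smooth[OF k]]] by blast
    obtain B2 where B2: "B2 > 0" "\<And>p q. cmod (a k p - a k q) \<le> B2 * dist p q"
      using periodic2_lipschitz[OF periodic[OF k] smooth[OF k]] by blast
    have "cmod (a k p) \<le> B1 + B2" for p using B1(2)[of p] B2(1) by simp
    moreover have "cmod (a k p - a k q) \<le> (B1 + B2) * dist p q" for p q
      using B2(2)[of p q] B1(1) by (smt (verit) mult_right_mono zero_le_dist)
    ultimately show ?thesis using B1(1) B2(1) by (intro exI[of _ "B1 + B2"]) auto
  qed
  then obtain B where B: "\<And>k. k \<le> m \<Longrightarrow> B k > 0 \<and> (\<forall>p. cmod (a k p) \<le> B k) \<and> (\<forall>p q. cmod (a k p - a k q) \<le> B k * dist p q)"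
    by metis
  define C where "C = (\<Sum>k\<le>m. B k)"
  have C: "B k \<le> C" if "k \<le> m" for k
    unfolding C_def using B that by (intro member_le_sum) (auto intro: less_imp_le)
  show ?thesis
  proof (rule that[of C])
    show "C > 0" using C[of m] B[of m] by simp
    show "cmod (a k p) \<le> C" if "k \<le> m" for k p using B[OF that] C[OF that] by (meson order_trans)
    show "cmod (a k p - a k q) \<le> C * dist p q" if "k \<le> m" for k p q
      using B[OF that] C[OF that] by (meson order_trans mult_right_mono zero_le_dist)
  qed
qed

lemma coef_bounded_measurable:
  assumes "k \<le> m" "\<And>k p. k \<le> m \<Longrightarrow> cmod (a k p) \<le> B" shows "bounded_measurable B (coef t y k)"
  unfolding bounded_measurable_def using smooth1_measurable[OF smooth1_coef[OF assms(1)]] assms by (simp add: coef_def)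

lemma coef_bounded_measurable_ex: "k \<le> m \<Longrightarrow> \<exists>B. bounded_measurable B (coef t y k)"
  using uniform_bounds coef_bounded_measurable by metis

lemma op_sum_L2:
  assumes "\<And>k. k \<le> m \<Longrightarrow> L2 (v k)" shows "L2 (\<lambda>x. \<Sum>k\<le>m. coef t y k x * v k x)"
  using assms coef_bounded_measurable_ex[of _ t y] by (intro L2_sum) (auto intro: bounded_measurable_L2)

lemma op_graph_iff:
  "(u, f) \<in> op_graph a m t y \<longleftrightarrow> L2 f \<and> (\<exists>v. weak_derivs m u v \<and>
      (AE x in lborel. f x = (\<Sum>k\<le>m. coef t y k x * v k x)))"
  unfolding op_graph_def coef_def by simp

lemma op_graph_intro:
  assumes "weak_derivs m u v" shows "(u, \<lambda>x. \<Sum>k\<le>m. coef t y k x * v k x) \<in> op_graph a m t y"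
  unfolding op_graph_iff using assms op_sum_L2[of v t y] by (auto simp: weak_derivs_def)

lemma sa: "sa_graph (op_graph a m t y)"
proof
  fix u f assume "(u, f) \<in> op_graph a m t y"
  then show "L2 u \<and> L2 f" unfolding op_graph_iff weak_derivs_def by auto
qed (rule selfadj)

definition op_rel :: "real \<Rightarrow> real \<times> real \<Rightarrow> (l2 \<times> l2) set" where
  "op_rel t y = qgraph (op_graph a m t y)"

definition op_apply :: "real \<Rightarrow> real \<times> real \<Rightarrow> (nat \<Rightarrow> l2) \<Rightarrow> l2" where
  "op_apply t y V = (\<Sum>k\<le>m. mult_op (coef t y k) (V k))"

lemma op_apply_mk:
  assumes "\<And>k. k \<le> m \<Longrightarrow> L2 (v k)"
  shows "op_apply t y (\<lambda>k. mk (v k)) = mk (\<lambda>x. \<Sum>k\<le>m. coef t y k x * v k x)"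
proof -
  have "mult_op (coef t y k) (mk (v k)) = mk (\<lambda>x. coef t y k x * v k x)" if k: "k \<le> m" for k
  proof -
    obtain B where B: "bounded_measurable B (coef t y k)" using coef_bounded_measurable_ex[OF k] by blast
    show ?thesis unfolding l2_eq_iff
      using fn_mult[OF B, of "mk (v k)"] fn_mk[OF assms[OF k]] fn_mk[OF bounded_measurable_L2[OF B assms[OF k]]]
      by eventually_elim simp
  qed
  moreover have "L2 (\<lambda>x. coef t y k x * v k x)" if k: "k \<le> m" for k
    using coef_bounded_measurable_ex[OF k, of t y] bounded_measurable_L2[OF _ assms[OF k]] by blast
  ultimately show ?thesis unfolding op_apply_def by (subst mk_sum) auto
qed

text \<open>Moves the operator entirely into \<open>l2\<close>: null sets disappear in the classes,
  and the weak derivatives become explicit data that can serve as a lift.\<close>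

lemma op_rel_iff: "(u, f) \<in> op_rel t y \<longleftrightarrow> (\<exists>V. weak_chain m V \<and> u = V 0 \<and> f = op_apply t y V)"
proof
  assume "(u, f) \<in> op_rel t y"
  then obtain v where v: "weak_derivs m (fn u) v" "AE x in lborel. fn f x = (\<Sum>k\<le>m. coef t y k x * v k x)"
    unfolding op_rel_def mem_qgraph op_graph_iff by blast
  have L: "L2 (v k)" if "k \<le> m" for k using v(1) that by (simp add: weak_derivs_def)
  have "weak_chain m (\<lambda>k. mk (v k))"
    using v(1) L unfolding weak_chain_def weak_derivs_iff_chain by (auto simp: mk_mem_weak_deriv_rel)
  moreover have "u = mk (v 0)" using v(1) by (simp add: weak_derivs_def)
  moreover have "f = op_apply t y (\<lambda>k. mk (v k))"
    using op_apply_mk[of v t y, OF L] v(2) mk_eq_iff[OF fn_L2 op_sum_L2[of v, OF L], of f t y] by simp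
  ultimately show "\<exists>V. weak_chain m V \<and> u = V 0 \<and> f = op_apply t y V" by (intro exI[of _ "\<lambda>k. mk (v k)"]) auto
next
  assume "\<exists>V. weak_chain m V \<and> u = V 0 \<and> f = op_apply t y V"
  then obtain V where V: "weak_chain m V" "u = V 0" "f = op_apply t y V" by blast
  let ?g = "\<lambda>x. \<Sum>k\<le>m. coef t y k x * fn (V k) x"
  have "mk ?g = f" using op_apply_mk[of "\<lambda>k. fn (V k)" t y] V(3) by simp
  moreover have "(fn u, ?g) \<in> op_graph a m t y" unfolding V(2)
    using V(1) by (intro op_graph_intro) (simp add: weak_chain_weak_derivs)
  ultimately show "(u, f) \<in> op_rel t y" unfolding op_rel_def
    using sa_graph.mk_mem_qgraph[OF sa] by (metis mk_fn)
qed

text \<open>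
  This replaces the density of test functions. If \<open>w\<close> annihilates them, then the graph contains
  \<open>(0, a\<^sub>m w)\<close> and also a pair \<open>(a\<^sub>m w, _)\<close>, so \<open>\<parallel>a\<^sub>m w\<parallel>\<^sup>2 = 0\<close> by symmetry.
\<close>

lemma perp_test_zero:
  assumes m: "m > 0" and w: "perp_test w" "L2 w" shows "AE x in lborel. w x = 0"
proof -
  let ?y = "(0, 0) :: real \<times> real"
  let ?w = "\<lambda>x. coef 0 ?y m x * w x"
  have w0: "LINT x|lborel. w x * \<phi> x = 0" if "test_fun \<phi>" for \<phi>
    using w(1) that by (simp add: perp_test_def)
  obtain B where B: "bounded_measurable B (coef 0 ?y m)" using coef_bounded_measurable_ex by blast
  have L: "L2 ?w" using bounded_measurable_L2[OF B w(2)] .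
  have perp: "LINT x|lborel. ?w x * \<phi> x = 0" if "test_fun \<phi>" for \<phi>
    using w0[OF test_fun_mult[OF smooth1_coef[of m 0 ?y] that]] by (simp add: mult.left_commute mult.assoc)
  \<comment> \<open>A function annihilating all test functions passes for a weak derivative of 0;
    \<open>m > 0\<close> keeps it apart from the entry of index 0.\<close>
  have "weak_derivs m (\<lambda>x. 0) (\<lambda>k. if k = m then w else (\<lambda>x. 0))"
    unfolding weak_derivs_iff_chain using m w(2) by (auto simp: L2_zero weak_deriv_def w0)
  from op_graph_intro[OF this, of 0 ?y]
  have "((\<lambda>x. 0), (\<lambda>x. \<Sum>k\<le>m. coef 0 ?y k x * (if k = m then w else (\<lambda>x. 0)) x)) \<in> op_graph a m 0 ?y" .
  moreover have "(\<lambda>x. \<Sum>k\<le>m. coef 0 ?y k x * (if k = m then w else (\<lambda>x. 0)) x) = ?w"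
  proof
    fix x
    have "(\<Sum>k\<le>m. coef 0 ?y k x * (if k = m then w else (\<lambda>x. 0)) x)
        = (\<Sum>k\<le>m. if k = m then ?w x else 0)" by (intro sum.cong) auto
    then show "(\<Sum>k\<le>m. coef 0 ?y k x * (if k = m then w else (\<lambda>x. 0)) x) = ?w x" by simp
  qed
  ultimately have 1: "((\<lambda>x. 0), ?w) \<in> op_graph a m 0 ?y" by simp
  have "weak_derivs m ?w (\<lambda>k. if k = 0 then ?w else (\<lambda>x. 0))"
    unfolding weak_derivs_iff_chain using L by (auto simp: L2_zero weak_deriv_def perp test_fun_vderiv)
  from sa_graph.symm[OF sa 1 op_graph_intro[OF this]] have "l2inner ?w ?w = 0"
    by (simp add: l2inner_def)
  then have "(LINT x|lborel. (cmod (?w x))\<^sup>2) = 0" unfolding l2inner_self by simp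
  then have "AE x in lborel. (cmod (?w x))\<^sup>2 = 0"
    by (subst (asm) integral_nonneg_eq_0_iff_AE) (auto intro: L2_integrable[OF L])
  then show ?thesis by eventually_elim (simp add: coef_def elliptic)
qed

text \<open>Uniqueness of weak derivatives. Annihilation of the test functions passes from each
  entry to the next, and \<open>perp_test_zero\<close> makes it vanishing.\<close>

lemma weak_chain_zero:
  assumes V: "weak_chain m V" "V 0 = 0" and j: "j \<le> m" shows "V j = 0"
proof (cases "j = 0")
  case False
  have "perp_test (fn (V j))" using j
  proof (induction j)
    case 0
    have "(LINT x|lborel. fn (V 0) x * \<phi> x) = 0" if "test_fun \<phi>" for \<phi>
      using lint_mult_inner[OF fn_L2 test_fun_L2[OF that], of "V 0"] V(2) by (simp add: complex_eq_iff)
    then show ?case by (simp add: perp_test_def)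
  next
    case (Suc j)
    then have "weak_deriv (fn (V j)) (fn (V (Suc j)))" using V(1) by (simp add: weak_chain_def mem_weak_deriv_rel)
    with Suc show ?case unfolding perp_test_def weak_deriv_def using test_fun_vderiv by fastforce
  qed
  then have "AE x in lborel. fn (V j) x = 0" using False j by (intro perp_test_zero) auto
  then show ?thesis unfolding l2_eq_iff using fn_zero by eventually_elim simp
qed (use V in simp)

text \<open>A lift of a point of the graph is a chain of weak derivatives, and its cost bounds all
  their norms. Every point has some lift, so \<open>lift_bound\<close> on the closed graph yields
  one of cost proportional to the graph norm.\<close>

lemma elliptic_estimate_pointwise:
  obtains K where "K > 0" "\<And>V k. weak_chain m V \<Longrightarrow> k \<le> m \<Longrightarrow> norm (V k) \<le> K * (norm (V 0) + norm (op_apply t y V))"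
proof -
  define P where "P p r \<longleftrightarrow> (\<exists>V. weak_chain m V \<and> p = (V 0, op_apply t y V) \<and> (\<forall>k\<le>m. norm (V k) \<le> r))" for p r
  have bl: "bounded_linear (mult_op (coef t y k))" if "k \<le> m" for k
    using coef_bounded_measurable_ex[OF that] bounded_linear_mult by blast
  obtain K where K: "K > 0" "\<And>p. p \<in> op_rel t y \<Longrightarrow> P p (K * norm p)"
  proof (rule lift_bound[of "op_rel t y" P])
    show "subspace (op_rel t y)" "closed (op_rel t y)"
      unfolding op_rel_def by (rule sa_graph.q_subspace[OF sa] sa_graph.q_closed[OF sa])+
    show "P p r'" if "P p r" "r \<le> r'" for p r r'
      using that unfolding P_def by (blast intro: order_trans)
    show "P (c *\<^sub>R p) (\<bar>c\<bar> * r)" if "P p r" for p r c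
    proof -
      from that obtain V where V: "weak_chain m V" "p = (V 0, op_apply t y V)" "\<forall>k\<le>m. norm (V k) \<le> r"
        unfolding P_def by blast
      have "op_apply t y (\<lambda>k. c *\<^sub>R V k) = c *\<^sub>R op_apply t y V"
        unfolding op_apply_def scaleR_sum_right
        by (intro sum.cong refl linear_scale[OF bounded_linear.linear[OF bl]]) simp
      then show ?thesis unfolding P_def using weak_chain_scaleR[OF V(1), of c] V(2,3)
        by (intro exI[of _ "\<lambda>k. c *\<^sub>R V k"]) (auto intro: mult_left_mono)
    qed
    show "\<exists>r. P p r" if "p \<in> op_rel t y" for p
    proof -
      from that obtain V where V: "weak_chain m V" "p = (V 0, op_apply t y V)" using op_rel_iff by (metis surj_pair)
      have "norm (V k) \<le> (\<Sum>k\<le>m. norm (V k))" if "k \<le> m" for k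
        using that by (intro member_le_sum) auto
      then show ?thesis unfolding P_def using V by blast
    qed
    show "P x (suminf r)" if y: "\<And>n. P (p n) (r n)" and s: "p sums x" "summable r" for p r x
    proof -
      obtain V where V: "\<And>n. weak_chain m (V n)" "\<And>n. p n = (V n 0, op_apply t y (V n))" "\<And>n k. k \<le> m \<Longrightarrow> norm (V n k) \<le> r n"
        using y unfolding P_def by metis
      have sn: "summable (\<lambda>n. norm (V n k))" if "k \<le> m" for k
        by (rule summable_comparison_test'[OF s(2)]) (simp add: V(3) that)
      define S where "S k = (\<Sum>n. V n k)" for k
      have S: "(\<lambda>n. V n k) sums S k" if "k \<le> m" for k
        unfolding S_def by (rule summable_sums[OF summable_norm_cancel[OF sn[OF that]]])
      have WS: "weak_chain m S" using V(1) S by (rule weak_chain_sums)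
      have SA: "(\<lambda>n. op_apply t y (V n)) sums op_apply t y S"
        unfolding op_apply_def
      proof (rule sums_sum)
        fix k assume "k \<in> {..m}"
        then have k: "k \<le> m" by simp
        show "(\<lambda>n. mult_op (coef t y k) (V n k)) sums mult_op (coef t y k) (S k)"
          by (rule bounded_linear.sums[OF bl[OF k] S[OF k]])
      qed
      have psum: "(\<Sum>i<n. p i) = (\<Sum>i<n. V i 0, \<Sum>i<n. op_apply t y (V i))" for n
        unfolding V(2) sum_prod ..
      have "p sums (S 0, op_apply t y S)"
        using S[OF le0] SA unfolding sums_def psum by (rule tendsto_Pair)
      then have "x = (S 0, op_apply t y S)" using s(1) sums_unique2 by blast
      moreover note WS
      moreover have "norm (S k) \<le> suminf r" if "k \<le> m" for k
        unfolding S_def using summable_norm[OF sn[OF that]] suminf_le[OF V(3)[OF that] sn[OF that] s(2)] by linarith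
      ultimately show ?thesis unfolding P_def by blast
    qed
  qed (auto simp: that)
  show ?thesis
  proof (rule that[OF K(1)])
    fix V k assume V: "weak_chain m V" and k: "k \<le> m"
    have "(V 0, op_apply t y V) \<in> op_rel t y" using V by (auto simp: op_rel_iff)
    \<comment> \<open>The cheap lift may a priori differ from \<open>V\<close>; both start at the
      same function, so uniqueness identifies them up to index \<open>m\<close>.\<close>
    from K(2)[OF this] obtain V' where V': "weak_chain m V'" "V' 0 = V 0"
      "\<And>k. k \<le> m \<Longrightarrow> norm (V' k) \<le> K * norm (V 0, op_apply t y V)" unfolding P_def by force
    have "V k - V' k = 0" using weak_chain_zero[OF weak_chain_diff[OF V V'(1)] _ k] V'(2) by simp
    then have "norm (V k) \<le> K * norm (V 0, op_apply t y V)" using V'(3)[OF k] by simp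
    also have "\<dots> \<le> K * (norm (V 0) + norm (op_apply t y V))"
      using K(1) norm_Pair_le by (intro mult_left_mono) auto
    finally show "norm (V k) \<le> K * (norm (V 0) + norm (op_apply t y V))" .
  qed
qed

text \<open>With equal slopes the two lines stay at the constant distance \<open>dist y y'\<close>,
  so the coefficients differ uniformly on the whole line.\<close>

lemma op_apply_lipschitz:
  obtains B where "B > 0" "\<And>t y y' V. norm (op_apply t y V - op_apply t y' V) \<le> B * dist y y' * (\<Sum>k\<le>m. norm (V k))"
proof -
  obtain B where B: "B > 0" "\<And>k p. k \<le> m \<Longrightarrow> cmod (a k p) \<le> B"
    "\<And>k p q. k \<le> m \<Longrightarrow> cmod (a k p - a k q) \<le> B * dist p q" using uniform_bounds by blast
  show ?thesis
  proof (rule that[OF B(1)])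
    fix t :: real and y y' :: "real \<times> real" and V :: "nat \<Rightarrow> l2"
    have "norm (mult_op (coef t y k) (V k) - mult_op (coef t y' k) (V k)) \<le> B * dist y y' * norm (V k)" if k: "k \<le> m" for k
    proof -
      have b: "bounded_measurable (B * dist y y') (\<lambda>x. coef t y k x - coef t y' k x)"
        unfolding bounded_measurable_def
      proof (intro conjI allI)
        show "(\<lambda>x. coef t y k x - coef t y' k x) \<in> borel_measurable borel"
          using smooth1_measurable[OF smooth1_coef[OF k]] by simp
        fix x
        have "dist (x + fst y, t * x + snd y) (x + fst y', t * x + snd y') = dist y y'"
          by (cases y; cases y') (simp add: dist_Pair_Pair dist_norm)
        then show "cmod (coef t y k x - coef t y' k x) \<le> B * dist y y'"
          unfolding coef_def using B(3)[OF k] by metis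
      qed
      have b1: "bounded_measurable B (coef t y k)" for y by (rule coef_bounded_measurable[OF k B(2)])
      show ?thesis
        using norm_mult_le[OF b, of "V k"]
        unfolding mult_diff_left[OF b1[of y] b1[of y'] b] by simp
    qed
    then show "norm (op_apply t y V - op_apply t y' V) \<le> B * dist y y' * (\<Sum>k\<le>m. norm (V k))"
      unfolding op_apply_def sum_subtractf[symmetric] sum_distrib_left by (intro sum_norm_le) auto
  qed
qed

text \<open>Moving the base point perturbs the operator by a small multiple of all the derivatives
  together, and this is absorbed into the left-hand side of the estimate at
  \<open>y\<close>.\<close>

lemma elliptic_estimate_local:
  "\<exists>\<rho>>0. \<exists>K>0. \<forall>y'\<in>ball y \<rho>. \<forall>V. weak_chain m V \<longrightarrow> (\<forall>k\<le>m. norm (V k) \<le> K * (norm (V 0) + norm (op_apply t y' V)))"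
proof -
  obtain K where K: "K > 0" "\<And>V k. weak_chain m V \<Longrightarrow> k \<le> m \<Longrightarrow> norm (V k) \<le> K * (norm (V 0) + norm (op_apply t y V))"
    using elliptic_estimate_pointwise by blast
  obtain B where B: "B > 0" "\<And>t y y' V. norm (op_apply t y V - op_apply t y' V) \<le> B * dist y y' * (\<Sum>k\<le>m. norm (V k))"
    using op_apply_lipschitz by blast
  define N where "N = real (Suc m) * K"
  have N: "N > 0" using K(1) by (simp add: N_def)
  \<comment> \<open>Chosen so that the perturbation \<open>N * B * \<rho> * S\<close> is exactly
    half of \<open>S\<close>.\<close>
  define \<rho> where "\<rho> = 1 / (2 * N * B)"
  have "norm (V k) \<le> 2 * N * (norm (V 0) + norm (op_apply t y' V))"
    if y': "y' \<in> ball y \<rho>" and V: "weak_chain m V" and k: "k \<le> m" for y' V k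
  proof -
    define S where "S = (\<Sum>k\<le>m. norm (V k))"
    have S0: "S \<ge> 0" by (simp add: S_def sum_nonneg)
    have "S \<le> (\<Sum>k\<le>m. K * (norm (V 0) + norm (op_apply t y V)))"
      unfolding S_def using K(2)[OF V] by (intro sum_mono) auto
    also have "\<dots> = N * (norm (V 0) + norm (op_apply t y V))" by (simp add: N_def)
    also have "\<dots> \<le> N * (norm (V 0) + (norm (op_apply t y' V) + B * dist y y' * S))"
    proof (intro mult_left_mono add_left_mono)
      show "norm (op_apply t y V) \<le> norm (op_apply t y' V) + B * dist y y' * S"
        using B(2)[of t y V y'] norm_triangle_ineq2[of "op_apply t y V" "op_apply t y' V"] unfolding S_def by linarith
    qed (use N in auto)
    also have "\<dots> \<le> N * (norm (V 0) + (norm (op_apply t y' V) + B * \<rho> * S))"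
      using y' N B(1) S0 by (intro mult_left_mono add_left_mono mult_right_mono) auto
    also have "\<dots> = N * (norm (V 0) + norm (op_apply t y' V)) + S / 2"
      using N B(1) by (simp add: \<rho>_def field_simps)
    finally have "S \<le> 2 * N * (norm (V 0) + norm (op_apply t y' V))" by simp
    moreover have "norm (V k) \<le> S" unfolding S_def using k by (intro member_le_sum) auto
    ultimately show ?thesis by linarith
  qed
  moreover have "\<rho> > 0" using N B(1) by (simp add: \<rho>_def)
  moreover have "2 * N > 0" using N by simp
  ultimately show ?thesis by blast
qed

lemma coef_frac: "k \<le> m \<Longrightarrow> coef t y k = coef t (frac (fst y), frac (snd y)) k"
proof
  fix x assume k: "k \<le> m"
  show "coef t y k x = coef t (frac (fst y), frac (snd y)) k x"
    using periodic2_int[OF periodic[OF k], of "x + frac (fst y)" "\<lfloor>fst y\<rfloor>" "t * x + frac (snd y)" "\<lfloor>snd y\<rfloor>"]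
    by (simp add: coef_def frac_def)
qed

lemma elliptic_estimate:
  obtains K where "K > 0"
    "\<And>y V k. weak_chain m V \<Longrightarrow> k \<le> m \<Longrightarrow> norm (V k) \<le> K * (norm (V 0) + norm (op_apply t y V))"
proof -
  let ?Q = "{0..1} \<times> {0..1} :: (real \<times> real) set"
  define good where "good K y \<longleftrightarrow> (\<forall>V. weak_chain m V \<longrightarrow> (\<forall>k\<le>m. norm (V k) \<le> K * (norm (V 0) + norm (op_apply t y V))))" for K y
  have good_mono: "good K' y" if "good K y" "K \<le> K'" for K K' y
    using that unfolding good_def by (meson add_nonneg_nonneg mult_right_mono norm_ge_zero order_trans)
  have "\<forall>y. \<exists>\<rho> K. \<rho> > 0 \<and> K > 0 \<and> (\<forall>y'\<in>ball y \<rho>. good K y')"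
    using elliptic_estimate_local unfolding good_def by blast
  then obtain \<rho> K where \<rho>K: "\<And>y. \<rho> y > 0" "\<And>y. K y > 0" "\<And>y y'. y' \<in> ball y (\<rho> y) \<Longrightarrow> good (K y) y'"
    by metis
  have "compact ?Q" by (intro compact_Times) auto
  then obtain F where F: "finite F" "?Q \<subseteq> (\<Union>y\<in>F. ball y (\<rho> y))"
  proof (rule compactE_image[of _ ?Q "\<lambda>y. ball y (\<rho> y)"])
    show "?Q \<subseteq> (\<Union>y\<in>?Q. ball y (\<rho> y))" using \<rho>K(1) centre_in_ball by blast
  qed auto
  \<comment> \<open>The sum over the finite cover dominates every local constant at once.\<close>
  define M where "M = 1 + (\<Sum>y\<in>F. K y)"
  have M: "M > 0" unfolding M_def using \<rho>K(2) by (smt (verit) sum_nonneg)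
  have goodQ: "good M y" if "y \<in> ?Q" for y
  proof -
    from that obtain y0 where y0: "y0 \<in> F" "y \<in> ball y0 (\<rho> y0)" using F(2) by blast
    have "K y0 \<le> (\<Sum>y\<in>F. K y)" using y0(1) F(1) \<rho>K(2) by (intro member_le_sum) (auto intro: less_imp_le)
    then show ?thesis using good_mono[OF \<rho>K(3)[OF y0(2)]] by (simp add: M_def)
  qed
  have "good M y" for y
  proof -
    have "op_apply t y V = op_apply t (frac (fst y), frac (snd y)) V" for V
      unfolding op_apply_def by (intro sum.cong) (auto simp: coef_frac[of _ t y])
    moreover have "good M (frac (fst y), frac (snd y))"
      by (intro goodQ) (auto simp: frac_ge_0 frac_lt_1 less_imp_le)
    ultimately show ?thesis unfolding good_def by simp
  qed
  with M show ?thesis unfolding good_def by (intro that[of M]) auto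
qed

end

section \<open>Localization\<close>

lemma power_le_exp:
  fixes x :: real
  assumes "0 \<le> x" "n > 0" shows "x ^ n \<le> real n ^ n * exp x"
proof -
  have "(x / real n) ^ n \<le> exp (x / real n) ^ n"
    using assms by (intro power_mono order_trans[OF _ exp_ge_add_one_self]) auto
  also have "\<dots> = exp x" using assms(2) by (simp flip: exp_of_nat_mult)
  finally show ?thesis using assms(2) by (simp add: power_divide field_simps)
qed

lemma poly_gaussian_bounded:
  fixes q :: "real poly"
  shows "\<exists>E>0. \<forall>r. \<bar>poly q r\<bar> * exp (- r\<^sup>2) \<le> E"
proof -
  define E where "E i = 1 + real (Suc i) ^ Suc i" for i
  have E0: "E i > 0" for i by (simp add: E_def add_pos_nonneg)
  have E: "\<bar>r ^ i\<bar> * exp (- r\<^sup>2) \<le> E i" for i and r :: real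
  proof -
    \<comment> \<open>An even power majorizes the monomial, so the exponential bound can be used in
      the variable \<open>r\<^sup>2\<close>.\<close>
    have "\<bar>r ^ i\<bar> \<le> 1 + (r\<^sup>2) ^ Suc i"
    proof (cases "\<bar>r\<bar> \<le> 1")
      case True
      then have "\<bar>r\<bar> ^ i \<le> 1" by (simp add: power_le_one)
      then show ?thesis by (simp add: power_abs add_increasing2)
    next
      case False
      then have "\<bar>r\<bar> ^ i \<le> \<bar>r\<bar> ^ (2 * Suc i)" by (intro power_increasing) auto
      also have "\<bar>r\<bar> ^ (2 * Suc i) = (r\<^sup>2) ^ Suc i" unfolding power_mult by simp
      finally show ?thesis by (simp add: power_abs)
    qed
    also have "\<dots> \<le> exp (r\<^sup>2) + real (Suc i) ^ Suc i * exp (r\<^sup>2)"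
      by (intro add_mono power_le_exp) auto
    finally have "\<bar>r ^ i\<bar> * exp (- r\<^sup>2) \<le> (exp (r\<^sup>2) + real (Suc i) ^ Suc i * exp (r\<^sup>2)) * exp (- r\<^sup>2)"
      by (rule mult_right_mono) simp
    also have "\<dots> = 1 + real (Suc i) ^ Suc i"
    proof -
      have "exp (r\<^sup>2) * exp (- r\<^sup>2) = 1" by (simp flip: exp_add)
      then show ?thesis by (simp only: distrib_right mult.assoc mult_1_right)
    qed
    finally show "\<bar>r ^ i\<bar> * exp (- r\<^sup>2) \<le> E i" by (simp only: E_def)
  qed
  let ?E = "\<Sum>i\<le>degree q. \<bar>coeff q i\<bar> * E i"
  have "\<bar>poly q r\<bar> * exp (- r\<^sup>2) \<le> 1 + ?E" for r
  proof -
    have "\<bar>poly q r\<bar> \<le> (\<Sum>i\<le>degree q. \<bar>coeff q i\<bar> * \<bar>r ^ i\<bar>)"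
      unfolding poly_altdef abs_mult[symmetric] by (rule sum_abs)
    then have "\<bar>poly q r\<bar> * exp (- r\<^sup>2) \<le> (\<Sum>i\<le>degree q. \<bar>coeff q i\<bar> * \<bar>r ^ i\<bar>) * exp (- r\<^sup>2)"
      by (rule mult_right_mono) simp
    also have "\<dots> = (\<Sum>i\<le>degree q. \<bar>coeff q i\<bar> * (\<bar>r ^ i\<bar> * exp (- r\<^sup>2)))"
      by (simp add: sum_distrib_right mult.assoc)
    also have "\<dots> \<le> ?E" by (intro sum_mono mult_left_mono E) auto
    finally show ?thesis by simp
  qed
  moreover have "1 + ?E > 0" by (intro add_pos_nonneg sum_nonneg) (auto simp: less_imp_le[OF E0])
  ultimately show ?thesis by blast
qed

text \<open>Up to the sign \<open>(-1) ^ n\<close>, these are the Hermite polynomials of the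
  physicists.\<close>

primrec gauss_poly :: "nat \<Rightarrow> real poly" where
  "gauss_poly 0 = 1"
| "gauss_poly (Suc n) = pderiv (gauss_poly n) - [:0, 2:] * gauss_poly n"

definition gauss :: "nat \<Rightarrow> real \<Rightarrow> real" where
  "gauss i r = poly (gauss_poly i) r * exp (- r\<^sup>2)"

lemma gauss_0: "gauss 0 r = exp (- r\<^sup>2)"
  by (simp add: gauss_def)

lemma gauss_deriv: "(gauss i has_real_derivative gauss (Suc i) r) (at r)"
  unfolding gauss_def[abs_def]
  by (auto intro!: derivative_eq_intros simp: algebra_simps)

text \<open>One majorant, with integrable square, for the cutoff, its derivatives up to order
  \<open>N\<close>, and the product \<open>r * gauss 0 r\<close>, in which \<open>r\<close> stands
  for the mismatch of coefficients away from the centre. A common weight lets all error terms be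
  averaged together.\<close>

lemma gauss_decay:
  obtains E where "E > 0" "\<And>i r. i \<le> N \<Longrightarrow> \<bar>gauss i r\<bar> \<le> E / (1 + r\<^sup>2)" "\<And>r. \<bar>r * gauss 0 r\<bar> \<le> E / (1 + r\<^sup>2)"
proof -
  have bound: "\<exists>E>0. \<forall>r. \<bar>poly q r * exp (- r\<^sup>2)\<bar> \<le> E / (1 + r\<^sup>2)" for q :: "real poly"
  proof -
    obtain E where E: "E > 0" "\<And>r. \<bar>poly (q * [:1, 0, 1:]) r\<bar> * exp (- r\<^sup>2) \<le> E"
      using poly_gaussian_bounded by blast
    have "\<bar>poly q r * exp (- r\<^sup>2)\<bar> \<le> E / (1 + r\<^sup>2)" for r
    proof -
      have p: "1 + r\<^sup>2 > 0" by (simp add: add_pos_nonneg)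
      have "poly (q * [:1, 0, 1:]) r = poly q r * (1 + r\<^sup>2)"
        by (simp add: algebra_simps power2_eq_square)
      then have "\<bar>poly (q * [:1, 0, 1:]) r\<bar> = \<bar>poly q r\<bar> * (1 + r\<^sup>2)"
        using p by (simp only: abs_mult abs_of_pos)
      then show ?thesis using E(2)[of r] p by (simp add: abs_mult pos_le_divide_eq mult_ac)
    qed
    with E(1) show ?thesis by blast
  qed
  have "\<forall>i. \<exists>E>0. \<forall>r. \<bar>gauss i r\<bar> \<le> E / (1 + r\<^sup>2)" unfolding gauss_def using bound by blast
  then obtain E where E: "\<And>i. E i > 0" "\<And>i r. \<bar>gauss i r\<bar> \<le> E i / (1 + r\<^sup>2)" by metis
  obtain E' where E': "E' > 0" "\<And>r. \<bar>r * gauss 0 r\<bar> \<le> E' / (1 + r\<^sup>2)"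
    using bound[of "[:0, 1:]"] by (auto simp: gauss_0)
  define F where "F = E' + (\<Sum>i\<le>N. E i)"
  have le: "x \<le> F / (1 + r\<^sup>2)" if "x \<le> e / (1 + r\<^sup>2)" "e \<le> F" for x e r
    using that by (meson add_nonneg_nonneg divide_right_mono order_trans zero_le_one zero_le_power2)
  have s: "(\<Sum>i\<le>N. E i) \<ge> 0" using E(1) by (intro sum_nonneg) (auto intro: less_imp_le)
  show ?thesis
  proof (rule that[of F])
    show "F > 0" using E'(1) s by (simp add: F_def)
    show "\<bar>gauss i r\<bar> \<le> F / (1 + r\<^sup>2)" if "i \<le> N" for i r
    proof (rule le[OF E(2)])
      have "E i \<le> (\<Sum>i\<le>N. E i)" using E(1) that by (intro member_le_sum) (auto intro: less_imp_le)
      then show "E i \<le> F" using E'(1) by (simp add: F_def)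
    qed
    show "\<bar>r * gauss 0 r\<bar> \<le> F / (1 + r\<^sup>2)" for r
      by (rule le[OF E'(2)]) (use s in \<open>simp add: F_def\<close>)
  qed
qed

text \<open>For \<open>L > 0\<close>, \<open>cutoff s L i\<close> is the \<open>i\<close>-th
  derivative of \<open>cutoff s L 0\<close>; each differentiation contributes a factor
  \<open>1 / L\<close>.\<close>

definition cutoff :: "real \<Rightarrow> real \<Rightarrow> nat \<Rightarrow> real \<Rightarrow> complex" where
  "cutoff s L i x = of_real (gauss i ((x - s) / L) / L ^ i)"

lemma cutoff_has_vderiv:
  assumes "L > 0"
  shows "(cutoff s L i has_vector_derivative cutoff s L (Suc i) x) (at x)"
proof -
  have "((\<lambda>x. gauss i ((x - s) / L) / L ^ i) has_real_derivative gauss (Suc i) ((x - s) / L) * (1 / L) / L ^ i) (at x)"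
    by (rule DERIV_cdivide, rule DERIV_chain2[OF gauss_deriv]) (use assms in \<open>auto intro!: derivative_eq_intros\<close>)
  then have "((\<lambda>x. gauss i ((x - s) / L) / L ^ i) has_real_derivative gauss (Suc i) ((x - s) / L) / L ^ Suc i) (at x)"
    by simp
  then show ?thesis unfolding cutoff_def
    by (intro has_vector_derivative_of_real) (simp add: has_real_derivative_iff_has_vector_derivative)
qed

lemma cutoff_multiplier:
  assumes L: "L > 0" shows "multiplier (cutoff s L)"
  unfolding multiplier_def
proof (intro allI conjI)
  fix i
  show "smooth1 (cutoff s L i)"
    by (rule smooth1_coinduct[of "\<lambda>h. \<exists>i. h = cutoff s L i"]) (use cutoff_has_vderiv[OF L] in blast)+
  show "vderiv (cutoff s L i) = cutoff s L (Suc i)"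
    by (rule vderiv_eqI) (rule cutoff_has_vderiv[OF L])
  obtain E where E: "\<And>r. \<bar>gauss i r\<bar> \<le> E"
    using poly_gaussian_bounded[of "gauss_poly i"] by (auto simp: gauss_def abs_mult)
  have "cmod (cutoff s L i x) \<le> E / L ^ i" for x
    using E[of "(x - s) / L"] L by (simp add: cutoff_def norm_divide norm_power divide_right_mono)
  then show "\<exists>C. \<forall>x. cmod (cutoff s L i x) \<le> C" by blast
qed

text \<open>The weight is at most 1, so its square is dominated by the derivative of
  \<open>arctan\<close>; the negative half-line is handled by reflection.\<close>

lemma nn_integral_inverse_square_finite:
  "(\<integral>\<^sup>+r. ennreal ((1 / (1 + r\<^sup>2))\<^sup>2) \<partial>lborel) < \<infinity>"
proof -
  let ?f = "\<lambda>r::real. ennreal (inverse (1 + r\<^sup>2))"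
  have nz: "1 + r\<^sup>2 \<noteq> 0" for r :: real using zero_le_power2[of r] by linarith
  have half: "(\<integral>\<^sup>+r. ?f r * indicator {0..} r \<partial>lborel) = ennreal (pi / 2 - arctan 0)"
    by (rule nn_integral_FTC_atLeast) (auto intro!: tendsto_arctan_at_top DERIV_arctan)
  have "(\<integral>\<^sup>+r. ?f r * indicator {..0} r \<partial>lborel) = (\<integral>\<^sup>+r. ?f r * indicator {0..} r \<partial>lborel)"
    by (subst nn_integral_real_affine[where c = "-1" and t = 0]) (auto intro!: nn_integral_cong split: split_indicator)
  then have "(\<integral>\<^sup>+r. ?f r * indicator {..0} r + ?f r * indicator {0..} r \<partial>lborel)
      = ennreal (pi / 2 - arctan 0) + ennreal (pi / 2 - arctan 0)"
    using half by (subst nn_integral_add) auto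
  moreover have "(\<integral>\<^sup>+r. ennreal ((1 / (1 + r\<^sup>2))\<^sup>2) \<partial>lborel)
      \<le> (\<integral>\<^sup>+r. ?f r * indicator {..0} r + ?f r * indicator {0..} r \<partial>lborel)"
  proof (rule nn_integral_mono)
    fix r :: real
    have "(1 / (1 + r\<^sup>2))\<^sup>2 \<le> (1 / (1 + r\<^sup>2)) * 1"
      unfolding power2_eq_square by (intro mult_left_mono) (auto simp: divide_le_eq_1 nz add_pos_nonneg)
    then have "ennreal ((1 / (1 + r\<^sup>2))\<^sup>2) \<le> ?f r" by (intro ennreal_leI) (simp add: inverse_eq_divide)
    then show "ennreal ((1 / (1 + r\<^sup>2))\<^sup>2) \<le> ?f r * indicator {..0} r + ?f r * indicator {0..} r"
      by (cases "r \<ge> 0") (auto simp: add_increasing split: split_indicator)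
  qed
  ultimately show ?thesis by (simp add: le_less_trans)
qed

text \<open>Finite by comparison with the weight, positive because the integrand is at least
  \<open>exp (-2)\<close> on the unit interval. The value itself does not matter.\<close>

lemma nn_integral_gauss:
  obtains i0 where "i0 > 0" "(\<integral>\<^sup>+r. ennreal ((gauss 0 r)\<^sup>2) \<partial>lborel) = ennreal i0"
proof -
  let ?I = "\<integral>\<^sup>+r. ennreal ((gauss 0 r)\<^sup>2) \<partial>lborel"
  have "?I \<le> (\<integral>\<^sup>+r. ennreal ((1 / (1 + r\<^sup>2))\<^sup>2) \<partial>lborel)"
  proof (intro nn_integral_mono ennreal_leI power_mono)
    fix r :: real
    have "1 + r\<^sup>2 \<le> exp (r\<^sup>2)" by (rule exp_ge_add_one_self)
    then show "gauss 0 r \<le> 1 / (1 + r\<^sup>2)"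
      unfolding gauss_0 exp_minus inverse_eq_divide by (intro divide_left_mono) (auto simp: add_pos_nonneg)
  qed (simp add: gauss_0)
  then have fin: "?I < \<infinity>" using nn_integral_inverse_square_finite by (rule le_less_trans)
  have "ennreal (exp (-2)) = (\<integral>\<^sup>+r. ennreal (exp (-2)) * indicator {0..1::real} r \<partial>lborel)"
    by (subst nn_integral_cmult_indicator) auto
  also have "\<dots> \<le> ?I"
  proof (rule nn_integral_mono)
    fix r :: real
    show "ennreal (exp (-2)) * indicator {0..1} r \<le> ennreal ((gauss 0 r)\<^sup>2)"
    proof (cases "r \<in> {0..1}")
      case True
      then have "r\<^sup>2 \<le> 1" by (simp add: power_le_one)
      then have "exp (-2) \<le> exp (- r\<^sup>2) * exp (- r\<^sup>2)" unfolding exp_add[symmetric] by simp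
      then show ?thesis using True by (simp add: gauss_0 power2_eq_square)
    qed simp
  qed
  finally have "ennreal (exp (-2)) \<le> ?I" .
  then have pos: "?I > 0" by (smt (verit) ennreal_less_zero_iff exp_gt_zero order_less_le_trans)
  show ?thesis
    by (rule that[of "enn2real ?I"]) (use fin pos in \<open>auto simp: enn2real_positive_iff\<close>)
qed

lemma gauss_measurable [measurable]: "gauss i \<in> borel_measurable borel"
  using gauss_deriv by (intro borel_measurable_continuous_onI continuous_at_imp_continuous_on) (auto intro: DERIV_isCont)

text \<open>By Tonelli the integration over the centre comes first, and its value does not depend on
  \<open>x\<close>. So averaging erases the cutoff, and the factor \<open>L\<close> is the same on
  both sides of the final inequality.\<close>

lemma nn_integral_translates:
  fixes \<phi> \<Phi> :: "real \<Rightarrow> ennreal"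
  assumes [measurable]: "\<phi> \<in> borel_measurable borel" "\<Phi> \<in> borel_measurable borel" and L: "L > 0"
  shows "(\<integral>\<^sup>+s. (\<integral>\<^sup>+x. \<phi> ((x - s) / L) * \<Phi> x \<partial>lborel) \<partial>lborel)
    = ennreal L * (\<integral>\<^sup>+r. \<phi> r \<partial>lborel) * (\<integral>\<^sup>+x. \<Phi> x \<partial>lborel)"
proof -
  have shift: "(\<integral>\<^sup>+s. \<phi> ((x - s) / L) \<partial>lborel) = ennreal L * (\<integral>\<^sup>+r. \<phi> r \<partial>lborel)" for x
    using nn_integral_real_affine[of "\<lambda>s. \<phi> ((x - s) / L)" "- L" x] L by simp
  have "(\<integral>\<^sup>+s. (\<integral>\<^sup>+x. \<phi> ((x - s) / L) * \<Phi> x \<partial>lborel) \<partial>lborel)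
      = (\<integral>\<^sup>+x. (\<integral>\<^sup>+s. \<phi> ((x - s) / L) * \<Phi> x \<partial>lborel) \<partial>lborel)"
    by (rule lborel_pair.Fubini') measurable
  also have "\<dots> = (\<integral>\<^sup>+x. (ennreal L * (\<integral>\<^sup>+r. \<phi> r \<partial>lborel)) * \<Phi> x \<partial>lborel)"
    by (simp add: nn_integral_multc shift)
  also have "\<dots> = ennreal L * (\<integral>\<^sup>+r. \<phi> r \<partial>lborel) * (\<integral>\<^sup>+x. \<Phi> x \<partial>lborel)"
    by (rule nn_integral_cmult) simp
  finally show ?thesis .
qed

context elliptic_family
begin

text \<open>Adding and subtracting splits the left-hand side into the cutoff times the old residue
  (\<open>t1\<close>), the change of coefficients (\<open>t2\<close>) and the Leibniz terms that
  differentiate the cutoff (\<open>t3\<close>). All three are bounded with the common weight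
  \<open>h\<close>.\<close>

lemma cutoff_pointwise:
  assumes B: "B > 0" "\<And>k p. k \<le> m \<Longrightarrow> cmod (a k p) \<le> B"
      "\<And>k p q. k \<le> m \<Longrightarrow> cmod (a k p - a k q) \<le> B * dist p q"
    and E: "E > 0" "\<And>i r. i \<le> m \<Longrightarrow> \<bar>gauss i r\<bar> \<le> E / (1 + r\<^sup>2)" "\<And>r. \<bar>r * gauss 0 r\<bar> \<le> E / (1 + r\<^sup>2)"
    and L: "L \<ge> 1" "\<bar>t - t'\<bar> * L\<^sup>2 = 1"
  shows "cmod ((\<Sum>k\<le>m. coef t' (fst y, snd y + (t - t') * s) k x * leibniz k (cutoff s L) v x)
        - z * (cutoff s L 0 x * v 0 x))
    \<le> E / (1 + ((x - s) / L)\<^sup>2) * (cmod ((\<Sum>k\<le>m. coef t y k x * v k x) - z * v 0 x)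
        + B * (1 + real (Suc m) * 2 ^ m) / L * (\<Sum>k\<le>m. cmod (v k x)))"
proof -
  define r where "r = (x - s) / L"
  define h where "h = E / (1 + r\<^sup>2)"
  define y' where "y' = (fst y, snd y + (t - t') * s)"
  define D where "D = cutoff s L"
  define S where "S = (\<Sum>k\<le>m. cmod (v k x))"
  have S0: "S \<ge> 0" by (simp add: S_def sum_nonneg)
  have L0: "L > 0" using L(1) by simp
  have h0: "h > 0" using E(1) by (simp add: h_def add_pos_nonneg)
  have vS: "cmod (v k x) \<le> S" if "k \<le> m" for k
    unfolding S_def using that by (intro member_le_sum) auto
  have D0: "cmod (D 0 x) = \<bar>gauss 0 r\<bar>" by (simp add: D_def cutoff_def r_def)
  have D0h: "cmod (D 0 x) \<le> h" using E(2)[of 0 r] by (simp add: D0 h_def)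
  have Dh: "cmod (D i x) \<le> h / L" if "1 \<le> i" "i \<le> m" for i
  proof -
    have "cmod (D i x) = \<bar>gauss i r\<bar> / L ^ i" using L0 by (simp add: D_def cutoff_def r_def norm_divide norm_power)
    also have "\<dots> \<le> h / L ^ i" using E(2)[OF that(2), of r] L0 by (intro divide_right_mono) (auto simp: h_def)
    \<comment> \<open>Derivatives of higher order gain more; since \<open>L \<ge> 1\<close>, all of
      them are at least as good as the first.\<close>
    also have "\<dots> \<le> h / L ^ 1" using L L0 h0 that(1) by (intro divide_left_mono power_increasing) auto
    finally show ?thesis by simp
  qed
  have t1: "cmod (D 0 x * ((\<Sum>k\<le>m. coef t y k x * v k x) - z * v 0 x))
      \<le> h * cmod ((\<Sum>k\<le>m. coef t y k x * v k x) - z * v 0 x)"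
    using D0h by (simp add: norm_mult mult_right_mono)
  have t2: "cmod (\<Sum>k\<le>m. (coef t' y' k x - coef t y k x) * D 0 x * v k x) \<le> (\<Sum>k\<le>m. B / L * h * cmod (v k x))"
  proof (rule sum_norm_le)
    fix k assume "k \<in> {..m}"
    then have k: "k \<le> m" by simp
    have Lr: "x - s = L * r" using L0 by (simp add: r_def)
    \<comment> \<open>The base point \<open>y'\<close> makes the two lines cross at
      \<open>x = s\<close>; their distance grows linearly from there.\<close>
    have "t' * x + snd y' - (t * x + snd y) = (t' - t) * (x - s)"
      by (simp add: y'_def algebra_simps)
    then have "t' * x + snd y' - (t * x + snd y) = (t' - t) * (L * r)" unfolding Lr .
    then have "dist (x + fst y', t' * x + snd y') (x + fst y, t * x + snd y) = \<bar>t - t'\<bar> * (L * \<bar>r\<bar>)"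
      using L0 by (simp add: y'_def dist_Pair_Pair dist_norm abs_mult abs_minus_commute)
    then have "cmod (coef t' y' k x - coef t y k x) \<le> B * (\<bar>t - t'\<bar> * (L * \<bar>r\<bar>))"
      unfolding coef_def using B(3)[OF k] by metis
    \<comment> \<open>The choice of \<open>L\<close> enters here: the mismatch acquires the same
      order \<open>1 / L\<close> as the commutator.\<close>
    also have "\<bar>t - t'\<bar> * (L * \<bar>r\<bar>) = \<bar>r\<bar> / L"
      using L(2) L0 by (simp add: field_simps power2_eq_square)
    finally have "cmod (coef t' y' k x - coef t y k x) * cmod (D 0 x) \<le> B * (\<bar>r\<bar> / L) * cmod (D 0 x)"
      by (rule mult_right_mono) simp
    also have "\<dots> = B / L * \<bar>r * gauss 0 r\<bar>" by (simp add: D0 abs_mult)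
    also have "\<dots> \<le> B / L * h" unfolding h_def using B(1) L0 by (intro mult_left_mono E(3)) auto
    finally show "cmod ((coef t' y' k x - coef t y k x) * D 0 x * v k x) \<le> B / L * h * cmod (v k x)"
      unfolding norm_mult by (rule mult_right_mono) simp
  qed
  have t3: "cmod (\<Sum>k\<le>m. coef t' y' k x * (leibniz k D v x - D 0 x * v k x)) \<le> (\<Sum>k\<le>m. B * (2 ^ m * (h / L) * S))"
  proof (rule sum_norm_le)
    fix k assume "k \<in> {..m}"
    then have k: "k \<le> m" by simp
    have "cmod (leibniz k D v x - D 0 x * v k x) \<le> 2 ^ k * (h / L) * S"
      using k Dh vS h0 L0 by (intro leibniz_bound) auto
    also have "\<dots> \<le> 2 ^ m * (h / L) * S"
      using k h0 L0 S0 by (intro mult_right_mono power_increasing) auto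
    finally show "cmod (coef t' y' k x * (leibniz k D v x - D 0 x * v k x)) \<le> B * (2 ^ m * (h / L) * S)"
      unfolding norm_mult using B(1,2) k by (intro mult_mono) (auto simp: coef_def)
  qed
  have "(\<Sum>k\<le>m. coef t' y' k x * leibniz k D v x) - z * (D 0 x * v 0 x)
     = D 0 x * ((\<Sum>k\<le>m. coef t y k x * v k x) - z * v 0 x)
     + (\<Sum>k\<le>m. (coef t' y' k x - coef t y k x) * D 0 x * v k x)
     + (\<Sum>k\<le>m. coef t' y' k x * (leibniz k D v x - D 0 x * v k x))"
    by (simp add: algebra_simps sum_distrib_left sum.distrib sum_subtractf)
  then have "cmod ((\<Sum>k\<le>m. coef t' y' k x * leibniz k D v x) - z * (D 0 x * v 0 x))
     \<le> h * cmod ((\<Sum>k\<le>m. coef t y k x * v k x) - z * v 0 x)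
     + (\<Sum>k\<le>m. B / L * h * cmod (v k x)) + (\<Sum>k\<le>m. B * (2 ^ m * (h / L) * S))"
    using norm_triangle_mono[OF norm_triangle_mono[OF t1 t2] t3] by (simp only:)
  also have "\<dots> = h * (cmod ((\<Sum>k\<le>m. coef t y k x * v k x) - z * v 0 x) + B * (1 + real (Suc m) * 2 ^ m) / L * S)"
    unfolding sum_distrib_left[symmetric] S_def[symmetric]
    using L0 by (simp add: field_simps)
  finally show ?thesis unfolding h_def r_def y'_def D_def S_def .
qed


lemma nn_integral_weighted_square:
  assumes "L2 p" "\<And>k. k \<le> n \<Longrightarrow> L2 (v k)" "0 \<le> c" "0 \<le> b"
  shows "(\<integral>\<^sup>+x. ennreal (c * ((cmod (p x))\<^sup>2 + b * (\<Sum>k\<le>n. (cmod (v k x))\<^sup>2))) \<partial>lborel)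
    = ennreal (c * ((norm (mk p))\<^sup>2 + b * (\<Sum>k\<le>n. (norm (mk (v k)))\<^sup>2)))"
proof -
  have n: "(norm (mk f))\<^sup>2 = (LINT x|lborel. (cmod (f x))\<^sup>2)" if "L2 f" for f
  proof -
    have "ennreal ((norm (mk f))\<^sup>2) = ennreal (LINT x|lborel. (cmod (f x))\<^sup>2)"
      unfolding norm_mk[OF that] by (rule nn_integral_eq_integral) (auto intro: L2_integrable[OF that])
    then show ?thesis by simp
  qed
  have ip: "integrable lborel (\<lambda>x. (cmod (p x))\<^sup>2)" using assms(1) by (rule L2_integrable)
  have iv: "integrable lborel (\<lambda>x. (cmod (v k x))\<^sup>2)" if "k \<in> {..n}" for k
    using assms(2) that by (auto intro: L2_integrable)
  have isum: "integrable lborel (\<lambda>x. b * (\<Sum>k\<le>n. (cmod (v k x))\<^sup>2))"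
    by (intro integrable_mult_right Bochner_Integration.integrable_sum iv)
  have "(\<integral>\<^sup>+x. ennreal (c * ((cmod (p x))\<^sup>2 + b * (\<Sum>k\<le>n. (cmod (v k x))\<^sup>2))) \<partial>lborel)
    = ennreal (LINT x|lborel. c * ((cmod (p x))\<^sup>2 + b * (\<Sum>k\<le>n. (cmod (v k x))\<^sup>2)))"
    using assms(3,4)
    by (intro nn_integral_eq_integral integrable_mult_right Bochner_Integration.integrable_add ip isum)
      (auto intro!: AE_I2 mult_nonneg_nonneg add_nonneg_nonneg sum_nonneg)
  also have "(LINT x|lborel. c * ((cmod (p x))\<^sup>2 + b * (\<Sum>k\<le>n. (cmod (v k x))\<^sup>2)))
    = c * ((norm (mk p))\<^sup>2 + b * (\<Sum>k\<le>n. (norm (mk (v k)))\<^sup>2))"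
    using n[OF assms(1)] n[OF assms(2)] iv
    by (simp add: Bochner_Integration.integral_add[OF ip isum] Bochner_Integration.integral_sum)
  finally show ?thesis .
qed

text \<open>The Leibniz rule puts the localized function into the domain, so the gap applies to it.
  Nonnegative integrals are used for both norms so that Tonelli applies directly when
  \<open>s\<close> varies.\<close>

lemma cutoff_norm_estimate:
  assumes V: "weak_chain m V" and L: "L > 0" and d: "d \<ge> 0"
    and gap: "\<And>u f. (u, f) \<in> op_rel t' y' \<Longrightarrow> d * norm u \<le> norm (f - cscale z u)"
  shows "ennreal (d\<^sup>2) * (\<integral>\<^sup>+x. ennreal ((cmod (cutoff s L 0 x * fn (V 0) x))\<^sup>2) \<partial>lborel)
    \<le> (\<integral>\<^sup>+x. ennreal ((cmod ((\<Sum>k\<le>m. coef t' y' k x * leibniz k (cutoff s L) (\<lambda>k. fn (V k)) x)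
        - z * (cutoff s L 0 x * fn (V 0) x)))\<^sup>2) \<partial>lborel)"
proof -
  let ?u = "\<lambda>x. cutoff s L 0 x * fn (V 0) x"
  let ?g = "\<lambda>x. \<Sum>k\<le>m. coef t' y' k x * leibniz k (cutoff s L) (\<lambda>k. fn (V k)) x"
  have "weak_derivs m ?u (\<lambda>k. leibniz k (cutoff s L) (\<lambda>k. fn (V k)))"
    using V by (intro weak_derivs_leibniz cutoff_multiplier L) (simp add: weak_chain_weak_derivs)
  from op_graph_intro[OF this] have ug: "(?u, ?g) \<in> op_graph a m t' y'" .
  have L2u: "L2 ?u" and L2g: "L2 ?g" using sa_graph.L2G[OF sa ug] by auto
  have "d * norm (mk ?u) \<le> norm (mk ?g - cscale z (mk ?u))"
    using gap sa_graph.mk_mem_qgraph[OF sa ug] unfolding op_rel_def by blast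
  also have "mk ?g - cscale z (mk ?u) = mk (\<lambda>x. ?g x - z * ?u x)"
    unfolding cscale_mk[OF L2u] by (rule mk_diff[OF L2g L2_cmult[OF L2u], symmetric])
  finally have "d * norm (mk ?u) \<le> norm (mk (\<lambda>x. ?g x - z * ?u x))" .
  then have "(d * norm (mk ?u))\<^sup>2 \<le> (norm (mk (\<lambda>x. ?g x - z * ?u x)))\<^sup>2"
    using d by (intro power_mono) auto
  then have "ennreal (d\<^sup>2) * ennreal ((norm (mk ?u))\<^sup>2) \<le> ennreal ((norm (mk (\<lambda>x. ?g x - z * ?u x)))\<^sup>2)"
    by (simp add: power_mult_distrib ennreal_leI flip: ennreal_mult)
  then show ?thesis unfolding norm_mk[OF L2u] norm_mk[OF L2_diff[OF L2g L2_cmult[OF L2u]]] .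
qed

text \<open>The base point moves with the centre, so the gap is required at every \<open>y'\<close>;
  averaging over \<open>s\<close> then returns to the norms of the original chain. The constant
  depends on the family only.\<close>

lemma gap_estimate:
  obtains M where "M > 0"
    "\<And>t t' y z d V L. weak_chain m V \<Longrightarrow> L \<ge> 1 \<Longrightarrow> \<bar>t - t'\<bar> * L\<^sup>2 = 1 \<Longrightarrow> d \<ge> 0 \<Longrightarrow>
      (\<And>y' u f. (u, f) \<in> op_rel t' y' \<Longrightarrow> d * norm u \<le> norm (f - cscale z u)) \<Longrightarrow>
      d\<^sup>2 * (norm (V 0))\<^sup>2 \<le> M * ((norm (op_apply t y V - cscale z (V 0)))\<^sup>2 + (\<Sum>k\<le>m. (norm (V k))\<^sup>2) / L\<^sup>2)"
proof -
  obtain B where B: "B > 0" "\<And>k p. k \<le> m \<Longrightarrow> cmod (a k p) \<le> B"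
    "\<And>k p q. k \<le> m \<Longrightarrow> cmod (a k p - a k q) \<le> B * dist p q" using uniform_bounds by blast
  obtain E where E: "E > 0" "\<And>i r. i \<le> m \<Longrightarrow> \<bar>gauss i r\<bar> \<le> E / (1 + r\<^sup>2)" "\<And>r. \<bar>r * gauss 0 r\<bar> \<le> E / (1 + r\<^sup>2)"
    using gauss_decay by blast
  obtain i0 where i0: "i0 > 0" "(\<integral>\<^sup>+r. ennreal ((gauss 0 r)\<^sup>2) \<partial>lborel) = ennreal i0"
    using nn_integral_gauss by blast
  obtain i1 where i1: "i1 \<ge> 0" "(\<integral>\<^sup>+r. ennreal ((1 / (1 + r\<^sup>2))\<^sup>2) \<partial>lborel) = ennreal i1"
    using nn_integral_inverse_square_finite by (cases "(\<integral>\<^sup>+r. ennreal ((1 / (1 + r\<^sup>2))\<^sup>2) \<partial>lborel)") auto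
  define C where "C = B * (1 + real (Suc m) * 2 ^ m)"
  define N where "N = 1 + C\<^sup>2 * real (Suc m)"
  have N: "N \<ge> 1" by (simp add: N_def)
  \<comment> \<open>Here \<open>i0\<close> and \<open>i1\<close> are the averages of the squared
    cutoff and squared weight, \<open>2 * E\<^sup>2\<close> comes from squaring the pointwise bound,
    and \<open>N\<close> absorbs its coefficients; \<open>i1 + 1\<close> makes the constant visibly
    positive.\<close>
  define M where "M = (i1 + 1) * (2 * E\<^sup>2) * N / i0"
  show ?thesis
  proof (rule that[of M])
    show "M > 0" using E(1) i0(1) i1(1) N by (simp add: M_def)
    fix t t' y z d V L
    assume V: "weak_chain m V" and L: "L \<ge> (1::real)" "\<bar>t - t'\<bar> * L\<^sup>2 = 1" and d: "d \<ge> 0"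
      and gap: "\<And>y' u f. (u, f) \<in> op_rel t' y' \<Longrightarrow> d * norm u \<le> norm (f - cscale z u)"
    have L0: "L > 0" using L(1) by simp
    define v where "v k = fn (V k)" for k
    have [measurable]: "v k \<in> borel_measurable borel" for k by (simp add: v_def)
    have L2v: "L2 (v k)" and mkv: "mk (v k) = V k" for k by (simp_all add: v_def)
    let ?F = "\<lambda>x. \<Sum>k\<le>m. coef t y k x * v k x"
    define p where "p x = ?F x - z * v 0 x" for x
    have L2p: "L2 p" unfolding p_def by (intro L2_diff op_sum_L2 L2_cmult L2v)
    then have [measurable]: "p \<in> borel_measurable borel" by (rule L2_borel)
    have mkp: "mk p = op_apply t y V - cscale z (V 0)"
    proof -
      have "mk p = mk ?F - mk (\<lambda>x. z * v 0 x)"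
        unfolding p_def by (intro mk_diff op_sum_L2 L2_cmult L2v)
      also have "mk ?F = op_apply t y V" using op_apply_mk[of v t y] L2v mkv by simp
      also have "mk (\<lambda>x. z * v 0 x) = cscale z (V 0)" by (simp add: cscale_def v_def)
      finally show ?thesis .
    qed
    \<comment> \<open>The factor \<open>Suc m\<close> is the Cauchy-Schwarz cost of passing from the
      squared sum over \<open>m + 1\<close> derivatives to the sum of squares.\<close>
    define b where "b = (C / L)\<^sup>2 * real (Suc m)"
    have b: "b \<ge> 0" by (simp add: b_def)
    define \<Phi> where "\<Phi> x = ennreal (2 * E\<^sup>2 * ((cmod (p x))\<^sup>2 + b * (\<Sum>k\<le>m. (cmod (v k x))\<^sup>2)))" for x
    have [measurable]: "\<Phi> \<in> borel_measurable borel" unfolding \<Phi>_def by measurable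
    have slice: "ennreal (d\<^sup>2) * (\<integral>\<^sup>+x. ennreal ((gauss 0 ((x - s) / L))\<^sup>2) * ennreal ((cmod (v 0 x))\<^sup>2) \<partial>lborel)
       \<le> (\<integral>\<^sup>+x. ennreal ((1 / (1 + ((x - s) / L)\<^sup>2))\<^sup>2) * \<Phi> x \<partial>lborel)" for s
    proof -
      let ?y' = "(fst y, snd y + (t - t') * s)"
      let ?g = "\<lambda>x. \<Sum>k\<le>m. coef t' ?y' k x * leibniz k (cutoff s L) v x"
      have "ennreal (d\<^sup>2) * (\<integral>\<^sup>+x. ennreal ((gauss 0 ((x - s) / L))\<^sup>2) * ennreal ((cmod (v 0 x))\<^sup>2) \<partial>lborel)
        = ennreal (d\<^sup>2) * (\<integral>\<^sup>+x. ennreal ((cmod (cutoff s L 0 x * v 0 x))\<^sup>2) \<partial>lborel)"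
        by (simp add: cutoff_def norm_mult power_mult_distrib ennreal_mult)
      also have "\<dots> \<le> (\<integral>\<^sup>+x. ennreal ((cmod (?g x - z * (cutoff s L 0 x * v 0 x)))\<^sup>2) \<partial>lborel)"
        using cutoff_norm_estimate[where y' = ?y' and s = s, OF V L0 d gap] unfolding v_def[symmetric] .
      also have "\<dots> \<le> (\<integral>\<^sup>+x. ennreal ((1 / (1 + ((x - s) / L)\<^sup>2))\<^sup>2) * \<Phi> x \<partial>lborel)"
      proof (rule nn_integral_mono)
        fix x
        define h where "h = 1 / (1 + ((x - s) / L)\<^sup>2)"
        define S where "S = (\<Sum>k\<le>m. cmod (v k x))"
        have "cmod (?g x - z * (cutoff s L 0 x * v 0 x)) \<le> E * h * (cmod (p x) + C / L * S)"
          using cutoff_pointwise[OF B E L, of y s x v z]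
          by (simp add: h_def S_def C_def p_def)
        then have "(cmod (?g x - z * (cutoff s L 0 x * v 0 x)))\<^sup>2 \<le> (E * h * (cmod (p x) + C / L * S))\<^sup>2"
          by (rule power_mono) simp
        also have "\<dots> = h\<^sup>2 * (E\<^sup>2 * (cmod (p x) + C / L * S)\<^sup>2)" by (simp add: power_mult_distrib)
        also have "\<dots> \<le> h\<^sup>2 * (E\<^sup>2 * (2 * ((cmod (p x))\<^sup>2 + b * (\<Sum>k\<le>m. (cmod (v k x))\<^sup>2))))"
        proof (intro mult_left_mono)
          have "(cmod (p x) + C / L * S)\<^sup>2 \<le> 2 * (cmod (p x))\<^sup>2 + 2 * (C / L * S)\<^sup>2"
            using sum_squares_bound[of "cmod (p x)" "C / L * S"] by (simp add: power2_sum)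
          also have "(C / L * S)\<^sup>2 = (C / L)\<^sup>2 * S\<^sup>2" by (rule power_mult_distrib)
          also have "S\<^sup>2 \<le> real (Suc m) * (\<Sum>k\<le>m. (cmod (v k x))\<^sup>2)"
            unfolding S_def using sum_squared_le_sum_of_squares[of "\<lambda>k. cmod (v k x)" "{..m}"] by (simp add: mult.commute)
          finally show "(cmod (p x) + C / L * S)\<^sup>2 \<le> 2 * ((cmod (p x))\<^sup>2 + b * (\<Sum>k\<le>m. (cmod (v k x))\<^sup>2))"
            by (simp add: b_def mult_left_mono mult.assoc)
        qed auto
        also have "\<dots> = h\<^sup>2 * (2 * E\<^sup>2 * ((cmod (p x))\<^sup>2 + b * (\<Sum>k\<le>m. (cmod (v k x))\<^sup>2)))"
          by (simp only: mult_ac)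
        finally have le: "(cmod (?g x - z * (cutoff s L 0 x * v 0 x)))\<^sup>2
          \<le> h\<^sup>2 * (2 * E\<^sup>2 * ((cmod (p x))\<^sup>2 + b * (\<Sum>k\<le>m. (cmod (v k x))\<^sup>2)))" .
        show "ennreal ((cmod (?g x - z * (cutoff s L 0 x * v 0 x)))\<^sup>2) \<le> ennreal (h\<^sup>2) * \<Phi> x"
          unfolding \<Phi>_def using ennreal_leI[OF le] b
          by (subst ennreal_mult[symmetric]) (auto intro!: mult_nonneg_nonneg add_nonneg_nonneg sum_nonneg)
      qed
      finally show ?thesis .
    qed
    have "ennreal (d\<^sup>2 * (L * i0 * (norm (V 0))\<^sup>2))
        = ennreal (d\<^sup>2) * (ennreal L * (\<integral>\<^sup>+r. ennreal ((gauss 0 r)\<^sup>2) \<partial>lborel) * (\<integral>\<^sup>+x. ennreal ((cmod (v 0 x))\<^sup>2) \<partial>lborel))"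
      using L0 i0 by (simp add: ennreal_mult norm_l2_nn v_def)
    also have "\<dots> = ennreal (d\<^sup>2) * (\<integral>\<^sup>+s. (\<integral>\<^sup>+x. ennreal ((gauss 0 ((x - s) / L))\<^sup>2) * ennreal ((cmod (v 0 x))\<^sup>2) \<partial>lborel) \<partial>lborel)"
      by (subst nn_integral_translates[OF _ _ L0, of "\<lambda>r. ennreal ((gauss 0 r)\<^sup>2)"]) auto
    also have "\<dots> = (\<integral>\<^sup>+s. ennreal (d\<^sup>2) * (\<integral>\<^sup>+x. ennreal ((gauss 0 ((x - s) / L))\<^sup>2) * ennreal ((cmod (v 0 x))\<^sup>2) \<partial>lborel) \<partial>lborel)"
      by (rule nn_integral_cmult[symmetric]) measurable
    also have "\<dots> \<le> (\<integral>\<^sup>+s. (\<integral>\<^sup>+x. ennreal ((1 / (1 + ((x - s) / L)\<^sup>2))\<^sup>2) * \<Phi> x \<partial>lborel) \<partial>lborel)"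
      by (intro nn_integral_mono slice)
    also have "\<dots> = ennreal L * (\<integral>\<^sup>+r. ennreal ((1 / (1 + r\<^sup>2))\<^sup>2) \<partial>lborel) * (\<integral>\<^sup>+x. \<Phi> x \<partial>lborel)"
      by (rule nn_integral_translates[OF _ _ L0, of "\<lambda>r. ennreal ((1 / (1 + r\<^sup>2))\<^sup>2)"]) auto
    also have "(\<integral>\<^sup>+x. \<Phi> x \<partial>lborel) = ennreal (2 * E\<^sup>2 * ((norm (mk p))\<^sup>2 + b * (\<Sum>k\<le>m. (norm (V k))\<^sup>2)))"
      unfolding \<Phi>_def using nn_integral_weighted_square[OF L2p L2v, where c = "2 * E\<^sup>2" and b = b and n = m] b mkv by simp
    also have "ennreal L * (\<integral>\<^sup>+r. ennreal ((1 / (1 + r\<^sup>2))\<^sup>2) \<partial>lborel) * \<dots>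
        = ennreal (L * i1 * (2 * E\<^sup>2 * ((norm (mk p))\<^sup>2 + b * (\<Sum>k\<le>m. (norm (V k))\<^sup>2))))"
      using L0 i1 b by (simp add: ennreal_mult sum_nonneg)
    finally have "d\<^sup>2 * (L * i0 * (norm (V 0))\<^sup>2) \<le> L * i1 * (2 * E\<^sup>2 * ((norm (mk p))\<^sup>2 + b * (\<Sum>k\<le>m. (norm (V k))\<^sup>2)))"
      using L0 i1 b by (subst (asm) ennreal_le_iff) (auto intro!: mult_nonneg_nonneg add_nonneg_nonneg sum_nonneg)
    \<comment> \<open>The common factor \<open>L\<close> cancels, so the width of the cutoff
      survives only in the small coefficient \<open>b\<close>.\<close>
    then have "i0 * (d\<^sup>2 * (norm (V 0))\<^sup>2) \<le> i1 * (2 * E\<^sup>2) * ((norm (mk p))\<^sup>2 + b * (\<Sum>k\<le>m. (norm (V k))\<^sup>2))"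
      using L0 by (simp add: mult_ac)
    also have "\<dots> \<le> (i1 + 1) * (2 * E\<^sup>2) * (N * ((norm (mk p))\<^sup>2 + (\<Sum>k\<le>m. (norm (V k))\<^sup>2) / L\<^sup>2))"
    proof (intro mult_mono)
      define Q where "Q = (\<Sum>k\<le>m. (norm (V k))\<^sup>2) / L\<^sup>2"
      have Q: "Q \<ge> 0" by (simp add: Q_def sum_nonneg)
      have "b * (\<Sum>k\<le>m. (norm (V k))\<^sup>2) = (N - 1) * Q" by (simp add: b_def N_def Q_def power_divide)
      moreover have "(norm (mk p))\<^sup>2 \<le> N * (norm (mk p))\<^sup>2" using N by (simp add: mult_le_cancel_right1)
      ultimately show "(norm (mk p))\<^sup>2 + b * (\<Sum>k\<le>m. (norm (V k))\<^sup>2) \<le> N * ((norm (mk p))\<^sup>2 + (\<Sum>k\<le>m. (norm (V k))\<^sup>2) / L\<^sup>2)"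
        unfolding Q_def[symmetric] using Q by (simp add: algebra_simps)
    qed (use i1 b in \<open>auto intro!: add_nonneg_nonneg mult_nonneg_nonneg sum_nonneg\<close>)
    finally have "d\<^sup>2 * (norm (V 0))\<^sup>2 \<le> M * ((norm (mk p))\<^sup>2 + (\<Sum>k\<le>m. (norm (V k))\<^sup>2) / L\<^sup>2)"
      using i0(1) by (simp add: M_def pos_le_divide_eq mult_ac)
    then show "d\<^sup>2 * (norm (V 0))\<^sup>2 \<le> M * ((norm (op_apply t y V - cscale z (V 0)))\<^sup>2 + (\<Sum>k\<le>m. (norm (V k))\<^sup>2) / L\<^sup>2)"
      unfolding mkp .
  qed
qed

lemma spectrum_distance:
  "\<exists>C>0. \<forall>t' z. \<bar>t - t'\<bar> < 1 \<longrightarrow> z \<in> Sigma_spec a m t \<longrightarrow>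
     infdist z (Sigma_spec a m t') \<le> C * (1 + cmod z) * sqrt \<bar>t - t'\<bar>"
proof -
  obtain M where M: "M > 0"
    "\<And>t t' y z d V L. weak_chain m V \<Longrightarrow> L \<ge> 1 \<Longrightarrow> \<bar>t - t'\<bar> * L\<^sup>2 = 1 \<Longrightarrow> d \<ge> 0 \<Longrightarrow>
      (\<And>y' u f. (u, f) \<in> op_rel t' y' \<Longrightarrow> d * norm u \<le> norm (f - cscale z u)) \<Longrightarrow>
      d\<^sup>2 * (norm (V 0))\<^sup>2 \<le> M * ((norm (op_apply t y V - cscale z (V 0)))\<^sup>2 + (\<Sum>k\<le>m. (norm (V k))\<^sup>2) / L\<^sup>2)"
    using gap_estimate by metis
  obtain K where K: "K > 0"
    "\<And>y V k. weak_chain m V \<Longrightarrow> k \<le> m \<Longrightarrow> norm (V k) \<le> K * (norm (V 0) + norm (op_apply t y V))"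
    using elliptic_estimate by metis
  \<comment> \<open>The 1 accounts for the residue of the approximate eigenfunction, the other term
    for its \<open>m + 1\<close> derivatives, each at most \<open>2 * K * (1 + cmod z)\<close> times
    its norm.\<close>
  define C where "C = sqrt (M * (1 + real (Suc m) * (2 * K)\<^sup>2))"
  have C: "C > 0" unfolding C_def using M(1) by (simp add: add_pos_nonneg)
  have "infdist z (Sigma_spec a m t') \<le> C * (1 + cmod z) * sqrt \<bar>t - t'\<bar>"
    if t': "\<bar>t - t'\<bar> < 1" and z: "z \<in> Sigma_spec a m t" for t' z
  \<comment> \<open>Only a positive distance needs an argument; an empty target set is also covered,
    since \<open>infdist\<close> to it is 0 by convention.\<close>
  proof (cases "t = t' \<or> infdist z (Sigma_spec a m t') = 0")
    case True
    then have "infdist z (Sigma_spec a m t') = 0" using z infdist_zero by auto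
    then show ?thesis using C by simp
  next
    case False
    define d where "d = infdist z (Sigma_spec a m t')"
    have d: "d > 0" using False infdist_nonneg[of z "Sigma_spec a m t'"] by (simp add: d_def)
    define \<epsilon> where "\<epsilon> = sqrt \<bar>t - t'\<bar>"
    have \<epsilon>: "\<epsilon> > 0" "\<epsilon> \<le> 1" using False t' by (auto simp: \<epsilon>_def)
    \<comment> \<open>A slope difference below 1 is what makes \<open>L \<ge> 1\<close>, as the
      cutoff estimates require.\<close>
    define L where "L = 1 / \<epsilon>"
    have \<epsilon>2: "\<epsilon>\<^sup>2 = \<bar>t - t'\<bar>" by (simp add: \<epsilon>_def)
    have L: "L \<ge> 1" "\<bar>t - t'\<bar> * L\<^sup>2 = 1"
      using \<epsilon> unfolding \<epsilon>2[symmetric] by (auto simp: L_def power_divide)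
    obtain y where y: "z \<in> spec_graph (op_graph a m t y)" using z unfolding Sigma_spec_def by blast
    \<comment> \<open>The tolerance has the order of the desired bound, so the residue costs no more
      than the localization errors.\<close>
    obtain u f where uf: "(u, f) \<in> op_rel t y" "norm (f - cscale z u) < \<epsilon> * norm u"
      using sa_graph.approx_eigenvector[OF sa y \<epsilon>(1)] unfolding op_rel_def by blast
    obtain V where V: "weak_chain m V" "u = V 0" "f = op_apply t y V" using uf(1) unfolding op_rel_iff by blast
    have u0: "norm u > 0"
      using uf(2) norm_ge_zero[of "f - cscale z u"] by (cases "u = 0") auto
    \<comment> \<open>The gap bound is formulated at real points, and spectral points of
      self-adjoint graphs are real.\<close>
    have zr: "z = of_real (Re z)" using sa_graph.spec_real[OF sa y] .
    have gap: "d * norm w \<le> norm (g - cscale z w)" if "(w, g) \<in> op_rel t' y'" for y' w g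
    proof -
      have "d \<le> dist (of_real (Re z)) x" if "x \<in> spec_graph (op_graph a m t' y')" for x
        unfolding zr[symmetric] d_def Sigma_spec_def using that by (intro infdist_le UN_I[of y']) auto
      from sa_graph.gap_bound[OF sa d this] that show ?thesis
        unfolding zr[symmetric] op_rel_def by blast
    qed
    have Vk: "norm (V k) \<le> 2 * K * (1 + cmod z) * norm u" if k: "k \<le> m" for k
    proof -
      \<comment> \<open>The elliptic estimate involves the norm of \<open>f\<close>, which for an
        approximate eigenfunction is at most \<open>1 + cmod z\<close> times that of
        \<open>u\<close>; this is the origin of the growth factor in the theorem.\<close>
      have "norm f \<le> norm (f - cscale z u) + norm (cscale z u)" using norm_triangle_sub by (simp add: add.commute)
      also have "\<dots> \<le> norm u + cmod z * norm u"
        using uf(2) mult_right_mono[OF \<epsilon>(2) norm_ge_zero[of u]] by (simp add: norm_cscale)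
      finally have "norm f \<le> norm u + cmod z * norm u" .
      moreover have "2 * (1 + cmod z) * norm u = 2 * norm u + 2 * (cmod z * norm u)"
        by (simp add: algebra_simps)
      moreover have "0 \<le> cmod z * norm u" by simp
      ultimately have "norm u + norm f \<le> 2 * (1 + cmod z) * norm u" by linarith
      then have "K * (norm u + norm f) \<le> K * (2 * (1 + cmod z) * norm u)"
        using K(1) by (intro mult_left_mono) auto
      then show ?thesis using K(2)[OF V(1) k, of y] V(2,3) by (simp add: mult_ac)
    qed
    define Z where "Z = 1 + cmod z"
    have "d\<^sup>2 * (norm u)\<^sup>2 \<le> M * ((norm (f - cscale z u))\<^sup>2 + (\<Sum>k\<le>m. (norm (V k))\<^sup>2) / L\<^sup>2)"
      using M(2)[where y = y, OF V(1) L less_imp_le[OF d] gap] V(2,3) by simp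
    also have "\<dots> \<le> M * ((\<epsilon> * norm u)\<^sup>2 + (\<Sum>k\<le>m. (2 * K * (1 + cmod z) * norm u)\<^sup>2) / L\<^sup>2)"
      using M(1) uf(2) Vk by (intro mult_left_mono add_mono power_mono divide_right_mono sum_mono) auto
    also have "\<dots> = M * (1 + real (Suc m) * (2 * K)\<^sup>2 * (1 + cmod z)\<^sup>2) * \<epsilon>\<^sup>2 * (norm u)\<^sup>2"
      unfolding Z_def[symmetric] by (simp add: L_def power_divide power_mult_distrib algebra_simps)
    finally have "d\<^sup>2 \<le> M * (1 + real (Suc m) * (2 * K)\<^sup>2 * (1 + cmod z)\<^sup>2) * \<epsilon>\<^sup>2"
      using u0 by simp
    also have "\<dots> \<le> M * ((1 + real (Suc m) * (2 * K)\<^sup>2) * (1 + cmod z)\<^sup>2) * \<epsilon>\<^sup>2"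
    proof (intro mult_right_mono mult_left_mono)
      have "1 \<le> (1 + cmod z)\<^sup>2" by (simp add: one_le_power)
      then show "1 + real (Suc m) * (2 * K)\<^sup>2 * (1 + cmod z)\<^sup>2 \<le> (1 + real (Suc m) * (2 * K)\<^sup>2) * (1 + cmod z)\<^sup>2"
        by (simp add: distrib_right)
    qed (use M in auto)
    also have "\<dots> = (C * (1 + cmod z) * \<epsilon>)\<^sup>2"
      using M(1) by (simp add: C_def power_mult_distrib)
    finally have "d \<le> C * (1 + cmod z) * \<epsilon>"
      by (rule power2_le_imp_le) (use C \<epsilon> in simp)
    then show ?thesis by (simp add: d_def \<epsilon>_def)
  qed
  with C show ?thesis by blast
qed

end

theorem theorem3p3:
  fixes a :: "nat \<Rightarrow> real \<times> real \<Rightarrow> complex" and m :: nat and \<theta> :: real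
  assumes smooth: "\<And>k. k \<le> m \<Longrightarrow> smooth2 (a k)"
    and periodic: "\<And>k. k \<le> m \<Longrightarrow> periodic2 (a k)"
    and elliptic: "\<And>p. a m p \<noteq> 0"
    and selfadj: "\<And>t y. self_adjoint_graph (op_graph a m t y)"
  shows "\<exists>C>0. \<exists>\<delta>>0. \<forall>\<theta>'. \<bar>\<theta> - \<theta>'\<bar> < \<delta> \<longrightarrow>
           (\<forall>z\<in>Sigma_spec a m \<theta>.
              infdist z (Sigma_spec a m \<theta>') \<le> C * (1 + cmod z) * sqrt \<bar>\<theta> - \<theta>'\<bar>)"
proof -
  interpret elliptic_family a m using assms by unfold_locales
  obtain C where "C > 0" "\<And>t' z. \<bar>\<theta> - t'\<bar> < 1 \<Longrightarrow> z \<in> Sigma_spec a m \<theta> \<Longrightarrow>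
     infdist z (Sigma_spec a m t') \<le> C * (1 + cmod z) * sqrt \<bar>\<theta> - t'\<bar>"
    using spectrum_distance by blast
  then show ?thesis by (intro exI[of _ C] exI[of _ 1] conjI) auto
qed

end
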